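(* Let $E$ be an arbitrary graph. If the graph C*-algebra $C^*(E)$ is a Zorn ring, then the graph $E$ satisfies Condition (L).
   Context: A ring $R$ (associative, not necessarily with identity) is a Zorn ring if for every $a \in R$, either $a$ is nilpotent or there is $b \in R$ such that $ab$ is a non-zero idempotent. A (directed) graph $E = (E^0, E^1, r, s)$ consists of two sets $E^0$ (vertices) and $E^1$ (edges) and maps $r, s : E^1 \to E^0$. No restriction is placed on the number of vertices or on the number of edges emitted by a vertex. A vertex $v$ is regular if $s^{-1}(v)$ is finite and non-empty. A path is a finite sequence of edges $\mu = e_1 \cdots e_n$ ($n \ge 1$) with $r(e_i) = s(e_{i+1})$ for $1 \le i \le n-1$. It is closed if $r(e_n) = s(e_1)$, and a closed path is simple if $s(e_i) \ne s(e_1)$ for all $i = 2, \dots, n$. An exit for a path $\mu = e_1 \cdots e_n$ is an edge $e$ such that $s(e) = s(e_i)$ and $e \neq e_i$ for some $i$. The graph $E$ satisfies Condition (L) if every simple closed path in $E$ has an exit. The graph C*-algebra $C^*(E)$ is the universal C*-algebra generated by mutually orthogonal projections $\{p_v : v \in E^0\}$ and partial isometries $\{s_e : e \in E^1\}$ with mutually orthogonal ranges such that $s_e^* s_e = p_{r(e)}$ and $s_e s_e^* \le p_{s(e)}$ for all $e \in E^1$, and $p_v = \sum_{e \in E^1, s(e) = v} s_e s_e^*$ for every regular vertex $v$. *)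

theory Defs
  imports
    "HOL-Analysis.Analysis"
    "HOL-Algebra.Module"
    "Graph_Theory.Digraph"
begin

section \<open>Zorn rings\<close>

text \<open>
  Rings need not have an identity.  They are represented by the ring records of HOL-Algebra,
  whose field \<open>one\<close> is ignored throughout: no definition below refers to it.
\<close>

locale rng = abelian_group R for R (structure) +
  assumes m_closed: "\<lbrakk>x \<in> carrier R; y \<in> carrier R\<rbrakk> \<Longrightarrow> x \<otimes> y \<in> carrier R"
    and m_assoc: "\<lbrakk>x \<in> carrier R; y \<in> carrier R; z \<in> carrier R\<rbrakk>
      \<Longrightarrow> (x \<otimes> y) \<otimes> z = x \<otimes> (y \<otimes> z)"
    and l_distr: "\<lbrakk>x \<in> carrier R; y \<in> carrier R; z \<in> carrier R\<rbrakk>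
      \<Longrightarrow> (x \<oplus> y) \<otimes> z = x \<otimes> z \<oplus> y \<otimes> z"
    and r_distr: "\<lbrakk>x \<in> carrier R; y \<in> carrier R; z \<in> carrier R\<rbrakk>
      \<Longrightarrow> z \<otimes> (x \<oplus> y) = z \<otimes> x \<oplus> z \<otimes> y"

text \<open>
  The \<open>n\<close>-fold iterate below is the power of \<open>a\<close> with exponent \<open>n + 1\<close>; the library's
  \<open>[^]\<close> starts from the identity and is not available.
\<close>

definition nilpotent_elem :: "('a, 'm) ring_scheme \<Rightarrow> 'a \<Rightarrow> bool" where
  "nilpotent_elem R a \<longleftrightarrow> (\<exists>n::nat. ((\<lambda>x. a \<otimes>\<^bsub>R\<^esub> x) ^^ n) a = \<zero>\<^bsub>R\<^esub>)"

definition idempotent_elem :: "('a, 'm) ring_scheme \<Rightarrow> 'a \<Rightarrow> bool" where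
  "idempotent_elem R e \<longleftrightarrow> e \<in> carrier R \<and> e \<otimes>\<^bsub>R\<^esub> e = e"

definition zorn_ring :: "('a, 'm) ring_scheme \<Rightarrow> bool" where
  "zorn_ring R \<longleftrightarrow> rng R \<and>
    (\<forall>a\<in>carrier R. nilpotent_elem R a \<or>
      (\<exists>b\<in>carrier R. idempotent_elem R (a \<otimes>\<^bsub>R\<^esub> b) \<and> a \<otimes>\<^bsub>R\<^esub> b \<noteq> \<zero>\<^bsub>R\<^esub>))"

section \<open>Graphs and Condition (L)\<close>

text \<open>
  A directed graph is a \<^const>\<open>wf_digraph\<close>, with source map \<^const>\<open>tail\<close> and range
  map \<^const>\<open>head\<close>; loops, parallel edges and arbitrary sets of vertices and edges are allowed.
\<close>

definition regular_vertex :: "('v, 'e) pre_digraph \<Rightarrow> 'v \<Rightarrow> bool" where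
  "regular_vertex G v \<longleftrightarrow> v \<in> verts G \<and> finite (out_arcs G v) \<and> out_arcs G v \<noteq> {}"

definition edge_path :: "('v, 'e) pre_digraph \<Rightarrow> 'e list \<Rightarrow> bool" where
  "edge_path G \<mu> \<longleftrightarrow> \<mu> \<noteq> [] \<and> set \<mu> \<subseteq> arcs G \<and>
    (\<forall>i. Suc i < length \<mu> \<longrightarrow> head G (\<mu> ! i) = tail G (\<mu> ! Suc i))"

definition closed_path :: "('v, 'e) pre_digraph \<Rightarrow> 'e list \<Rightarrow> bool" where
  "closed_path G \<mu> \<longleftrightarrow> edge_path G \<mu> \<and> head G (last \<mu>) = tail G (hd \<mu>)"

definition simple_closed_path :: "('v, 'e) pre_digraph \<Rightarrow> 'e list \<Rightarrow> bool" where
  "simple_closed_path G \<mu> \<longleftrightarrow> closed_path G \<mu> \<and>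
    (\<forall>i. 1 \<le> i \<and> i < length \<mu> \<longrightarrow> tail G (\<mu> ! i) \<noteq> tail G (hd \<mu>))"

definition is_exit :: "('v, 'e) pre_digraph \<Rightarrow> 'e list \<Rightarrow> 'e \<Rightarrow> bool" where
  "is_exit G \<mu> e \<longleftrightarrow> e \<in> arcs G \<and>
    (\<exists>i<length \<mu>. tail G e = tail G (\<mu> ! i) \<and> e \<noteq> \<mu> ! i)"

definition condition_L :: "('v, 'e) pre_digraph \<Rightarrow> bool" where
  "condition_L G \<longleftrightarrow> (\<forall>\<mu>. simple_closed_path G \<mu> \<longrightarrow> (\<exists>e. is_exit G \<mu> e))"

section \<open>C*-algebras\<close>

record 'a star_algebra = "(complex, 'a) module" +
  adj :: "'a \<Rightarrow> 'a"
  cnorm :: "'a \<Rightarrow> real"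

definition complex_ring :: "complex ring" where
  "complex_ring = \<lparr>carrier = UNIV, mult = (*), one = 1, zero = 0, add = (+)\<rparr>"

definition norm_lim :: "('a, 'm) star_algebra_scheme \<Rightarrow> (nat \<Rightarrow> 'a) \<Rightarrow> 'a \<Rightarrow> bool" where
  "norm_lim A f x \<longleftrightarrow> (\<lambda>n. cnorm A (f n \<ominus>\<^bsub>A\<^esub> x)) \<longlonglongrightarrow> 0"

locale cstar_algebra = rng A + V: module complex_ring A for A (structure) +
  assumes smult_mult_left: "\<lbrakk>x \<in> carrier A; y \<in> carrier A\<rbrakk> \<Longrightarrow> (c \<odot> x) \<otimes> y = c \<odot> (x \<otimes> y)"
    and smult_mult_right: "\<lbrakk>x \<in> carrier A; y \<in> carrier A\<rbrakk> \<Longrightarrow> x \<otimes> (c \<odot> y) = c \<odot> (x \<otimes> y)"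
    and adj_closed: "x \<in> carrier A \<Longrightarrow> adj A x \<in> carrier A"
    and adj_adj: "x \<in> carrier A \<Longrightarrow> adj A (adj A x) = x"
    and adj_add: "\<lbrakk>x \<in> carrier A; y \<in> carrier A\<rbrakk> \<Longrightarrow> adj A (x \<oplus> y) = adj A x \<oplus> adj A y"
    and adj_smult: "x \<in> carrier A \<Longrightarrow> adj A (c \<odot> x) = cnj c \<odot> adj A x"
    and adj_mult: "\<lbrakk>x \<in> carrier A; y \<in> carrier A\<rbrakk> \<Longrightarrow> adj A (x \<otimes> y) = adj A y \<otimes> adj A x"
    and cnorm_nonneg: "x \<in> carrier A \<Longrightarrow> 0 \<le> cnorm A x"
    and cnorm_eq_0: "x \<in> carrier A \<Longrightarrow> cnorm A x = 0 \<longleftrightarrow> x = \<zero>"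
    and cnorm_smult: "x \<in> carrier A \<Longrightarrow> cnorm A (c \<odot> x) = cmod c * cnorm A x"
    and cnorm_triangle: "\<lbrakk>x \<in> carrier A; y \<in> carrier A\<rbrakk>
      \<Longrightarrow> cnorm A (x \<oplus> y) \<le> cnorm A x + cnorm A y"
    and cnorm_mult: "\<lbrakk>x \<in> carrier A; y \<in> carrier A\<rbrakk>
      \<Longrightarrow> cnorm A (x \<otimes> y) \<le> cnorm A x * cnorm A y"
    and cstar_identity: "x \<in> carrier A \<Longrightarrow> cnorm A (adj A x \<otimes> x) = (cnorm A x)\<^sup>2"
    and complete: "\<lbrakk>\<And>n. f n \<in> carrier A;
      \<And>\<epsilon>. \<epsilon> > 0 \<Longrightarrow> \<exists>N. \<forall>m\<ge>N. \<forall>n\<ge>N. cnorm A (f m \<ominus> f n) < \<epsilon>\<rbrakk>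
      \<Longrightarrow> \<exists>x\<in>carrier A. norm_lim A f x"

definition star_hom :: "'a star_algebra \<Rightarrow> 'b star_algebra \<Rightarrow> ('a \<Rightarrow> 'b) \<Rightarrow> bool" where
  "star_hom A B \<phi> \<longleftrightarrow> \<phi> \<in> carrier A \<rightarrow> carrier B \<and>
    (\<forall>x\<in>carrier A. \<forall>y\<in>carrier A. \<phi> (x \<oplus>\<^bsub>A\<^esub> y) = \<phi> x \<oplus>\<^bsub>B\<^esub> \<phi> y) \<and>
    (\<forall>x\<in>carrier A. \<forall>y\<in>carrier A. \<phi> (x \<otimes>\<^bsub>A\<^esub> y) = \<phi> x \<otimes>\<^bsub>B\<^esub> \<phi> y) \<and>
    (\<forall>c. \<forall>x\<in>carrier A. \<phi> (c \<odot>\<^bsub>A\<^esub> x) = c \<odot>\<^bsub>B\<^esub> \<phi> x) \<and>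
    (\<forall>x\<in>carrier A. \<phi> (adj A x) = adj B (\<phi> x))"

definition closed_star_subalgebra :: "'a star_algebra \<Rightarrow> 'a set \<Rightarrow> bool" where
  "closed_star_subalgebra A D \<longleftrightarrow> D \<subseteq> carrier A \<and> \<zero>\<^bsub>A\<^esub> \<in> D \<and>
    (\<forall>x\<in>D. \<forall>y\<in>D. x \<oplus>\<^bsub>A\<^esub> y \<in> D) \<and>
    (\<forall>x\<in>D. \<forall>y\<in>D. x \<otimes>\<^bsub>A\<^esub> y \<in> D) \<and>
    (\<forall>c. \<forall>x\<in>D. c \<odot>\<^bsub>A\<^esub> x \<in> D) \<and>
    (\<forall>x\<in>D. adj A x \<in> D) \<and>
    (\<forall>f x. (\<forall>n. f n \<in> D) \<and> x \<in> carrier A \<and> norm_lim A f x \<longrightarrow> x \<in> D)"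

definition generates :: "'a star_algebra \<Rightarrow> 'a set \<Rightarrow> bool" where
  "generates A X \<longleftrightarrow> (\<forall>D. closed_star_subalgebra A D \<and> X \<subseteq> D \<longrightarrow> D = carrier A)"

definition projection :: "'a star_algebra \<Rightarrow> 'a \<Rightarrow> bool" where
  "projection A p \<longleftrightarrow> p \<in> carrier A \<and> adj A p = p \<and> p \<otimes>\<^bsub>A\<^esub> p = p"

definition orthogonal_projections :: "'a star_algebra \<Rightarrow> 'a \<Rightarrow> 'a \<Rightarrow> bool" where
  "orthogonal_projections A p q \<longleftrightarrow> projection A p \<and> projection A q \<and> p \<otimes>\<^bsub>A\<^esub> q = \<zero>\<^bsub>A\<^esub>"

definition projection_le :: "'a star_algebra \<Rightarrow> 'a \<Rightarrow> 'a \<Rightarrow> bool" where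
  "projection_le A p q \<longleftrightarrow> projection A p \<and> projection A q \<and> p \<otimes>\<^bsub>A\<^esub> q = p \<and> q \<otimes>\<^bsub>A\<^esub> p = p"

definition partial_isometry :: "'a star_algebra \<Rightarrow> 'a \<Rightarrow> bool" where
  "partial_isometry A s \<longleftrightarrow> s \<in> carrier A \<and> s \<otimes>\<^bsub>A\<^esub> adj A s \<otimes>\<^bsub>A\<^esub> s = s"

definition range_proj :: "'a star_algebra \<Rightarrow> 'a \<Rightarrow> 'a" where
  "range_proj A s = s \<otimes>\<^bsub>A\<^esub> adj A s"

section \<open>Graph C*-algebras\<close>

definition graph_family ::
  "('v, 'e) pre_digraph \<Rightarrow> 'a star_algebra \<Rightarrow> ('v \<Rightarrow> 'a) \<Rightarrow> ('e \<Rightarrow> 'a) \<Rightarrow> bool" where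
  "graph_family G A p s \<longleftrightarrow>
    (\<forall>v\<in>verts G. projection A (p v)) \<and>
    (\<forall>v\<in>verts G. \<forall>w\<in>verts G. v \<noteq> w \<longrightarrow> orthogonal_projections A (p v) (p w)) \<and>
    (\<forall>e\<in>arcs G. partial_isometry A (s e)) \<and>
    (\<forall>e\<in>arcs G. \<forall>f\<in>arcs G. e \<noteq> f \<longrightarrow>
      orthogonal_projections A (range_proj A (s e)) (range_proj A (s f))) \<and>
    (\<forall>e\<in>arcs G. adj A (s e) \<otimes>\<^bsub>A\<^esub> s e = p (head G e)) \<and>
    (\<forall>e\<in>arcs G. projection_le A (range_proj A (s e)) (p (tail G e))) \<and>
    (\<forall>v. regular_vertex G v \<longrightarrow> p v = (\<Oplus>\<^bsub>A\<^esub>e\<in>out_arcs G v. range_proj A (s e)))"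

text \<open>
  A universal property refers to all C*-algebras, but a formula can quantify only over those
  carried by subsets of one fixed type.  The type of formal expressions below is large enough:
  every element of the closed *-subalgebra generated by a family indexed by vertices and edges is
  the value of some expression, and so that subalgebra is isomorphic to one carried by a set of
  expressions.  Theorem \<open>graph_cstar_universal\<close> below derives the universal property for
  C*-algebras over arbitrary types from its instance at this type.
\<close>

datatype ('v, 'e) cexpr =
    Vertex 'v
  | Edge 'e
  | Zero
  | Add "('v, 'e) cexpr" "('v, 'e) cexpr"
  | Mult "('v, 'e) cexpr" "('v, 'e) cexpr"
  | Smult complex "('v, 'e) cexpr"
  | Adj "('v, 'e) cexpr"
  | Limit "nat \<Rightarrow> ('v, 'e) cexpr"

definition graph_cstar_algebra ::
  "('v, 'e) pre_digraph \<Rightarrow> 'a star_algebra \<Rightarrow> ('v \<Rightarrow> 'a) \<Rightarrow> ('e \<Rightarrow> 'a) \<Rightarrow> bool" where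
  "graph_cstar_algebra G A p s \<longleftrightarrow>
    cstar_algebra A \<and> graph_family G A p s \<and> generates A (p ` verts G \<union> s ` arcs G) \<and>
    (\<forall>(B :: ('v, 'e) cexpr star_algebra) q t. cstar_algebra B \<and> graph_family G B q t \<longrightarrow>
      (\<exists>\<phi>. star_hom A B \<phi> \<and> (\<forall>v\<in>verts G. \<phi> (p v) = q v) \<and> (\<forall>e\<in>arcs G. \<phi> (s e) = t e)))"

subsection \<open>The universal property for C*-algebras over arbitrary types\<close>

context cstar_algebra
begin

lemma smult_in: "x \<in> carrier A \<Longrightarrow> c \<odot> x \<in> carrier A"
  by (rule V.smult_closed) (simp_all add: complex_ring_def)

lemma uminus_eq: "x \<in> carrier A \<Longrightarrow> \<ominus> x = (-1) \<odot> x"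
proof -
  assume x: "x \<in> carrier A"
  have "(-1) \<odot> x \<oplus> x = (-1 + 1) \<odot> x"
    using x V.smult_l_distr[of "-1" 1 x] V.smult_one[OF x] by (simp add: complex_ring_def)
  also have "\<dots> = \<zero>"
    using V.smult_l_null[OF x] by (simp add: complex_ring_def)
  finally show ?thesis
    using x smult_in by (metis minus_equality)
qed

lemma norm_lim_unique:
  assumes f: "\<And>n. f n \<in> carrier A" and xy: "x \<in> carrier A" "y \<in> carrier A"
    and lim: "norm_lim A f x" "norm_lim A f y"
  shows "x = y"
proof -
  have le: "cnorm A (x \<ominus> y) \<le> cnorm A (f n \<ominus> x) + cnorm A (f n \<ominus> y)" for n
  proof -
    have "x \<ominus> y = (-1) \<odot> (f n \<ominus> x) \<oplus> (f n \<ominus> y)"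
    proof -
      have "(-1) \<odot> (f n \<ominus> x) = \<ominus> (f n \<ominus> x)"
        using f xy by (simp add: uminus_eq)
      also have "\<dots> = x \<ominus> f n"
        using f[of n] xy by (simp add: minus_eq minus_add a_comm)
      finally show ?thesis
        using f[of n] xy by (simp add: minus_eq a_assoc r_neg1 r_neg2)
    qed
    then show ?thesis
      using cnorm_triangle[of "(-1) \<odot> (f n \<ominus> x)" "f n \<ominus> y"] f xy
      by (simp add: cnorm_smult smult_in)
  qed
  have "(\<lambda>n. cnorm A (f n \<ominus> x) + cnorm A (f n \<ominus> y)) \<longlonglongrightarrow> 0 + 0"
    using lim unfolding norm_lim_def by (rule tendsto_add)
  then have "cnorm A (x \<ominus> y) \<le> 0"
    using le by (intro LIMSEQ_le_const) auto
  then have "x \<ominus> y = \<zero>"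
    using xy cnorm_eq_0[of "x \<ominus> y"] cnorm_nonneg[of "x \<ominus> y"] by simp
  moreover have "x = (x \<ominus> y) \<oplus> y"
    using xy by (simp add: minus_eq a_assoc l_neg)
  ultimately show ?thesis
    using xy by simp
qed

end

definition transport :: "'a star_algebra \<Rightarrow> 'a set \<Rightarrow> ('a \<Rightarrow> 'b) \<Rightarrow> 'b star_algebra" where
  "transport A D g = (let h = inv_into D g in
    \<lparr>carrier = g ` D, mult = (\<lambda>x y. g (h x \<otimes>\<^bsub>A\<^esub> h y)), one = undefined, zero = g \<zero>\<^bsub>A\<^esub>,
     add = (\<lambda>x y. g (h x \<oplus>\<^bsub>A\<^esub> h y)), smult = (\<lambda>c x. g (c \<odot>\<^bsub>A\<^esub> h x)),
     adj = (\<lambda>x. g (adj A (h x))), cnorm = (\<lambda>x. cnorm A (h x))\<rparr>)"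

locale transported = cstar_algebra A for A :: "'a star_algebra" (structure) +
  fixes D :: "'a set" and g :: "'a \<Rightarrow> 'b" and B :: "'b star_algebra"
  assumes D: "closed_star_subalgebra A D" and inj: "inj_on g D" and B: "B = transport A D g"
begin

abbreviation "h \<equiv> inv_into D g"

lemma hg [simp]: "x \<in> D \<Longrightarrow> h (g x) = x"
  using inj by (simp add: inv_into_f_f)

lemma D_ops:
  shows D_carrier: "x \<in> D \<Longrightarrow> x \<in> carrier A"
    and D_zero: "\<zero> \<in> D"
    and D_add: "x \<in> D \<Longrightarrow> y \<in> D \<Longrightarrow> x \<oplus> y \<in> D"
    and D_mult: "x \<in> D \<Longrightarrow> y \<in> D \<Longrightarrow> x \<otimes> y \<in> D"
    and D_smult: "x \<in> D \<Longrightarrow> c \<odot> x \<in> D"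
    and D_adj: "x \<in> D \<Longrightarrow> adj A x \<in> D"
    and D_lim: "(\<And>n. f n \<in> D) \<Longrightarrow> x \<in> carrier A \<Longrightarrow> norm_lim A f x \<Longrightarrow> x \<in> D"
  using D unfolding closed_star_subalgebra_def by blast+

lemma D_uminus: "x \<in> D \<Longrightarrow> \<ominus> x \<in> D"
  using D_smult[of x "-1"] by (simp add: uminus_eq D_carrier)

lemma D_minus: "x \<in> D \<Longrightarrow> y \<in> D \<Longrightarrow> x \<ominus> y \<in> D"
  by (simp add: minus_eq D_add D_uminus)

lemma B_ops:
  shows B_carrier: "carrier B = g ` D"
    and B_zero: "\<zero>\<^bsub>B\<^esub> = g \<zero>"
    and B_add: "x \<in> D \<Longrightarrow> y \<in> D \<Longrightarrow> g x \<oplus>\<^bsub>B\<^esub> g y = g (x \<oplus> y)"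
    and B_mult: "x \<in> D \<Longrightarrow> y \<in> D \<Longrightarrow> g x \<otimes>\<^bsub>B\<^esub> g y = g (x \<otimes> y)"
    and B_smult: "x \<in> D \<Longrightarrow> c \<odot>\<^bsub>B\<^esub> g x = g (c \<odot> x)"
    and B_adj: "x \<in> D \<Longrightarrow> adj B (g x) = g (adj A x)"
    and B_norm: "x \<in> D \<Longrightarrow> cnorm B (g x) = cnorm A x"
  by (simp_all add: B transport_def Let_def)

lemma g_eq: "x \<in> D \<Longrightarrow> y \<in> D \<Longrightarrow> g x = g y \<longleftrightarrow> x = y"
  using inj by (auto dest: inj_onD)

lemma B_abelian_group: "abelian_group B"
proof (rule abelian_groupI, goal_cases)
  case (6 x)
  then obtain a where a: "a \<in> D" "x = g a" by (auto simp: B_carrier)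
  show ?case
    by (rule bexI[of _ "g (\<ominus> a)"])
      (use a in \<open>auto simp: B_add B_zero B_carrier D_uminus l_neg D_carrier\<close>)
qed (auto simp: B_carrier B_zero B_add D_zero D_add a_ac D_carrier)

lemma B_minus: "x \<in> D \<Longrightarrow> y \<in> D \<Longrightarrow> g x \<ominus>\<^bsub>B\<^esub> g y = g (x \<ominus> y)"
proof -
  assume xy: "x \<in> D" "y \<in> D"
  interpret B: abelian_group B by (rule B_abelian_group)
  have "g (\<ominus> y) \<oplus>\<^bsub>B\<^esub> g y = \<zero>\<^bsub>B\<^esub>"
    using xy by (simp add: B_add D_uminus B_zero l_neg D_carrier)
  then have "\<ominus>\<^bsub>B\<^esub> g y = g (\<ominus> y)"
    using xy by (intro B.minus_equality) (auto simp: B_carrier D_uminus)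
  then show ?thesis
    using xy by (simp add: a_minus_def B_add D_uminus)
qed

lemma B_complete:
  assumes f: "\<And>n. f n \<in> carrier B"
    and Cauchy: "\<And>\<epsilon>. \<epsilon> > 0 \<Longrightarrow> \<exists>N. \<forall>m\<ge>N. \<forall>n\<ge>N. cnorm B (f m \<ominus>\<^bsub>B\<^esub> f n) < \<epsilon>"
  shows "\<exists>x\<in>carrier B. norm_lim B f x"
proof -
  define k where "k = (\<lambda>n. h (f n))"
  have k: "k n \<in> D" "f n = g (k n)" for n
    using f[of n] by (auto simp: k_def B_carrier)
  have "\<exists>N. \<forall>m\<ge>N. \<forall>n\<ge>N. cnorm A (k m \<ominus> k n) < \<epsilon>" if "\<epsilon> > 0" for \<epsilon>
    using Cauchy[OF that] k by (simp add: B_minus B_norm D_minus)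
  then obtain x where x: "x \<in> carrier A" "norm_lim A k x"
    using complete[of k] k D_carrier by blast
  then have "x \<in> D" using k D_lim by blast
  then have "norm_lim B f (g x)"
    using x k by (simp add: norm_lim_def B_minus B_norm D_minus)
  then show ?thesis using \<open>x \<in> D\<close> by (auto simp: B_carrier)
qed

lemma B_cstar: "cstar_algebra B"
proof -
  interpret BG: abelian_group B by (rule B_abelian_group)
  have cx: "a \<in> carrier complex_ring" for a
    by (simp add: complex_ring_def)
  note ops = D_ops(1-6) B_ops
  have "rng B"
    by unfold_locales
      (auto simp: ops m_assoc l_distr r_distr)
  moreover have "module complex_ring B"
    using V.smult_l_distr[OF cx cx] V.smult_r_distr[OF cx] V.smult_assoc1[OF cx cx] V.smult_one
    by (intro moduleI V.R.is_cring B_abelian_group) (auto simp: ops)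
  moreover have "cstar_algebra_axioms B"
  proof (unfold_locales, goal_cases)
    case (14 f)
    then show ?case by (rule B_complete)
  qed (auto simp: ops g_eq smult_mult_left smult_mult_right adj_adj adj_add adj_smult adj_mult
      cnorm_nonneg cnorm_eq_0 cnorm_smult cnorm_triangle cnorm_mult cstar_identity)
  ultimately show ?thesis
    by (simp add: cstar_algebra_def)
qed

lemma B_finsum:
  assumes "finite F" "\<And>i. i \<in> F \<Longrightarrow> k i \<in> D"
  shows "(\<Oplus>\<^bsub>A\<^esub>i\<in>F. k i) \<in> D \<and> (\<Oplus>\<^bsub>B\<^esub>i\<in>F. g (k i)) = g (\<Oplus>\<^bsub>A\<^esub>i\<in>F. k i)"
  using assms
proof (induction F rule: finite_induct)
  case empty
  interpret BG: abelian_group B by (rule B_abelian_group)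
  show ?case by (simp add: D_zero B_zero)
next
  case (insert i F)
  interpret BG: abelian_group B by (rule B_abelian_group)
  have "(\<Oplus>\<^bsub>A\<^esub>j\<in>insert i F. k j) = k i \<oplus> (\<Oplus>\<^bsub>A\<^esub>j\<in>F. k j)"
    using insert by (intro finsum_insert) (auto simp: D_carrier)
  moreover have "(\<Oplus>\<^bsub>B\<^esub>j\<in>insert i F. g (k j)) = g (k i) \<oplus>\<^bsub>B\<^esub> (\<Oplus>\<^bsub>B\<^esub>j\<in>F. g (k j))"
    using insert by (intro BG.finsum_insert) (auto simp: B_carrier)
  ultimately show ?case
    using insert by (simp add: B_add D_add)
qed

lemma B_projection: "x \<in> D \<Longrightarrow> projection B (g x) \<longleftrightarrow> projection A x"
  by (simp add: projection_def B_ops g_eq D_ops(1-6))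

lemma B_graph_family:
  assumes wf: "wf_digraph G" and fam: "graph_family G A q t"
    and q: "\<And>v. v \<in> verts G \<Longrightarrow> q v \<in> D" and t: "\<And>e. e \<in> arcs G \<Longrightarrow> t e \<in> D"
  shows "graph_family G B (g \<circ> q) (g \<circ> t)"
proof -
  interpret wf_digraph G by (rule wf)
  have rp: "range_proj A (t e) \<in> D" "range_proj B (g (t e)) = g (range_proj A (t e))"
    if "e \<in> arcs G" for e
    using t[OF that] by (simp_all add: range_proj_def D_ops(1-6) B_ops)
  have "g (q v) = (\<Oplus>\<^bsub>B\<^esub>e\<in>out_arcs G v. range_proj B (g (t e)))" if v: "regular_vertex G v" for v
  proof -
    interpret BG: abelian_group B by (rule B_abelian_group)
    have fin: "finite (out_arcs G v)" and sub: "\<And>e. e \<in> out_arcs G v \<Longrightarrow> e \<in> arcs G"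
      using v by (auto simp: regular_vertex_def)
    have "(\<Oplus>\<^bsub>B\<^esub>e\<in>out_arcs G v. range_proj B (g (t e)))
        = (\<Oplus>\<^bsub>B\<^esub>e\<in>out_arcs G v. g (range_proj A (t e)))"
      by (rule BG.finsum_cong') (use sub rp in \<open>auto simp: B_carrier\<close>)
    also have "\<dots> = g (\<Oplus>\<^bsub>A\<^esub>e\<in>out_arcs G v. range_proj A (t e))"
      using B_finsum[of "out_arcs G v" "\<lambda>e. range_proj A (t e)"] fin sub rp by blast
    finally show ?thesis
      using fam v by (simp add: graph_family_def)
  qed
  moreover have "\<forall>e\<in>arcs G. adj A (t e) \<in> D" and "\<forall>e\<in>arcs G. q (head G e) \<in> D"
    and "\<forall>e\<in>arcs G. q (tail G e) \<in> D"
    using t q by (auto simp: D_adj)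
  ultimately show ?thesis
    using fam q t rp
    by (simp add: graph_family_def orthogonal_projections_def projection_le_def
        partial_isometry_def B_projection B_ops g_eq D_ops(1-6))
qed

lemma h_hom: "star_hom B A h"
  by (auto simp: star_hom_def B_ops D_ops(1-6))

end

lemma star_hom_comp: "star_hom A B \<phi> \<Longrightarrow> star_hom B C \<psi> \<Longrightarrow> star_hom A C (\<psi> \<circ> \<phi>)"
  unfolding star_hom_def by (auto simp: Pi_iff)

inductive denotes :: "('v, 'e) pre_digraph \<Rightarrow> 'b star_algebra \<Rightarrow> ('v \<Rightarrow> 'b) \<Rightarrow> ('e \<Rightarrow> 'b) \<Rightarrow>
    ('v, 'e) cexpr \<Rightarrow> 'b \<Rightarrow> bool"
  for G B q t where
    "v \<in> verts G \<Longrightarrow> denotes G B q t (Vertex v) (q v)"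
  | "e \<in> arcs G \<Longrightarrow> denotes G B q t (Edge e) (t e)"
  | "denotes G B q t Zero \<zero>\<^bsub>B\<^esub>"
  | "denotes G B q t a x \<Longrightarrow> denotes G B q t b y \<Longrightarrow> denotes G B q t (Add a b) (x \<oplus>\<^bsub>B\<^esub> y)"
  | "denotes G B q t a x \<Longrightarrow> denotes G B q t b y \<Longrightarrow> denotes G B q t (Mult a b) (x \<otimes>\<^bsub>B\<^esub> y)"
  | "denotes G B q t a x \<Longrightarrow> denotes G B q t (Smult c a) (c \<odot>\<^bsub>B\<^esub> x)"
  | "denotes G B q t a x \<Longrightarrow> denotes G B q t (Adj a) (adj B x)"
  | "(\<And>n. denotes G B q t (F n) (f n)) \<Longrightarrow> x \<in> carrier B \<Longrightarrow> norm_lim B f x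
      \<Longrightarrow> denotes G B q t (Limit F) x"

inductive_cases denotes_elims:
  "denotes G B q t (Vertex v) z"
  "denotes G B q t (Edge e) z"
  "denotes G B q t Zero z"
  "denotes G B q t (Add a b) z"
  "denotes G B q t (Mult a b) z"
  "denotes G B q t (Smult c a) z"
  "denotes G B q t (Adj a) z"
  "denotes G B q t (Limit F) z"

lemma denotes_carrier:
  assumes "cstar_algebra B" "graph_family G B q t" "denotes G B q t a x"
  shows "x \<in> carrier B"
proof -
  interpret cstar_algebra B by fact
  from assms(3) show ?thesis
    by induction
      (use assms(2) in \<open>auto simp: graph_family_def projection_def partial_isometry_def
        m_closed smult_in adj_closed\<close>)
qed

lemma denotes_unique:
  assumes "cstar_algebra B" "graph_family G B q t" "denotes G B q t a x" "denotes G B q t a y"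
  shows "x = y"
proof -
  interpret cstar_algebra B by fact
  from assms(3,4) show ?thesis
  proof (induction arbitrary: y)
    case (8 F f x)
    from "8.prems" obtain f' where f': "\<And>n. denotes G B q t (F n) (f' n)" "y \<in> carrier B" "norm_lim B f' y"
      by (rule denotes_elims) blast
    have "f n = f' n" for n
      using "8.IH" f'(1) by blast
    then have "f = f'" by blast
    moreover have "f n \<in> carrier B" for n
      using denotes_carrier[OF assms(1,2)] "8.IH" "8.hyps" by blast
    ultimately show ?case
      using norm_lim_unique[of f x y] "8.hyps" f' by blast
  qed (erule denotes_elims; blast)+
qed

theorem graph_cstar_universal:
  fixes G :: "('v, 'e) pre_digraph" and A :: "'a star_algebra" and B :: "'b star_algebra"
  assumes wf: "wf_digraph G" and A: "graph_cstar_algebra G A p s"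
    and B: "cstar_algebra B" and fam: "graph_family G B q t"
  shows "\<exists>\<phi>. star_hom A B \<phi> \<and> (\<forall>v\<in>verts G. \<phi> (p v) = q v) \<and> (\<forall>e\<in>arcs G. \<phi> (s e) = t e)"
proof -
  define D where "D = {x. \<exists>a. denotes G B q t a x}"
  define g where "g = (\<lambda>x. SOME a. denotes G B q t a x)"
  have g: "denotes G B q t (g x) x" if "x \<in> D" for x
    using that unfolding D_def g_def by (auto intro: someI)
  interpret cstar_algebra B by (rule B)
  have "x \<in> D" if "\<And>n. f n \<in> D" "x \<in> carrier B" "norm_lim B f x" for f x
    using denotes.intros(8)[of G B q t "\<lambda>n. g (f n)" f x] g that by (auto simp: D_def)
  then have "closed_star_subalgebra B D"
    unfolding closed_star_subalgebra_def using denotes_carrier[OF B fam]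
    by (auto simp: D_def intro: denotes.intros)
  moreover have "inj_on g D"
    by (rule inj_onI) (metis g denotes_unique[OF B fam])
  ultimately interpret transported B D g "transport B D g"
    by unfold_locales auto
  have qt: "\<And>v. v \<in> verts G \<Longrightarrow> q v \<in> D" "\<And>e. e \<in> arcs G \<Longrightarrow> t e \<in> D"
    by (auto simp: D_def intro: denotes.intros)
  obtain \<phi> where \<phi>: "star_hom A (transport B D g) \<phi>"
    "\<forall>v\<in>verts G. \<phi> (p v) = (g \<circ> q) v" "\<forall>e\<in>arcs G. \<phi> (s e) = (g \<circ> t) e"
    using A B_cstar B_graph_family[OF wf fam qt] unfolding graph_cstar_algebra_def by blast
  then have "star_hom A B (h \<circ> \<phi>)"
    using h_hom star_hom_comp by blast
  then show ?thesis
    using \<phi> qt by (intro exI[of _ "h \<circ> \<phi>"]) auto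
qed

end

theory Submission
  imports
    Defs
    "HOL-Complex_Analysis.Cauchy_Integral_Formula"
    "HOL-Computational_Algebra.Polynomial"
    "HOL-Library.Stream"
    "Graph_Theory.Arc_Walk"
begin

text \<open>
  Suppose that a simple closed path \<open>\<mu>\<close> based at a vertex \<open>v\<close> has no exit.  Let \<open>p\<close> be the
  projection of \<open>v\<close> and \<open>u\<close> the product of the partial isometries along \<open>\<mu>\<close>.  Every vertex of
  \<open>\<mu>\<close> is regular and emits a single edge, so \<open>u\<close> is a unitary of the corner \<open>pAp\<close>, and in fact
  this corner is the algebra of continuous functions on the unit circle with \<open>u\<close> as the
  coordinate function.  There \<open>p - u\<close> is the function \<open>1 - z\<close>.  It is not nilpotent, and an
  idempotent multiple of it vanishes at \<open>z = 1\<close>, hence everywhere because the circle is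
  connected.  Since a non-zero idempotent \<open>f = (p - u)b\<close> of \<open>A\<close> yields the non-zero idempotent
  \<open>e = fp\<close> of the corner, the Zorn property fails.

  The proof below follows this idea without Gelfand theory; three facts about the corner take its
  place.

  Density.  Every element of \<open>pAp\<close> is a limit of Laurent polynomials in \<open>u\<close>
  (\<open>corner_laurent_approximable\<close>).  Indeed \<open>pA\<close> is the closed span of the elements \<open>u\<^sup>k s\<^sub>\<beta>\<^sup>*\<close> with
  \<open>\<beta>\<close> a path into \<open>v\<close>, because right multiplication by a generator or its adjoint maps each of
  them to such an element or to zero; and a path \<open>\<beta>\<close> from \<open>v\<close> to \<open>v\<close> can only go round the cycle.

  Evaluation.  The graph acts on the square-summable families indexed by its infinite paths, an
  edge acting by prefixing, and the edge operators may be multiplied by any scalar of modulus one.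
  The periodic path \<open>\<mu>\<mu>\<mu>\<dots>\<close> gives an eigenvector of \<open>u\<close>, with any prescribed eigenvalue \<open>w\<close> on
  the unit circle (\<open>cycle_eigenvector_representation\<close>).  Homomorphisms into the operators are
  contractive (\<open>star_hom_contractive\<close>), so by density this vector is an eigenvector of the whole
  corner, and an idempotent \<open>e\<close> near a Laurent polynomial \<open>u\<^sup>-\<^sup>mP(u)\<close> has an eigenvalue in
  \<open>{0, 1}\<close> that is near \<open>w\<^sup>-\<^sup>mP(w)\<close>.
  For \<open>e = (p - u)b\<close> the eigenvalue at \<open>w = 1\<close> is \<open>0\<close>, and connectedness makes the modulus of
  \<open>P\<close> small on the whole circle.

  Norm.  It remains to see that \<open>e = 0\<close>, that is, that the eigenvalues detect \<open>e\<close>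
  (\<open>idempotent_near_small_laurent_eq_0\<close>).  If \<open>|P|\<close> is at most \<open>1/4\<close> on the circle, the coefficients
  of \<open>P\<^sup>N\<close> are at most \<open>1/4\<^sup>N\<close> by Cauchy's inequality, so the norm of \<open>P(u)\<^sup>N\<close> decays like \<open>1/4\<^sup>N\<close> up
  to a factor linear in \<open>N\<close>.  An idempotent \<open>e\<close> within \<open>1/4\<close> of \<open>u\<^sup>-\<^sup>mP(u)\<close> satisfies
  \<open>\<parallel>e P(u)\<^sup>N\<parallel> \<ge> (3/4)\<^sup>N \<parallel>e\<parallel>\<close>, which is incompatible with that decay unless \<open>e = 0\<close>.
\<close>

section \<open>Square-summable families\<close>

text \<open>
  The inner product is real-valued: it is the real part of the usual one, which makes the space an
  instance of \<^class>\<open>real_inner\<close>.  The complex structure is recovered from the maps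
  \<open>scale_ell2\<close> introduced below.
\<close>

typedef 'i ell2 = "{f :: 'i \<Rightarrow> complex. (\<lambda>i. (cmod (f i))\<^sup>2) summable_on UNIV}"
  morphisms coord Abs_ell2
  by (rule exI[of _ "\<lambda>_. 0"]) simp

setup_lifting type_definition_ell2

lemma coord_summable: "(\<lambda>i. (cmod (coord x i))\<^sup>2) summable_on UNIV"
  using coord[of x] by simp

lemma ell2_eqI: "(\<And>i. coord x i = coord y i) \<Longrightarrow> x = y"
  by (simp add: coord_inject[symmetric] ext)

lemma square_summable_add:
  fixes f g :: "'i \<Rightarrow> complex"
  assumes "(\<lambda>i. (cmod (f i))\<^sup>2) summable_on UNIV" "(\<lambda>i. (cmod (g i))\<^sup>2) summable_on UNIV"
  shows "(\<lambda>i. (cmod (f i + g i))\<^sup>2) summable_on UNIV"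
proof (rule summable_on_comparison_test)
  show "(\<lambda>i. 2 * (cmod (f i))\<^sup>2 + 2 * (cmod (g i))\<^sup>2) summable_on UNIV"
    by (intro summable_on_add summable_on_cmult_right assms)
  fix i
  have "(cmod (f i + g i))\<^sup>2 \<le> (cmod (f i) + cmod (g i))\<^sup>2"
    by (intro power_mono norm_triangle_ineq) simp
  also have "\<dots> \<le> 2 * (cmod (f i))\<^sup>2 + 2 * (cmod (g i))\<^sup>2"
    using sum_squares_bound[of "cmod (f i)" "cmod (g i)"] by (simp add: power2_sum)
  finally show "(cmod (f i + g i))\<^sup>2 \<le> 2 * (cmod (f i))\<^sup>2 + 2 * (cmod (g i))\<^sup>2" .
qed simp

lemma square_summable_mult:
  fixes f :: "'i \<Rightarrow> complex"
  assumes "(\<lambda>i. (cmod (f i))\<^sup>2) summable_on UNIV"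
  shows "(\<lambda>i. (cmod (c * f i))\<^sup>2) summable_on UNIV"
  using assms by (simp add: norm_mult power_mult_distrib summable_on_cmult_right)

instantiation ell2 :: (type) real_vector
begin

lift_definition zero_ell2 :: "'a ell2" is "\<lambda>_. 0" by simp
lift_definition plus_ell2 :: "'a ell2 \<Rightarrow> 'a ell2 \<Rightarrow> 'a ell2" is "\<lambda>f g i. f i + g i"
  by (rule square_summable_add)
lift_definition uminus_ell2 :: "'a ell2 \<Rightarrow> 'a ell2" is "\<lambda>f i. - f i" by simp
definition minus_ell2 :: "'a ell2 \<Rightarrow> 'a ell2 \<Rightarrow> 'a ell2" where "minus_ell2 x y = x + (- y)"
lift_definition scaleR_ell2 :: "real \<Rightarrow> 'a ell2 \<Rightarrow> 'a ell2" is "\<lambda>r f i. of_real r * f i"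
  by (rule square_summable_mult)

instance
proof
  fix x y z :: "'a ell2" and r s :: real
  show "x + y + z = x + (y + z)" by transfer (simp add: add.assoc)
  show "x + y = y + x" by transfer (simp add: add.commute)
  show "0 + x = x" by transfer simp
  show "- x + x = 0" by transfer simp
  show "x - y = x + - y" by (rule minus_ell2_def)
  show "r *\<^sub>R (x + y) = r *\<^sub>R x + r *\<^sub>R y" by transfer (simp add: algebra_simps)
  show "(r + s) *\<^sub>R x = r *\<^sub>R x + s *\<^sub>R x" by transfer (simp add: algebra_simps)
  show "r *\<^sub>R s *\<^sub>R x = (r * s) *\<^sub>R x" by transfer (simp add: algebra_simps)
  show "1 *\<^sub>R x = x" by transfer simp
qed

end

instantiation ell2 :: (type) real_inner
begin

definition inner_ell2 :: "'a ell2 \<Rightarrow> 'a ell2 \<Rightarrow> real" where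
  "inner_ell2 x y = (\<Sum>\<^sub>\<infinity>i. inner (coord x i) (coord y i))"
definition norm_ell2 :: "'a ell2 \<Rightarrow> real" where "norm_ell2 x = sqrt (inner x x)"
definition dist_ell2 :: "'a ell2 \<Rightarrow> 'a ell2 \<Rightarrow> real" where "dist_ell2 x y = norm (x - y)"
definition sgn_ell2 :: "'a ell2 \<Rightarrow> 'a ell2" where "sgn_ell2 x = x /\<^sub>R norm x"
definition uniformity_ell2 :: "('a ell2 \<times> 'a ell2) filter" where
  "uniformity_ell2 = (INF e\<in>{0<..}. principal {(x, y). dist x y < e})"
definition open_ell2 :: "'a ell2 set \<Rightarrow> bool" where
  "open_ell2 U \<longleftrightarrow> (\<forall>x\<in>U. eventually (\<lambda>(x', y). x' = x \<longrightarrow> y \<in> U) uniformity)"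

lemma inner_summable: "(\<lambda>i. inner (coord x i) (coord y i)) summable_on UNIV"
proof -
  have "(\<lambda>i. norm (inner (coord x i) (coord y i))) summable_on UNIV"
  proof (rule summable_on_comparison_test)
    show "(\<lambda>i. (cmod (coord x i))\<^sup>2 + (cmod (coord y i))\<^sup>2) summable_on UNIV"
      by (intro summable_on_add coord_summable)
    fix i
    have "norm (inner (coord x i) (coord y i)) \<le> cmod (coord x i) * cmod (coord y i)"
      by (simp add: Cauchy_Schwarz_ineq2)
    also have "\<dots> \<le> (cmod (coord x i))\<^sup>2 + (cmod (coord y i))\<^sup>2"
      using sum_squares_bound[of "cmod (coord x i)" "cmod (coord y i)"]
        mult_nonneg_nonneg[OF norm_ge_zero norm_ge_zero, of "coord x i" "coord y i"]
      by linarith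
    finally show "norm (inner (coord x i) (coord y i)) \<le> (cmod (coord x i))\<^sup>2 + (cmod (coord y i))\<^sup>2" .
  qed simp
  then show ?thesis by (rule abs_summable_summable)
qed

instance
proof
  fix x y z :: "'a ell2" and r :: real
  show "dist x y = norm (x - y)" by (rule dist_ell2_def)
  show "sgn x = x /\<^sub>R norm x" by (rule sgn_ell2_def)
  show "(uniformity :: ('a ell2 \<times> 'a ell2) filter) = (INF e\<in>{0<..}. principal {(x, y). dist x y < e})"
    by (rule uniformity_ell2_def)
  show "open U \<longleftrightarrow> (\<forall>x\<in>U. eventually (\<lambda>(x', y). x' = x \<longrightarrow> y \<in> U) uniformity)" for U :: "'a ell2 set"
    by (rule open_ell2_def)
  show "inner x y = inner y x" by (simp add: inner_ell2_def inner_commute)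
  show "inner (x + y) z = inner x z + inner y z"
    by (simp add: inner_ell2_def plus_ell2.rep_eq inner_add_left infsum_add inner_summable)
  show "inner (r *\<^sub>R x) y = r * inner x y"
  proof -
    have "inner (of_real r * coord x i) (coord y i) = r * inner (coord x i) (coord y i)" for i
      by (simp add: inner_complex_def algebra_simps)
    then show ?thesis
      by (simp add: inner_ell2_def scaleR_ell2.rep_eq infsum_cmult_right')
  qed
  show "0 \<le> inner x x" by (simp add: inner_ell2_def infsum_nonneg)
  show "inner x x = 0 \<longleftrightarrow> x = 0"
  proof
    assume *: "inner x x = 0"
    have "coord x i = 0" for i
    proof -
      have "inner (coord x i) (coord x i) = 0"
        by (rule nonneg_infsum_le_0D[OF _ inner_summable])
          (use * in \<open>auto simp: inner_ell2_def\<close>)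
      then show ?thesis by simp
    qed
    then show "x = 0" by (intro ell2_eqI) (simp add: zero_ell2.rep_eq)
  qed (simp add: inner_ell2_def zero_ell2.rep_eq)
  show "norm x = sqrt (inner x x)" by (rule norm_ell2_def)
qed

end

lemma coord_simps [simp]:
  "coord 0 i = 0" "coord (x + y) i = coord x i + coord y i" "coord (- x) i = - coord x i"
  "coord (x - y) i = coord x i - coord y i" "coord (r *\<^sub>R x) i = of_real r * coord x i"
  by (simp_all add: zero_ell2.rep_eq plus_ell2.rep_eq uminus_ell2.rep_eq scaleR_ell2.rep_eq minus_ell2_def
      del: add_uminus_conv_diff)

lemma norm_ell2_square: "(norm x)\<^sup>2 = (\<Sum>\<^sub>\<infinity>i. (cmod (coord x i))\<^sup>2)"
proof -
  have "(norm x)\<^sup>2 = inner x x" by (rule dot_square_norm[symmetric])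
  also have "\<dots> = (\<Sum>\<^sub>\<infinity>i. (cmod (coord x i))\<^sup>2)"
    unfolding inner_ell2_def dot_square_norm ..
  finally show ?thesis .
qed

lemma sum_coord_le_norm: "finite F \<Longrightarrow> (\<Sum>i\<in>F. (cmod (coord x i))\<^sup>2) \<le> (norm x)\<^sup>2"
  unfolding norm_ell2_square by (rule finite_sum_le_infsum[OF coord_summable]) auto

lemma coord_le_norm: "cmod (coord x i) \<le> norm x"
  by (rule power2_le_imp_le) (use sum_coord_le_norm[of "{i}" x] in auto)

text \<open>
  Both the limit of a Cauchy sequence and the image of a vector under an operator are first given
  coordinatewise; bounds on finite sums then show that they lie in the space and bound the norm.
\<close>

lemma ell2_bounded_sums:
  assumes "\<And>F. finite F \<Longrightarrow> (\<Sum>i\<in>F. (cmod (f i))\<^sup>2) \<le> c\<^sup>2" "0 \<le> c"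
  obtains x where "coord x = f" "norm x \<le> c"
proof
  have "(\<lambda>i. (cmod (f i))\<^sup>2) summable_on UNIV"
  proof (rule nonneg_bdd_above_summable_on)
    show "bdd_above (sum (\<lambda>i. (cmod (f i))\<^sup>2) ` {F. F \<subseteq> UNIV \<and> finite F})"
      by (rule bdd_aboveI2[where M = "c\<^sup>2"]) (use assms in auto)
  qed simp
  then show f: "coord (Abs_ell2 f) = f" by (simp add: Abs_ell2_inverse)
  have "(norm (Abs_ell2 f))\<^sup>2 \<le> c\<^sup>2"
    unfolding norm_ell2_square using coord_summable[of "Abs_ell2 f"]
    by (intro infsum_le_finite_sums) (auto simp: f assms)
  then show "norm (Abs_ell2 f) \<le> c" using assms(2) by (rule power2_le_imp_le)
qed

instance ell2 :: (type) complete_space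
proof
  fix X :: "nat \<Rightarrow> 'a ell2"
  assume X: "Cauchy X"
  have "Cauchy (\<lambda>n. coord (X n) i)" for i
  proof (rule metric_CauchyI)
    fix e :: real assume "0 < e"
    then obtain M where M: "dist (X m) (X n) < e" if "m \<ge> M" "n \<ge> M" for m n
      using metric_CauchyD[OF X] by blast
    have "dist (coord (X m) i) (coord (X n) i) < e" if "m \<ge> M" "n \<ge> M" for m n
      using coord_le_norm[of "X m - X n" i] M[OF that] by (simp add: dist_norm)
    then show "\<exists>M. \<forall>m\<ge>M. \<forall>n\<ge>M. dist (coord (X m) i) (coord (X n) i) < e" by blast
  qed
  then have "\<exists>g. \<forall>i. (\<lambda>n. coord (X n) i) \<longlonglongrightarrow> g i"
    by (intro choice allI) (simp add: Cauchy_convergent_iff convergent_def)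
  then obtain g where g: "\<And>i. (\<lambda>n. coord (X n) i) \<longlonglongrightarrow> g i" by blast
  have tail: "\<exists>d. coord d = (\<lambda>i. coord (X m) i - g i) \<and> norm d \<le> e"
    if e: "0 < e" and M: "\<And>n. n \<ge> m \<Longrightarrow> norm (X m - X n) \<le> e" for m e
  proof -
    have "(\<Sum>i\<in>F. (cmod (coord (X m) i - g i))\<^sup>2) \<le> e\<^sup>2" if "finite F" for F
    proof (rule LIMSEQ_le_const2)
      show "(\<lambda>n. \<Sum>i\<in>F. (cmod (coord (X m) i - coord (X n) i))\<^sup>2)
          \<longlonglongrightarrow> (\<Sum>i\<in>F. (cmod (coord (X m) i - g i))\<^sup>2)"
        by (intro tendsto_intros g)
      have "(\<Sum>i\<in>F. (cmod (coord (X m) i - coord (X n) i))\<^sup>2) \<le> e\<^sup>2" if "n \<ge> m" for n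
        using sum_coord_le_norm[OF \<open>finite F\<close>, of "X m - X n"] M[OF that]
          power_mono[of "norm (X m - X n)" e 2] by simp
      then show "\<exists>N. \<forall>n\<ge>N. (\<Sum>i\<in>F. (cmod (coord (X m) i - coord (X n) i))\<^sup>2) \<le> e\<^sup>2" by blast
    qed
    then show ?thesis
      by (rule ell2_bounded_sums) (use e in auto)
  qed
  have Cau: "\<exists>M. \<forall>m\<ge>M. \<forall>n\<ge>M. norm (X m - X n) \<le> e" if "0 < e" for e
    using metric_CauchyD[OF X that] by (auto simp: dist_norm intro: less_imp_le)
  obtain M where "\<And>n. n \<ge> M \<Longrightarrow> norm (X M - X n) \<le> 1" using Cau[of 1] by auto
  from tail[OF _ this] obtain d where d: "coord d = (\<lambda>i. coord (X M) i - g i)" by auto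
  define x where "x = X M - d"
  have x: "coord x = g" by (rule ext) (simp add: x_def d)
  have "X \<longlonglongrightarrow> x"
  proof (rule LIMSEQ_I)
    fix e :: real assume e: "0 < e"
    obtain N where N: "\<And>m n. m \<ge> N \<Longrightarrow> n \<ge> N \<Longrightarrow> norm (X m - X n) \<le> e / 2" using Cau[of "e/2"] e by auto
    have "norm (X m - x) < e" if "m \<ge> N" for m
    proof -
      have "norm (X m - X n) \<le> e / 2" if "n \<ge> m" for n
        using N \<open>m \<ge> N\<close> that by simp
      then obtain d where d: "coord d = (\<lambda>i. coord (X m) i - g i)" "norm d \<le> e / 2"
        using tail[of "e/2" m] e by auto
      have "X m - x = d" by (rule ell2_eqI) (simp add: d x)
      then show ?thesis using d e by simp
    qed
    then show "\<exists>N. \<forall>m\<ge>N. norm (X m - x) < e" by blast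
  qed
  then show "convergent X" by (auto simp: convergent_def)
qed

instance ell2 :: (type) banach ..

section \<open>The C*-algebra of operators on square-summable families\<close>

lift_definition scale_ell2 :: "complex \<Rightarrow> 'i ell2 \<Rightarrow> 'i ell2" is "\<lambda>c f i. c * f i"
  by (rule square_summable_mult)

lemma coord_scale [simp]: "coord (scale_ell2 c x) i = c * coord x i"
  by (simp add: scale_ell2.rep_eq)

lemma norm_scale_ell2: "norm (scale_ell2 c x) = cmod c * norm x"
proof (rule power2_eq_imp_eq)
  show "(norm (scale_ell2 c x))\<^sup>2 = (cmod c * norm x)\<^sup>2"
    by (simp add: norm_ell2_square power_mult_distrib norm_mult infsum_cmult_right')
qed auto

lemma bounded_linear_scale_ell2: "bounded_linear (scale_ell2 c)"
  by (rule bounded_linear_intro[of _ "cmod c"])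
    (auto intro!: ell2_eqI simp: norm_scale_ell2 algebra_simps)

lemma inner_scale_ell2: "inner (scale_ell2 c x) y = inner x (scale_ell2 (cnj c) y)"
proof -
  have "inner (c * a) b = inner a (cnj c * b)" for a b :: complex
    by (simp add: inner_complex_def algebra_simps)
  then show ?thesis by (simp add: inner_ell2_def)
qed

type_synonym 'i ell2_op = "'i ell2 \<Rightarrow>\<^sub>L 'i ell2"

definition scale_op :: "complex \<Rightarrow> 'i ell2_op" where
  "scale_op c = Blinfun (scale_ell2 c)"

lemma scale_op_apply [simp]: "blinfun_apply (scale_op c) x = scale_ell2 c x"
  by (simp add: scale_op_def bounded_linear_Blinfun_apply bounded_linear_scale_ell2)

text \<open>
  Elements of \<^typ>\<open>'i ell2_op\<close> are only real-linear by their type.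
\<close>

definition complex_linear :: "'i ell2_op \<Rightarrow> bool" where
  "complex_linear T \<longleftrightarrow> (\<forall>c x. T (scale_ell2 c x) = scale_ell2 c (T x))"

definition adjoint_pair :: "'i ell2_op \<Rightarrow> 'i ell2_op \<Rightarrow> bool" where
  "adjoint_pair T S \<longleftrightarrow> (\<forall>x y. inner (T x) y = inner x (S y))"

text \<open>
  Having an adjoint is made part of membership.  Every bounded operator on a Hilbert space has one
  by the Riesz representation theorem, but with this definition closedness under limits
  follows from the fact that passing to the adjoint is isometric.
\<close>

definition ell2_algebra :: "'i ell2_op star_algebra" where
  "ell2_algebra = \<lparr>carrier = {T. complex_linear T \<and> (\<exists>S. adjoint_pair T S)},
     mult = (o\<^sub>L), one = id_blinfun, zero = 0, add = (+),
     smult = (\<lambda>c T. scale_op c o\<^sub>L T), adj = (\<lambda>T. SOME S. adjoint_pair T S), cnorm = norm\<rparr>"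

lemma ell2_algebra_simps [simp]:
  "T \<otimes>\<^bsub>ell2_algebra\<^esub> S = T o\<^sub>L S" "\<zero>\<^bsub>ell2_algebra\<^esub> = 0" "T \<oplus>\<^bsub>ell2_algebra\<^esub> S = T + S"
  "c \<odot>\<^bsub>ell2_algebra\<^esub> T = scale_op c o\<^sub>L T" "cnorm ell2_algebra T = norm T"
  by (simp_all add: ell2_algebra_def)

lemma ell2_algebra_carrier:
  "T \<in> carrier ell2_algebra \<longleftrightarrow> complex_linear T \<and> (\<exists>S. adjoint_pair T S)"
  by (simp add: ell2_algebra_def)

lemma adjoint_pair_sym: "adjoint_pair T S \<Longrightarrow> adjoint_pair S T"
  unfolding adjoint_pair_def by (metis inner_commute)

lemma adjoint_pair_unique:
  assumes "adjoint_pair T S" "adjoint_pair T S'"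
  shows "S = S'"
proof (rule blinfun_eqI)
  fix x
  have "inner y (S x - S' x) = 0" for y
    using assms by (simp add: adjoint_pair_def inner_diff_right)
  from this[of "S x - S' x"] show "S x = S' x" by simp
qed

lemma adj_eqI: "adjoint_pair T S \<Longrightarrow> adj ell2_algebra T = S"
  by (simp add: ell2_algebra_def adjoint_pair_unique some_equality)

lemma adjoint_pair_adj: "T \<in> carrier ell2_algebra \<Longrightarrow> adjoint_pair T (adj ell2_algebra T)"
  by (auto simp: ell2_algebra_carrier adj_eqI)

lemma adjoint_pair_add: "adjoint_pair T S \<Longrightarrow> adjoint_pair T' S' \<Longrightarrow> adjoint_pair (T + T') (S + S')"
  by (simp add: adjoint_pair_def inner_add_left inner_add_right blinfun.add_left)

lemma adjoint_pair_compose: "adjoint_pair T S \<Longrightarrow> adjoint_pair T' S' \<Longrightarrow> adjoint_pair (T o\<^sub>L T') (S' o\<^sub>L S)"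
  by (simp add: adjoint_pair_def)

lemma adjoint_pair_complex_linear:
  assumes "adjoint_pair T S" "complex_linear T"
  shows "complex_linear S"
  unfolding complex_linear_def
proof (intro allI)
  fix c x
  have "inner y (S (scale_ell2 c x)) = inner y (scale_ell2 c (S x))" for y
  proof -
    have "inner y (S (scale_ell2 c x)) = inner (T y) (scale_ell2 c x)"
      using assms by (simp add: adjoint_pair_def)
    also have "\<dots> = inner (T (scale_ell2 (cnj c) y)) x"
      using assms by (simp add: complex_linear_def inner_scale_ell2)
    also have "\<dots> = inner y (scale_ell2 c (S x))"
      using assms inner_scale_ell2[of "cnj c"] by (simp add: adjoint_pair_def)
    finally show ?thesis .
  qed
  then have "inner y (S (scale_ell2 c x) - scale_ell2 c (S x)) = 0" for y
    by (simp add: inner_diff_right)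
  from this[of "S (scale_ell2 c x) - scale_ell2 c (S x)"]
  show "S (scale_ell2 c x) = scale_ell2 c (S x)" by simp
qed

text \<open>
  The substantial half of the C*-identity, from \<open>\<parallel>Tx\<parallel>\<^sup>2 = \<langle>x, STx\<rangle>\<close>.
\<close>

lemma adjoint_pair_square_norm:
  assumes "adjoint_pair T S"
  shows "(norm T)\<^sup>2 \<le> norm (S o\<^sub>L T)"
proof -
  have "norm T \<le> sqrt (norm (S o\<^sub>L T))"
  proof (rule norm_blinfun_bound)
    fix x
    have "(norm (T x))\<^sup>2 = inner x ((S o\<^sub>L T) x)"
      using assms by (simp add: adjoint_pair_def flip: dot_square_norm)
    also have "\<dots> \<le> norm x * norm ((S o\<^sub>L T) x)" by (rule norm_cauchy_schwarz)
    also have "\<dots> \<le> norm x * (norm (S o\<^sub>L T) * norm x)"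
      by (intro mult_left_mono norm_blinfun) simp
    also have "\<dots> = (sqrt (norm (S o\<^sub>L T)) * norm x)\<^sup>2"
      by (simp add: power_mult_distrib power2_eq_square)
    finally show "norm (T x) \<le> sqrt (norm (S o\<^sub>L T)) * norm x"
      by (rule power2_le_imp_le) simp
  qed simp
  then have "(norm T)\<^sup>2 \<le> (sqrt (norm (S o\<^sub>L T)))\<^sup>2"
    by (rule power_mono) simp
  then show ?thesis by simp
qed

lemma adjoint_pair_norm_le:
  assumes "adjoint_pair T S"
  shows "norm T \<le> norm S"
proof (cases "norm T = 0")
  case False
  have "norm T * norm T \<le> norm S * norm T"
    using adjoint_pair_square_norm[OF assms] norm_blinfun_compose[of S T]
    by (simp add: power2_eq_square)
  then show ?thesis using False by (simp add: mult_le_cancel_right)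
qed (use norm_ge_zero[of S] in linarith)

lemma adjoint_pair_norm: "adjoint_pair T S \<Longrightarrow> norm T = norm S"
  by (simp add: adjoint_pair_norm_le adjoint_pair_sym antisym)

lemma complex_ring_cring: "cring complex_ring"
proof -
  have "\<exists>y. y + x = 0" for x :: complex by (rule exI[of _ "- x"]) simp
  then have "abelian_group complex_ring"
    by (intro abelian_groupI) (auto simp: complex_ring_def)
  moreover have "comm_monoid complex_ring"
    by (intro comm_monoidI) (auto simp: complex_ring_def)
  ultimately show ?thesis
    by (intro cringI) (auto simp: complex_ring_def algebra_simps)
qed

lemma adjoint_pair_scale: "adjoint_pair (scale_op c) (scale_op (cnj c))"
  by (simp add: adjoint_pair_def inner_scale_ell2)

lemma ell2_algebra_closed:
  shows ell2_zero_closed: "0 \<in> carrier ell2_algebra"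
    and ell2_add_closed: "T \<in> carrier ell2_algebra \<Longrightarrow> S \<in> carrier ell2_algebra \<Longrightarrow> T + S \<in> carrier ell2_algebra"
    and ell2_compose_closed: "T \<in> carrier ell2_algebra \<Longrightarrow> S \<in> carrier ell2_algebra \<Longrightarrow> T o\<^sub>L S \<in> carrier ell2_algebra"
    and ell2_scale_closed: "scale_op c \<in> carrier ell2_algebra"
    and ell2_adj_closed: "T \<in> carrier ell2_algebra \<Longrightarrow> adj ell2_algebra T \<in> carrier ell2_algebra"
proof -
  have "adjoint_pair 0 0" by (simp add: adjoint_pair_def)
  then show "0 \<in> carrier ell2_algebra"
    by (auto simp: ell2_algebra_carrier complex_linear_def intro!: ell2_eqI)
  show "T + S \<in> carrier ell2_algebra" if "T \<in> carrier ell2_algebra" "S \<in> carrier ell2_algebra"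
    using that adjoint_pair_add
    by (fastforce simp: ell2_algebra_carrier complex_linear_def blinfun.add_left algebra_simps intro!: ell2_eqI)
  show "T o\<^sub>L S \<in> carrier ell2_algebra" if "T \<in> carrier ell2_algebra" "S \<in> carrier ell2_algebra"
    using that adjoint_pair_compose
    by (fastforce simp: ell2_algebra_carrier complex_linear_def)
  show "scale_op c \<in> carrier ell2_algebra"
    using adjoint_pair_scale[of c]
    by (auto simp: ell2_algebra_carrier complex_linear_def algebra_simps intro!: ell2_eqI)
  show "adj ell2_algebra T \<in> carrier ell2_algebra" if "T \<in> carrier ell2_algebra"
    using adjoint_pair_adj[OF that] that adjoint_pair_sym adjoint_pair_complex_linear
    by (auto simp: ell2_algebra_carrier)
qed

lemma ell2_abelian_group: "abelian_group (ell2_algebra :: 'i ell2_op star_algebra)"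
proof (rule abelian_groupI)
  fix T :: "'i ell2_op" assume T: "T \<in> carrier ell2_algebra"
  have "(scale_op (-1) o\<^sub>L T) + T = 0"
    by (rule blinfun_eqI) (auto simp: blinfun.add_left intro: ell2_eqI)
  then show "\<exists>S\<in>carrier ell2_algebra. S \<oplus>\<^bsub>ell2_algebra\<^esub> T = \<zero>\<^bsub>ell2_algebra\<^esub>"
    using T by (auto intro!: bexI[of _ "scale_op (-1) o\<^sub>L T"] ell2_algebra_closed)
qed (auto simp: ell2_algebra_closed add_ac)

lemma ell2_minus:
  assumes "T \<in> carrier ell2_algebra" "S \<in> carrier ell2_algebra"
  shows "T \<ominus>\<^bsub>ell2_algebra\<^esub> S = T - S"
proof -
  interpret abelian_group ell2_algebra by (rule ell2_abelian_group)
  have eq: "- S = scale_op (-1) o\<^sub>L S"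
    by (rule blinfun_eqI) (auto simp: blinfun.minus_left intro: ell2_eqI)
  have "\<ominus>\<^bsub>ell2_algebra\<^esub> S = - S"
    using assms by (intro minus_equality) (auto simp: eq[symmetric], auto simp: eq ell2_algebra_closed)
  then show ?thesis by (simp add: a_minus_def)
qed

lemma ell2_norm_lim:
  assumes "\<And>n. f n \<in> carrier ell2_algebra" "T \<in> carrier ell2_algebra"
  shows "norm_lim ell2_algebra f T \<longleftrightarrow> f \<longlonglongrightarrow> T"
  using assms by (simp add: norm_lim_def ell2_minus LIM_zero_iff tendsto_norm_zero_iff)

text \<open>
  The adjoints of a Cauchy sequence of operators form a Cauchy sequence as well, and their limit is
  adjoint to the limit of the operators.
\<close>

lemma ell2_complete:
  fixes f :: "nat \<Rightarrow> 'i ell2_op"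
  assumes f: "\<And>n. f n \<in> carrier ell2_algebra"
    and Cauchy: "\<And>\<epsilon>. \<epsilon> > 0 \<Longrightarrow> \<exists>N. \<forall>m\<ge>N. \<forall>n\<ge>N. norm (f m - f n) < \<epsilon>"
  shows "\<exists>T\<in>carrier ell2_algebra. f \<longlonglongrightarrow> T"
proof -
  define g where "g n = adj ell2_algebra (f n)" for n
  have fg: "adjoint_pair (f n) (g n)" for n
    unfolding g_def by (rule adjoint_pair_adj[OF f])
  have "adjoint_pair (f m - f n) (g m - g n)" for m n
    using fg by (simp add: adjoint_pair_def inner_diff_left inner_diff_right blinfun.diff_left)
  then have gf: "norm (g m - g n) = norm (f m - f n)" for m n
    by (rule adjoint_pair_norm[symmetric])
  have "Cauchy f" "Cauchy g"
    using Cauchy by (auto simp: Cauchy_def dist_norm gf)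
  then obtain T S where T: "f \<longlonglongrightarrow> T" and S: "g \<longlonglongrightarrow> S"
    by (auto simp: Cauchy_convergent_iff convergent_def)
  have Tx: "(\<lambda>n. f n x) \<longlonglongrightarrow> T x" and Sx: "(\<lambda>n. g n x) \<longlonglongrightarrow> S x" for x
    using T S by (auto intro!: tendsto_intros)
  have "inner (T x) y = inner x (S y)" for x y
  proof (rule LIMSEQ_unique)
    show "(\<lambda>n. inner (f n x) y) \<longlonglongrightarrow> inner (T x) y"
      by (intro tendsto_intros Tx)
    show "(\<lambda>n. inner (f n x) y) \<longlonglongrightarrow> inner x (S y)"
      using fg by (simp add: adjoint_pair_def) (intro tendsto_intros Sx)
  qed
  moreover have "T (scale_ell2 c x) = scale_ell2 c (T x)" for c x
  proof (rule LIMSEQ_unique)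
    show "(\<lambda>n. f n (scale_ell2 c x)) \<longlonglongrightarrow> T (scale_ell2 c x)" by (rule Tx)
    show "(\<lambda>n. f n (scale_ell2 c x)) \<longlonglongrightarrow> scale_ell2 c (T x)"
      using f bounded_linear.tendsto[OF bounded_linear_scale_ell2 Tx, of c x]
      by (simp add: ell2_algebra_carrier complex_linear_def)
  qed
  ultimately have "T \<in> carrier ell2_algebra"
    unfolding ell2_algebra_carrier complex_linear_def adjoint_pair_def by blast
  then show ?thesis using T by blast
qed

theorem ell2_cstar_algebra: "cstar_algebra (ell2_algebra :: 'i ell2_op star_algebra)"
proof -
  let ?B = "ell2_algebra :: 'i ell2_op star_algebra"
  interpret abelian_group ?B by (rule ell2_abelian_group)
  have scale_lin: "scale_op c o\<^sub>L (T + S) = (scale_op c o\<^sub>L T) + (scale_op c o\<^sub>L S)"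
    "scale_op (c + d) o\<^sub>L T = (scale_op c o\<^sub>L T) + (scale_op d o\<^sub>L T)"
    "scale_op (c * d) o\<^sub>L T = scale_op c o\<^sub>L (scale_op d o\<^sub>L T)" "scale_op 1 o\<^sub>L T = T" for c d and T S :: "'i ell2_op"
    by (rule blinfun_eqI; rule ell2_eqI; simp add: blinfun.add_left algebra_simps)+
  have lin: "(T + S) o\<^sub>L U = (T o\<^sub>L U) + (S o\<^sub>L U)" "U o\<^sub>L (T + S) = (U o\<^sub>L T) + (U o\<^sub>L S)"
    "(T o\<^sub>L S) o\<^sub>L U = T o\<^sub>L (S o\<^sub>L U)" for T S U :: "'i ell2_op"
    by (rule blinfun_eqI; simp add: blinfun.add_left blinfun.add_right)+
  have comm: "T o\<^sub>L (scale_op c o\<^sub>L S) = scale_op c o\<^sub>L (T o\<^sub>L S)" if "T \<in> carrier ?B" for T S c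
    using that by (intro blinfun_eqI) (simp add: ell2_algebra_carrier complex_linear_def)
  have norm_scale: "norm (scale_op c o\<^sub>L T) = cmod c * norm T" for c and T :: "'i ell2_op"
  proof (rule antisym)
    have le: "norm (scale_op c o\<^sub>L T) \<le> cmod c * norm T" for c and T :: "'i ell2_op"
      by (rule norm_blinfun_bound)
        (auto simp: norm_scale_ell2 mult.assoc intro!: mult_left_mono norm_blinfun)
    then show "norm (scale_op c o\<^sub>L T) \<le> cmod c * norm T" .
    show "cmod c * norm T \<le> norm (scale_op c o\<^sub>L T)"
    proof (cases "c = 0")
      case False
      then have "T = scale_op (inverse c) o\<^sub>L (scale_op c o\<^sub>L T)"
        using scale_lin(3)[of "inverse c" c T] scale_lin(4)[of T] by simp
      then have "norm T \<le> cmod (inverse c) * norm (scale_op c o\<^sub>L T)"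
        using le by metis
      then show ?thesis using False by (simp add: norm_divide field_simps)
    qed simp
  qed
  have "rng ?B"
    by unfold_locales (auto simp: ell2_algebra_closed lin)
  moreover have "module complex_ring ?B"
    by (intro moduleI complex_ring_cring ell2_abelian_group)
      (auto simp: complex_ring_def ell2_algebra_closed scale_lin)
  moreover have "cstar_algebra_axioms ?B"
  proof (unfold_locales, goal_cases)
    case (1 T S c) show ?case by (simp add: lin)
  next
    case (2 T S c) then show ?case by (simp add: comm)
  next
    case (4 T) then show ?case by (rule adj_eqI[OF adjoint_pair_sym[OF adjoint_pair_adj]])
  next
    case (5 T S) then show ?case
      by (simp add: adj_eqI adjoint_pair_add adjoint_pair_adj)
  next
    case (6 T c)
    have "adjoint_pair (scale_op c o\<^sub>L T) (adj ?B T o\<^sub>L scale_op (cnj c))"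
      by (rule adjoint_pair_compose[OF adjoint_pair_scale adjoint_pair_adj[OF 6]])
    moreover have "adj ?B T o\<^sub>L scale_op (cnj c) = scale_op (cnj c) o\<^sub>L adj ?B T"
      using ell2_adj_closed[OF 6] by (intro blinfun_eqI) (simp add: ell2_algebra_carrier complex_linear_def)
    ultimately show ?case by (simp add: adj_eqI)
  next
    case (7 T S) then show ?case
      by (simp add: adj_eqI adjoint_pair_compose adjoint_pair_adj)
  next
    case (13 T)
    have *: "adjoint_pair T (adj ?B T)" by (rule adjoint_pair_adj[OF 13])
    have "norm (adj ?B T o\<^sub>L T) \<le> norm (adj ?B T) * norm T" by (rule norm_blinfun_compose)
    then show ?case
      using adjoint_pair_square_norm[OF *] adjoint_pair_norm[OF *] by (simp add: power2_eq_square)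
  next
    case (14 f)
    have "\<exists>T\<in>carrier ?B. f \<longlonglongrightarrow> T"
      using 14 by (intro ell2_complete) (auto simp: ell2_minus)
    then show ?case using 14(1) by (auto simp: ell2_norm_lim)
  qed (auto simp: ell2_adj_closed norm_scale norm_triangle_ineq norm_blinfun_compose)
  ultimately show ?thesis
    by (simp add: cstar_algebra_def)
qed

section \<open>Homomorphisms into the operators are contractive\<close>

context cstar_algebra
begin

lemma zero_mult: "x \<in> carrier A \<Longrightarrow> \<zero> \<otimes> x = \<zero>"
  using smult_mult_left[of \<zero> x 0] V.smult_l_null[of "\<zero> \<otimes> x"] V.smult_l_null[of \<zero>]
  by (simp add: complex_ring_def m_closed)

lemma mult_zero: "x \<in> carrier A \<Longrightarrow> x \<otimes> \<zero> = \<zero>"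
  using smult_mult_right[of x \<zero> 0] V.smult_l_null[of "x \<otimes> \<zero>"] V.smult_l_null[of \<zero>]
  by (simp add: complex_ring_def m_closed)

lemma smult_zero: "c \<odot> \<zero> = \<zero>"
  using V.smult_r_null[of c] by (simp add: complex_ring_def)

lemma smult_add: "x \<in> carrier A \<Longrightarrow> y \<in> carrier A \<Longrightarrow> c \<odot> (x \<oplus> y) = c \<odot> x \<oplus> c \<odot> y"
  using V.smult_r_distr[of c x y] by (simp add: complex_ring_def)

lemma add_smult: "x \<in> carrier A \<Longrightarrow> (c + d) \<odot> x = c \<odot> x \<oplus> d \<odot> x"
  using V.smult_l_distr[of c d x] by (simp add: complex_ring_def)

lemma smult_smult: "x \<in> carrier A \<Longrightarrow> c \<odot> (d \<odot> x) = (c * d) \<odot> x"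
  using V.smult_assoc1[of c d x] by (simp add: complex_ring_def)

lemma zero_smult: "x \<in> carrier A \<Longrightarrow> 0 \<odot> x = \<zero>"
  using V.smult_l_null[of x] by (simp add: complex_ring_def)

lemma minus_smult: "x \<in> carrier A \<Longrightarrow> y \<in> carrier A \<Longrightarrow> x \<ominus> y = x \<oplus> (-1) \<odot> y"
  by (simp add: minus_eq uminus_eq)

lemma minus_mult:
  "x \<in> carrier A \<Longrightarrow> y \<in> carrier A \<Longrightarrow> z \<in> carrier A \<Longrightarrow> (x \<ominus> y) \<otimes> z = x \<otimes> z \<ominus> y \<otimes> z"
  by (simp add: minus_smult l_distr smult_mult_left smult_in m_closed)

lemma mult_minus:
  "x \<in> carrier A \<Longrightarrow> y \<in> carrier A \<Longrightarrow> z \<in> carrier A \<Longrightarrow> z \<otimes> (x \<ominus> y) = z \<otimes> x \<ominus> z \<otimes> y"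
  by (simp add: minus_smult r_distr smult_mult_right smult_in m_closed)

lemma minus_swap: "x \<in> carrier A \<Longrightarrow> y \<in> carrier A \<Longrightarrow> y \<ominus> x = (-1) \<odot> (x \<ominus> y)"
  by (simp add: minus_smult smult_add smult_smult smult_in a_comm)
    (simp add: V.smult_one[unfolded complex_ring_def, simplified])

lemma cnorm_minus_commute: "x \<in> carrier A \<Longrightarrow> y \<in> carrier A \<Longrightarrow> cnorm A (x \<ominus> y) = cnorm A (y \<ominus> x)"
  by (subst minus_swap) (simp_all add: cnorm_smult)

lemma cnorm_zero: "cnorm A \<zero> = 0"
  using cnorm_eq_0[of \<zero>] by simp

lemma minus_add_minus:
  "x \<in> carrier A \<Longrightarrow> y \<in> carrier A \<Longrightarrow> z \<in> carrier A \<Longrightarrow> (x \<ominus> y) \<oplus> (y \<ominus> z) = x \<ominus> z"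
  by (simp add: minus_eq a_assoc r_neg1 r_neg2)

lemma cnorm_triangle_minus:
  "x \<in> carrier A \<Longrightarrow> y \<in> carrier A \<Longrightarrow> z \<in> carrier A
    \<Longrightarrow> cnorm A (x \<ominus> z) \<le> cnorm A (x \<ominus> y) + cnorm A (y \<ominus> z)"
  using cnorm_triangle[of "x \<ominus> y" "y \<ominus> z"] by (simp add: minus_add_minus)

lemma cnorm_adj: "x \<in> carrier A \<Longrightarrow> cnorm A (adj A x) = cnorm A x"
proof -
  have le: "cnorm A x \<le> cnorm A (adj A x)" if x: "x \<in> carrier A" for x
  proof (cases "cnorm A x = 0")
    case False
    have "cnorm A x * cnorm A x \<le> cnorm A (adj A x) * cnorm A x"
      using cstar_identity[OF x] cnorm_mult[OF adj_closed[OF x] x] by (simp add: power2_eq_square)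
    then show ?thesis
      using False cnorm_nonneg[OF x] by (simp add: mult_le_cancel_right)
  qed (simp add: cnorm_nonneg adj_closed x)
  assume x: "x \<in> carrier A"
  show ?thesis using le[OF x] le[OF adj_closed[OF x]] by (simp add: adj_adj x)
qed

lemma norm_lim_const: "x \<in> carrier A \<Longrightarrow> norm_lim A (\<lambda>_. x) x"
  by (simp add: norm_lim_def minus_eq r_neg cnorm_zero)

lemma norm_lim_add:
  assumes "\<And>n. f n \<in> carrier A" "\<And>n. g n \<in> carrier A" "x \<in> carrier A" "y \<in> carrier A"
    and "norm_lim A f x" "norm_lim A g y"
  shows "norm_lim A (\<lambda>n. f n \<oplus> g n) (x \<oplus> y)"
proof -
  have eq: "(f n \<oplus> g n) \<ominus> (x \<oplus> y) = (f n \<ominus> x) \<oplus> (g n \<ominus> y)" for n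
    using assms(1-4) by (simp add: minus_smult smult_add smult_in a_ac)
  have "(\<lambda>n. cnorm A (f n \<ominus> x) + cnorm A (g n \<ominus> y)) \<longlonglongrightarrow> 0 + 0"
    using assms(5,6) unfolding norm_lim_def by (rule tendsto_add)
  then have "(\<lambda>n. cnorm A ((f n \<oplus> g n) \<ominus> (x \<oplus> y))) \<longlonglongrightarrow> 0"
    by (rule metric_tendsto_imp_tendsto)
      (use assms(1-4) cnorm_triangle in \<open>auto simp: eq cnorm_nonneg\<close>)
  then show ?thesis by (simp add: norm_lim_def)
qed

lemma norm_lim_mult_right:
  assumes "\<And>n. f n \<in> carrier A" "x \<in> carrier A" "y \<in> carrier A" "norm_lim A f x"
  shows "norm_lim A (\<lambda>n. f n \<otimes> y) (x \<otimes> y)"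
proof -
  have eq: "f n \<otimes> y \<ominus> x \<otimes> y = (f n \<ominus> x) \<otimes> y" for n
    using assms(1-3) by (simp add: minus_mult)
  have "(\<lambda>n. cnorm A (f n \<ominus> x) * cnorm A y) \<longlonglongrightarrow> 0 * cnorm A y"
    using assms(4) unfolding norm_lim_def by (intro tendsto_intros)
  then have "(\<lambda>n. cnorm A (f n \<ominus> x) * cnorm A y) \<longlonglongrightarrow> 0" by simp
  then have "(\<lambda>n. cnorm A (f n \<otimes> y \<ominus> x \<otimes> y)) \<longlonglongrightarrow> 0"
    by (rule metric_tendsto_imp_tendsto)
      (use assms(1-3) cnorm_mult in \<open>auto simp: eq cnorm_nonneg m_closed\<close>)
  then show ?thesis by (simp add: norm_lim_def)
qed

lemma norm_lim_adj:
  assumes "\<And>n. f n \<in> carrier A" "x \<in> carrier A" "norm_lim A f x"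
  shows "norm_lim A (\<lambda>n. adj A (f n)) (adj A x)"
proof -
  have "adj A (f n) \<ominus> adj A x = adj A (f n \<ominus> x)" for n
    using assms(1,2) by (simp add: minus_smult adj_add adj_smult adj_closed smult_in)
  then show ?thesis using assms by (simp add: norm_lim_def cnorm_adj)
qed

lemma norm_lim_mult_left:
  assumes "\<And>n. f n \<in> carrier A" "x \<in> carrier A" "y \<in> carrier A" "norm_lim A f x"
  shows "norm_lim A (\<lambda>n. y \<otimes> f n) (y \<otimes> x)"
  using norm_lim_adj[OF _ _ norm_lim_mult_right[OF _ _ adj_closed[OF assms(3)] norm_lim_adj[OF assms(1,2,4)]]]
    assms by (simp add: adj_closed m_closed adj_mult adj_adj)

text \<open>
  The geometric series \<open>d = c + c\<^sup>2 + c\<^sup>3 + \<dots>\<close>, which plays the part of \<open>(1 - c)\<inverse> - 1\<close> in a ring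
  without identity.  It is obtained as the limit of the iterates of \<open>d \<mapsto> c + dc\<close>.
\<close>

lemma quasi_inverse:
  assumes c: "c \<in> carrier A" and r1: "cnorm A c < 1"
  obtains d where "d \<in> carrier A" "d = c \<oplus> d \<otimes> c"
proof -
  define r where "r = cnorm A c"
  have r: "0 \<le> r" "r < 1" using r1 cnorm_nonneg[OF c] by (auto simp: r_def)
  define f where "f n = ((\<lambda>d. c \<oplus> d \<otimes> c) ^^ n) \<zero>" for n
  have f0: "f 0 = \<zero>" and fS: "f (Suc n) = c \<oplus> f n \<otimes> c" for n by (simp_all add: f_def)
  have fc: "f n \<in> carrier A" for n by (induction n) (simp_all add: f0 fS c m_closed)
  have step: "cnorm A (f (Suc n) \<ominus> f n) \<le> r ^ n" for n
  proof (induction n)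
    case 0 show ?case using c r by (simp add: fS f0 zero_mult minus_smult smult_zero r_def)
  next
    case (Suc n)
    have "f (Suc (Suc n)) \<ominus> f (Suc n) = (f (Suc n) \<ominus> f n) \<otimes> c"
    proof -
      have "f (Suc (Suc n)) \<ominus> f (Suc n) = (c \<oplus> f (Suc n) \<otimes> c) \<ominus> (c \<oplus> f n \<otimes> c)"
        by (simp only: fS)
      also have "\<dots> = f (Suc n) \<otimes> c \<ominus> f n \<otimes> c"
        using c fc[of n] fc[of "Suc n"] by (simp add: minus_eq minus_add a_ac m_closed r_neg1 r_neg2 a_lcomm)
      finally show ?thesis using c fc by (simp add: minus_mult)
    qed
    then have "cnorm A (f (Suc (Suc n)) \<ominus> f (Suc n)) \<le> cnorm A (f (Suc n) \<ominus> f n) * r"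
      using cnorm_mult[of "f (Suc n) \<ominus> f n" c] c fc by (simp add: r_def)
    also have "\<dots> \<le> r ^ n * r" using Suc r by (intro mult_right_mono) auto
    finally show ?case by (simp add: mult.commute)
  qed
  have tail: "cnorm A (f (n + k) \<ominus> f n) \<le> (r ^ n - r ^ (n + k)) / (1 - r)" for n k
  proof (induction k)
    case 0 then show ?case using fc by (simp add: minus_eq r_neg cnorm_zero)
  next
    case (Suc k)
    have "cnorm A (f (n + Suc k) \<ominus> f n) \<le> cnorm A (f (Suc (n + k)) \<ominus> f (n + k)) + cnorm A (f (n + k) \<ominus> f n)"
      using cnorm_triangle_minus fc by simp
    also have "\<dots> \<le> r ^ (n + k) + (r ^ n - r ^ (n + k)) / (1 - r)"
      using step Suc by (intro add_mono) auto
    also have "\<dots> = (r ^ n - r ^ (n + Suc k)) / (1 - r)" using r by (simp add: field_simps)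
    finally show ?case .
  qed
  have "\<exists>N. \<forall>m\<ge>N. \<forall>n\<ge>N. cnorm A (f m \<ominus> f n) < \<epsilon>" if e: "\<epsilon> > 0" for \<epsilon>
  proof -
    have "0 < \<epsilon> * (1 - r) / 2" using e r by simp
    then obtain N where N: "r ^ N < \<epsilon> * (1 - r) / 2"
      using r real_arch_pow_inv[of "\<epsilon> * (1 - r) / 2" r] by blast
    have bd: "cnorm A (f m \<ominus> f N) < \<epsilon> / 2" if "m \<ge> N" for m
    proof -
      have "cnorm A (f m \<ominus> f N) \<le> (r ^ N - r ^ m) / (1 - r)"
        using tail[of N "m - N"] that by simp
      also have "\<dots> \<le> r ^ N / (1 - r)"
        using r by (intro divide_right_mono) auto
      also have "\<dots> < \<epsilon> / 2" using N r by (simp add: field_simps)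
      finally show ?thesis .
    qed
    have "cnorm A (f m \<ominus> f n) < \<epsilon>" if "m \<ge> N" "n \<ge> N" for m n
      using bd[OF that(1)] bd[OF that(2)] cnorm_triangle_minus[of "f m" "f N" "f n", OF fc fc fc]
        cnorm_minus_commute[of "f N" "f n", OF fc fc] by linarith
    then show ?thesis by blast
  qed
  then obtain d where d: "d \<in> carrier A" "norm_lim A f d"
    using complete[of f] fc by blast
  have "norm_lim A (\<lambda>n. f (Suc n)) d"
    using d(2) LIMSEQ_Suc[of "\<lambda>n. cnorm A (f n \<ominus> d)" 0] by (simp add: norm_lim_def)
  moreover have "norm_lim A (\<lambda>n. f (Suc n)) (c \<oplus> d \<otimes> c)"
    unfolding fS using c d fc
    by (intro norm_lim_add norm_lim_const norm_lim_mult_right) (auto simp: m_closed)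
  ultimately have "d = c \<oplus> d \<otimes> c"
    using norm_lim_unique[of "\<lambda>n. f (Suc n)" d "c \<oplus> d \<otimes> c"] c d fc by (simp add: m_closed)
  then show thesis using d that by blast
qed

end

lemma blinfun_almost_norming:
  fixes T :: "'a::real_normed_vector \<Rightarrow>\<^sub>L 'b::real_normed_vector"
  assumes "0 \<le> q" "q < norm T"
  obtains x where "q * norm x < norm (T x)"
  using assms norm_blinfun_bound[of q T] by (meson not_le)

text \<open>
  If \<open>\<parallel>T\<parallel> = 1\<close>, then \<open>1\<close> is an approximate eigenvalue of \<open>T\<^sup>*T\<close>: when \<open>\<parallel>Tx\<parallel>\<close> is close to \<open>\<parallel>x\<parallel>\<close>,
  the vector \<open>x - T\<^sup>*Tx\<close> is small, whereas \<open>T\<^sup>*Tx\<close> is not.  An operator \<open>D\<close> as assumed maps the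
  former to the latter, which is impossible.
\<close>

lemma selfadjoint_quasi_inverse_norm:
  fixes T :: "'i ell2_op"
  assumes TS: "adjoint_pair T S" and D: "D = (S o\<^sub>L T) + (D o\<^sub>L (S o\<^sub>L T))"
  shows "norm T \<noteq> 1"
proof
  assume T1: "norm T = 1"
  define K where "K = 2 * (norm D)\<^sup>2"
  have K: "0 \<le> K" by (simp add: K_def)
  \<comment> \<open>small enough for \<open>K\<delta> \<le> 1/4\<close> and \<open>\<sigma> \<ge> 3/4\<close>, which clash at the end\<close>
  define \<delta> where "\<delta> = 1 / (4 * (1 + K))"
  define \<sigma> where "\<sigma> = 1 - \<delta>"
  have \<delta>: "0 < \<delta>" "\<delta> \<le> 1 / 4" "K * \<delta> \<le> 1 / 4" using K by (auto simp: \<delta>_def field_simps)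
  obtain x where x: "sqrt \<sigma> * norm x < norm (T x)"
    using blinfun_almost_norming[of "sqrt \<sigma>" T] T1 \<delta> by (auto simp: \<sigma>_def)
  define t where "t = (norm (T x))\<^sup>2"
  define N where "N = (norm x)\<^sup>2"
  define y where "y = S (T x)"
  have t: "\<sigma> * N < t"
    using power_strict_mono[OF x, of 2] \<delta> by (simp add: t_def N_def \<sigma>_def power_mult_distrib)
  have "x \<noteq> 0" using x by auto
  then have N: "0 < N" by (simp add: N_def)
  have xy: "inner x y = t" using TS by (simp add: adjoint_pair_def y_def t_def flip: dot_square_norm)
  have ny: "norm y \<le> norm x"
  proof -
    have "norm y \<le> norm S * norm (T x)" unfolding y_def by (rule norm_blinfun)
    also have "\<dots> \<le> norm S * (norm T * norm x)" by (intro mult_left_mono norm_blinfun) simp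
    finally show ?thesis using adjoint_pair_norm[OF TS] T1 by simp
  qed
  have "y = D (x - y)"
  proof -
    have "D x = y + D y"
      using arg_cong[OF D, of "\<lambda>U. blinfun_apply U x"] by (simp add: blinfun.add_left y_def)
    then show ?thesis by (simp add: blinfun.diff_right)
  qed
  then have "norm y \<le> norm D * norm (x - y)" by (metis norm_blinfun)
  then have "(norm y)\<^sup>2 \<le> (norm D * norm (x - y))\<^sup>2" by (rule power_mono) simp
  also have "\<dots> = (norm D)\<^sup>2 * (norm (x - y))\<^sup>2" by (simp add: power_mult_distrib)
  also have "(norm (x - y))\<^sup>2 = N - 2 * t + (norm y)\<^sup>2"
    using xy by (simp add: power2_norm_eq_inner inner_diff_left inner_diff_right inner_commute N_def)
  also have "\<dots> \<le> 2 * (N - t)"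
    using power_mono[OF ny, of 2] by (simp add: N_def)
  also have "\<dots> \<le> 2 * (\<delta> * N)"
    using t by (simp add: \<sigma>_def algebra_simps)
  finally have y1: "(norm y)\<^sup>2 \<le> K * \<delta> * N"
    by (simp add: K_def mult_left_mono)
  have "t\<^sup>2 \<le> (norm x * norm y)\<^sup>2"
    using norm_cauchy_schwarz[of x y] xy by (intro power_mono) (auto simp: t_def)
  also have "\<dots> \<le> N * (K * \<delta> * N)"
    using y1 N by (simp add: power_mult_distrib N_def mult_left_mono)
  also have "\<dots> \<le> N * (1 / 4 * N)"
    using \<delta> N by (intro mult_left_mono mult_right_mono) auto
  finally have "t\<^sup>2 \<le> (N / 2)\<^sup>2" by (simp add: power2_eq_square)
  then have "t \<le> N / 2" using N by (intro power2_le_imp_le[of t]) auto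
  moreover have "3 / 4 * N \<le> \<sigma> * N" using \<delta> N by (intro mult_right_mono) (auto simp: \<sigma>_def)
  ultimately show False using t N by linarith
qed

text \<open>
  Homomorphisms preserve quasi-inverses.  If \<open>\<pi>\<close> increased the norm of \<open>a\<close>, some multiple \<open>b\<close> of \<open>a\<close>
  would satisfy \<open>\<parallel>b\<^sup>*b\<parallel> < 1\<close> and \<open>\<parallel>\<pi>(b)\<parallel> = 1\<close>; the quasi-inverse of \<open>b\<^sup>*b\<close> would be mapped to one of
  \<open>\<pi>(b)\<^sup>*\<pi>(b)\<close>, which the preceding lemma excludes.
\<close>

theorem star_hom_contractive:
  fixes A :: "'a star_algebra" and \<pi> :: "'a \<Rightarrow> 'i ell2_op"
  assumes A: "cstar_algebra A" and hom: "star_hom A ell2_algebra \<pi>" and a: "a \<in> carrier A"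
  shows "norm (\<pi> a) \<le> cnorm A a"
proof (rule ccontr)
  interpret cstar_algebra A by (rule A)
  interpret B: cstar_algebra "ell2_algebra :: 'i ell2_op star_algebra" by (rule ell2_cstar_algebra)
  assume *: "\<not> norm (\<pi> a) \<le> cnorm A a"
  define r where "r = norm (\<pi> a)"
  have r: "0 < r" "cnorm A a < r" using * cnorm_nonneg[OF a] by (auto simp: r_def)
  define b where "b = of_real (1 / r) \<odot>\<^bsub>A\<^esub> a"
  have b: "b \<in> carrier A" by (simp add: b_def smult_in a)
  have pb: "\<pi> b \<in> carrier ell2_algebra" using hom b by (auto simp: star_hom_def)
  have "cnorm A b < 1" using a r by (simp add: b_def cnorm_smult norm_divide)
  define c where "c = adj A b \<otimes>\<^bsub>A\<^esub> b"
  have c: "c \<in> carrier A" by (simp add: c_def b adj_closed m_closed)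
  have "cnorm A c < 1"
    using \<open>cnorm A b < 1\<close> cnorm_nonneg[OF b] by (simp add: c_def cstar_identity b power_less_one_iff)
  then obtain d where d: "d \<in> carrier A" "d = c \<oplus>\<^bsub>A\<^esub> d \<otimes>\<^bsub>A\<^esub> c"
    using quasi_inverse c by blast
  have "\<pi> d = \<pi> c + (\<pi> d o\<^sub>L \<pi> c)"
    using hom c d(1) arg_cong[OF d(2), of \<pi>] by (simp add: star_hom_def m_closed)
  moreover have "\<pi> c = adj ell2_algebra (\<pi> b) o\<^sub>L \<pi> b"
    using hom b by (simp add: star_hom_def c_def adj_closed)
  ultimately have "norm (\<pi> b) \<noteq> 1"
    using selfadjoint_quasi_inverse_norm[OF adjoint_pair_adj[OF pb]] by simp
  moreover have "\<pi> b = of_real (1 / r) \<odot>\<^bsub>ell2_algebra\<^esub> \<pi> a"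
    using hom a by (simp only: star_hom_def b_def)
  then have "norm (\<pi> b) = 1"
    using B.cnorm_smult[of "\<pi> a" "of_real (1 / r)"] hom a r
    by (auto simp: star_hom_def norm_divide r_def)
  ultimately show False by simp
qed

section \<open>Representing a graph on its infinite paths\<close>

text \<open>
  The gauge action of the circle: a scalar of modulus one cancels in every product of a partial
  isometry with its adjoint, and the relations involve the partial isometries only through such
  products.
\<close>

lemma graph_family_twist:
  fixes A :: "'a star_algebra" (structure)
  assumes A: "cstar_algebra A" and fam: "graph_family G A p s" and z: "cmod z = 1"
  shows "graph_family G A p (\<lambda>e. z \<odot> s e)"
proof -
  interpret cstar_algebra A by (rule A)
  have zz: "cnj z * z = 1" "z * cnj z = 1"
    using z complex_norm_square[of z] by (simp_all add: mult.commute)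
  have one: "1 \<odot> x = x" if "x \<in> carrier A" for x
    using V.smult_one[OF that] by (simp add: complex_ring_def)
  have s: "s e \<in> carrier A" if "e \<in> arcs G" for e
    using fam that by (simp add: graph_family_def partial_isometry_def)
  have as: "adj A (s e) \<in> carrier A" if "e \<in> arcs G" for e
    using s[OF that] by (rule adj_closed)
  have rp: "range_proj A (z \<odot> s e) = range_proj A (s e)" if "e \<in> arcs G" for e
    using s[OF that] as[OF that]
    by (simp add: range_proj_def adj_smult smult_mult_left smult_mult_right smult_smult smult_in m_closed zz one)
  have sp: "adj A (z \<odot> s e) \<otimes> (z \<odot> s e) = adj A (s e) \<otimes> s e" if "e \<in> arcs G" for e
    using s[OF that] as[OF that]
    by (simp add: range_proj_def adj_smult smult_mult_left smult_mult_right smult_smult smult_in m_closed zz one)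
  have iso: "partial_isometry A (z \<odot> s e)" if e: "e \<in> arcs G" for e
  proof -
    have "(z \<odot> s e) \<otimes> adj A (z \<odot> s e) \<otimes> (z \<odot> s e) = s e \<otimes> adj A (s e) \<otimes> (z \<odot> s e)"
      using rp[OF e] by (simp add: range_proj_def)
    also have "\<dots> = z \<odot> s e"
      using fam e s[OF e] as[OF e] by (simp add: smult_mult_right m_closed graph_family_def partial_isometry_def)
    finally show ?thesis using s[OF e] by (simp add: partial_isometry_def smult_in)
  qed
  have "p v = (\<Oplus>e\<in>out_arcs G v. range_proj A (z \<odot> s e))" if v: "regular_vertex G v" for v
  proof -
    have "(\<Oplus>e\<in>out_arcs G v. range_proj A (z \<odot> s e)) = (\<Oplus>e\<in>out_arcs G v. range_proj A (s e))"
      by (rule finsum_cong') (auto simp: rp, auto simp: range_proj_def s as m_closed)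
    then show ?thesis using fam v by (simp add: graph_family_def)
  qed
  then show ?thesis
    using fam iso by (simp add: graph_family_def rp sp)
qed

lemma ell2_finsum:
  fixes k :: "'j \<Rightarrow> 'i ell2_op"
  assumes "finite F" "\<And>j. j \<in> F \<Longrightarrow> k j \<in> carrier ell2_algebra"
  shows "(\<Oplus>\<^bsub>ell2_algebra\<^esub>j\<in>F. k j) = (\<Sum>j\<in>F. k j)"
proof -
  interpret abelian_group "ell2_algebra :: 'i ell2_op star_algebra" by (rule ell2_abelian_group)
  show ?thesis using assms
  proof (induction F rule: finite_induct)
    case (insert j F)
    then show ?case by (subst finsum_insert) auto
  qed simp
qed

text \<open>
  Composition with \<open>\<sigma>\<close>, cut off outside \<open>D\<close>.  For \<open>\<sigma>\<close> injective on \<open>D\<close> this is a partial isometry whose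
  adjoint is composition with the inverse of \<open>\<sigma>\<close>, cut off outside the image of \<open>D\<close>.  All operators
  that represent a graph are of this kind, so that each relation between them becomes a statement
  about partial bijections of the set of infinite paths.
\<close>

definition substitution_op :: "'i set \<Rightarrow> ('i \<Rightarrow> 'i) \<Rightarrow> 'i ell2_op" where
  "substitution_op D \<sigma> = Blinfun (\<lambda>x. Abs_ell2 (\<lambda>i. if i \<in> D then coord x (\<sigma> i) else 0))"

lemma coord_substitution_op:
  assumes inj: "inj_on \<sigma> D"
  shows "coord (substitution_op D \<sigma> x) i = (if i \<in> D then coord x (\<sigma> i) else 0)"
proof -
  let ?f = "\<lambda>x i. if i \<in> D then coord x (\<sigma> i) else 0"
  have "coord (Abs_ell2 (?f x)) = ?f x \<and> norm (Abs_ell2 (?f x)) \<le> norm x" for x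
  proof -
    have "(\<Sum>i\<in>F. (cmod (?f x i))\<^sup>2) \<le> (norm x)\<^sup>2" if F: "finite F" for F
    proof -
      have "(\<Sum>i\<in>F. (cmod (?f x i))\<^sup>2) = (\<Sum>i\<in>F \<inter> D. (cmod (coord x (\<sigma> i)))\<^sup>2)"
        using F by (intro sum.mono_neutral_cong_right) auto
      also have "\<dots> = (\<Sum>j\<in>\<sigma> ` (F \<inter> D). (cmod (coord x j))\<^sup>2)"
        using inj by (subst sum.reindex) (auto intro: inj_on_subset)
      also have "\<dots> \<le> (norm x)\<^sup>2" by (rule sum_coord_le_norm) (use F in auto)
      finally show ?thesis .
    qed
    then obtain y where "coord y = ?f x" "norm y \<le> norm x"
      by (rule ell2_bounded_sums) auto
    moreover have "Abs_ell2 (?f x) = y" using calculation(1) by (metis coord_inverse)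
    ultimately show ?thesis by simp
  qed
  then have c: "coord (Abs_ell2 (?f x)) = ?f x" and n: "norm (Abs_ell2 (?f x)) \<le> norm x" for x by blast+
  have "bounded_linear (\<lambda>x. Abs_ell2 (?f x))"
    by (rule bounded_linear_intro[of _ 1]) (auto intro!: ell2_eqI simp: c n)
  then show ?thesis by (simp add: substitution_op_def bounded_linear_Blinfun_apply c)
qed

lemma adjoint_pair_substitution_op:
  assumes "\<And>i. i \<in> D \<Longrightarrow> \<sigma> i \<in> D' \<and> \<sigma>' (\<sigma> i) = i" "\<And>j. j \<in> D' \<Longrightarrow> \<sigma>' j \<in> D \<and> \<sigma> (\<sigma>' j) = j"
  shows "adjoint_pair (substitution_op D \<sigma>) (substitution_op D' \<sigma>')"
  unfolding adjoint_pair_def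
proof (intro allI)
  fix x y
  have inj: "inj_on \<sigma> D" "inj_on \<sigma>' D'" using assms by (metis inj_onI)+
  have "inner (substitution_op D \<sigma> x) y = (\<Sum>\<^sub>\<infinity>i\<in>D. inner (coord x (\<sigma> i)) (coord y i))"
    unfolding inner_ell2_def by (rule infsum_cong_neutral) (auto simp: coord_substitution_op inj)
  also have "\<dots> = (\<Sum>\<^sub>\<infinity>j\<in>D'. inner (coord x j) (coord y (\<sigma>' j)))"
    by (rule infsum_reindex_bij_witness[of _ \<sigma>' \<sigma>]) (use assms in auto)
  also have "\<dots> = inner x (substitution_op D' \<sigma>' y)"
    unfolding inner_ell2_def by (rule infsum_cong_neutral) (auto simp: coord_substitution_op inj)
  finally show "inner (substitution_op D \<sigma> x) y = inner x (substitution_op D' \<sigma>' y)" .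
qed

lemma complex_linear_substitution_op: "inj_on \<sigma> D \<Longrightarrow> complex_linear (substitution_op D \<sigma>)"
  by (auto simp: complex_linear_def coord_substitution_op intro!: ell2_eqI)

definition infinite_path :: "('v, 'e) pre_digraph \<Rightarrow> 'e stream \<Rightarrow> bool" where
  "infinite_path G x \<longleftrightarrow> (\<forall>n. x !! n \<in> arcs G \<and> head G (x !! n) = tail G (x !! Suc n))"

lemma infinite_path_SCons:
  "infinite_path G (e ## x) \<longleftrightarrow> e \<in> arcs G \<and> head G e = tail G (shd x) \<and> infinite_path G x"
proof
  assume *: "infinite_path G (e ## x)"
  have "x !! n \<in> arcs G \<and> head G (x !! n) = tail G (x !! Suc n)" for n
    using * [unfolded infinite_path_def, THEN spec, of "Suc n"] by simp
  then show "e \<in> arcs G \<and> head G e = tail G (shd x) \<and> infinite_path G x"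
    using * [unfolded infinite_path_def, THEN spec, of 0] by (simp add: infinite_path_def)
next
  assume *: "e \<in> arcs G \<and> head G e = tail G (shd x) \<and> infinite_path G x"
  show "infinite_path G (e ## x)" unfolding infinite_path_def
  proof
    fix n show "(e ## x) !! n \<in> arcs G \<and> head G ((e ## x) !! n) = tail G ((e ## x) !! Suc n)"
      using * by (cases n) (auto simp: infinite_path_def)
  qed
qed

lemma infinite_path_shd_arc: "infinite_path G x \<Longrightarrow> shd x \<in> arcs G"
  by (metis infinite_path_SCons stream.collapse)

definition vertex_op :: "('v, 'e) pre_digraph \<Rightarrow> 'v \<Rightarrow> 'e stream ell2_op" where
  "vertex_op G v = substitution_op {x. infinite_path G x \<and> tail G (shd x) = v} (\<lambda>x. x)"

text \<open>
  Composition with the shift on the paths that begin with \<open>e\<close>; a basis vector \<open>x\<close> is mapped to the basis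
  vector of the path \<open>e\<close> followed by \<open>x\<close>.
\<close>

definition edge_op :: "('v, 'e) pre_digraph \<Rightarrow> 'e \<Rightarrow> 'e stream ell2_op" where
  "edge_op G e = substitution_op {x. infinite_path G x \<and> shd x = e} stl"

definition edge_op_adj :: "('v, 'e) pre_digraph \<Rightarrow> 'e \<Rightarrow> 'e stream ell2_op" where
  "edge_op_adj G e = substitution_op {x. infinite_path G (e ## x)} (SCons e)"

lemma coord_vertex_op:
  "coord (vertex_op G v f) x = (if infinite_path G x \<and> tail G (shd x) = v then coord f x else 0)"
  by (simp add: vertex_op_def coord_substitution_op)

lemma inj_on_stl: "inj_on stl {x. infinite_path G x \<and> shd x = e}"
  by (rule inj_onI) (metis (mono_tags) mem_Collect_eq stream.expand)

lemma coord_edge_op: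
  "coord (edge_op G e f) x = (if infinite_path G x \<and> shd x = e then coord f (stl x) else 0)"
  by (simp add: edge_op_def coord_substitution_op inj_on_stl)

lemma coord_edge_op_adj:
  "coord (edge_op_adj G e f) x = (if infinite_path G (e ## x) then coord f (e ## x) else 0)"
  by (simp add: edge_op_adj_def coord_substitution_op inj_on_def)

lemma adjoint_pair_vertex_op: "adjoint_pair (vertex_op G v) (vertex_op G v)"
  unfolding vertex_op_def by (rule adjoint_pair_substitution_op) auto

lemma adjoint_pair_edge_op: "adjoint_pair (edge_op G e) (edge_op_adj G e)"
  unfolding edge_op_def edge_op_adj_def by (rule adjoint_pair_substitution_op) auto

lemma vertex_op_carrier: "vertex_op G v \<in> carrier ell2_algebra"
proof -
  have "complex_linear (vertex_op G v)"
    unfolding vertex_op_def by (rule complex_linear_substitution_op) simp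
  then show ?thesis
    using adjoint_pair_vertex_op[of G v] by (auto simp: ell2_algebra_carrier)
qed

lemma edge_op_carrier: "edge_op G e \<in> carrier ell2_algebra"
  using adjoint_pair_edge_op[of G e] complex_linear_substitution_op[OF inj_on_stl]
  by (auto simp: ell2_algebra_carrier edge_op_def)

lemma adj_edge_op: "adj ell2_algebra (edge_op G e) = edge_op_adj G e"
  by (rule adj_eqI[OF adjoint_pair_edge_op])

lemma coord_range_proj_edge_op:
  "coord (range_proj ell2_algebra (edge_op G e) f) x = (if infinite_path G x \<and> shd x = e then coord f x else 0)"
  by (auto simp: range_proj_def adj_edge_op coord_edge_op coord_edge_op_adj)

lemma range_proj_edge_op_closed: "range_proj ell2_algebra (edge_op G e) \<in> carrier ell2_algebra"
  by (simp add: range_proj_def ell2_algebra_closed edge_op_carrier)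

lemma adjoint_pair_range_proj_edge_op:
  "adjoint_pair (range_proj ell2_algebra (edge_op G e)) (range_proj ell2_algebra (edge_op G e))"
  using adjoint_pair_compose[OF adjoint_pair_edge_op adjoint_pair_sym[OF adjoint_pair_edge_op], of G e]
  by (simp add: range_proj_def adj_edge_op)

text \<open>
  An infinite path that starts at \<open>v\<close> has exactly one first edge, which gives the summation relation at
  a regular vertex.  Only this relation uses that the paths are infinite: on finite paths it would
  fail at the path of length zero.
\<close>

lemma infinite_path_family: "graph_family G ell2_algebra (vertex_op G) (edge_op G)"
proof -
  have pv: "projection ell2_algebra (vertex_op G v)" for v
    by (auto simp: projection_def vertex_op_carrier adj_eqI adjoint_pair_vertex_op coord_vertex_op
        intro!: blinfun_eqI ell2_eqI)
  have pe: "projection ell2_algebra (range_proj ell2_algebra (edge_op G e))" for e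
    by (auto simp: projection_def range_proj_edge_op_closed adj_eqI adjoint_pair_range_proj_edge_op
        coord_range_proj_edge_op intro!: blinfun_eqI ell2_eqI)
  have "partial_isometry ell2_algebra (edge_op G e)" for e
    by (auto simp: partial_isometry_def edge_op_carrier adj_edge_op coord_edge_op coord_edge_op_adj
        intro!: blinfun_eqI ell2_eqI)
  moreover have "orthogonal_projections ell2_algebra (vertex_op G v) (vertex_op G w)" if "v \<noteq> w" for v w
    using that by (auto simp: orthogonal_projections_def pv coord_vertex_op intro!: blinfun_eqI ell2_eqI)
  moreover have "orthogonal_projections ell2_algebra (range_proj ell2_algebra (edge_op G e))
      (range_proj ell2_algebra (edge_op G f))" if "e \<noteq> f" for e f
    using that by (auto simp: orthogonal_projections_def pe coord_range_proj_edge_op intro!: blinfun_eqI ell2_eqI)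
  moreover have "edge_op_adj G e o\<^sub>L edge_op G e = vertex_op G (head G e)" if "e \<in> arcs G" for e
    using that by (auto simp: coord_edge_op coord_edge_op_adj coord_vertex_op infinite_path_SCons
        intro!: blinfun_eqI ell2_eqI)
  moreover have "projection_le ell2_algebra (range_proj ell2_algebra (edge_op G e)) (vertex_op G (tail G e))" for e
    by (auto simp: projection_le_def pv pe coord_range_proj_edge_op coord_vertex_op
        intro!: blinfun_eqI ell2_eqI)
  moreover have "vertex_op G v = (\<Oplus>\<^bsub>ell2_algebra\<^esub>e\<in>out_arcs G v. range_proj ell2_algebra (edge_op G e))"
    if v: "regular_vertex G v" for v
  proof -
    have fin: "finite (out_arcs G v)" using v by (simp add: regular_vertex_def)
    have apply_sum: "coord ((\<Sum>e\<in>F. range_proj ell2_algebra (edge_op G e)) f) x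
        = (\<Sum>e\<in>F. if infinite_path G x \<and> shd x = e then coord f x else 0)" if "finite F" for F f x
      using that by (induction F rule: finite_induct) (auto simp: blinfun.add_left coord_range_proj_edge_op)
    have "vertex_op G v = (\<Sum>e\<in>out_arcs G v. range_proj ell2_algebra (edge_op G e))"
    proof (intro blinfun_eqI ell2_eqI)
      fix f x
      have "(\<Sum>e\<in>out_arcs G v. if infinite_path G x \<and> shd x = e then coord f x else 0)
          = (if infinite_path G x \<and> shd x \<in> out_arcs G v then coord f x else 0)"
        using fin by (cases "infinite_path G x") (auto simp: sum.delta')
      also have "\<dots> = coord (vertex_op G v f) x"
        using infinite_path_shd_arc[of G x] by (auto simp: coord_vertex_op)
      finally show "coord (vertex_op G v f) x
          = coord ((\<Sum>e\<in>out_arcs G v. range_proj ell2_algebra (edge_op G e)) f) x"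
        by (simp add: apply_sum fin)
    qed
    then show ?thesis by (simp add: ell2_finsum fin range_proj_edge_op_closed)
  qed
  ultimately show ?thesis
    by (simp add: graph_family_def pv adj_edge_op)
qed

lift_definition basis_vector :: "'i \<Rightarrow> 'i ell2" is "\<lambda>j i. if i = j then 1 else 0"
proof -
  fix j :: 'i
  have "(\<lambda>i. (cmod (if i = j then 1 else 0))\<^sup>2) summable_on {j}" by simp
  then show "(\<lambda>i. (cmod (if i = j then 1 else 0))\<^sup>2) summable_on UNIV"
    by (rule summable_on_cong_neutral[THEN iffD1, rotated -1]) auto
qed

lemma coord_basis_vector: "coord (basis_vector j) i = (if i = j then 1 else 0)"
  by (simp add: basis_vector.rep_eq)

lemma norm_basis_vector: "norm (basis_vector j) = 1"
proof -
  have "(\<Sum>\<^sub>\<infinity>i. (cmod (coord (basis_vector j) i))\<^sup>2) = (\<Sum>\<^sub>\<infinity>i\<in>{j}. 1)"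
    by (rule infsum_cong_neutral) (auto simp: coord_basis_vector)
  then have "(norm (basis_vector j))\<^sup>2 = 1\<^sup>2"
    using norm_ell2_square[of "basis_vector j"] by simp
  then show ?thesis by (rule power2_eq_imp_eq) auto
qed

lemma edge_op_basis_vector:
  "infinite_path G (e ## x) \<Longrightarrow> edge_op G e (basis_vector x) = basis_vector (e ## x)"
  by (rule ell2_eqI) (auto simp: coord_edge_op coord_basis_vector)

lemma vertex_op_basis_vector:
  "infinite_path G x \<Longrightarrow> vertex_op G (tail G (shd x)) (basis_vector x) = basis_vector x"
  by (rule ell2_eqI) (auto simp: coord_vertex_op coord_basis_vector)

text \<open>
  The universal property applied to the action on infinite paths, twisted by \<open>z\<close>.
\<close>

lemma infinite_path_representation:
  assumes wf: "wf_digraph G" and A: "graph_cstar_algebra G A p s" and z: "cmod z = 1"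
  obtains \<pi> where "star_hom A ell2_algebra \<pi>" "\<And>v. v \<in> verts G \<Longrightarrow> \<pi> (p v) = vertex_op G v"
    "\<And>e. e \<in> arcs G \<Longrightarrow> \<pi> (s e) = scale_op z o\<^sub>L edge_op G e"
proof -
  show thesis
    using graph_cstar_universal[OF wf A ell2_cstar_algebra
        graph_family_twist[OF ell2_cstar_algebra infinite_path_family z]] that
    by auto
qed

section \<open>Laurent polynomials in a unitary of a corner\<close>

text \<open>
  The closed linear span.  The inductive form gives membership proofs and proofs about all elements by
  rule induction, with one case for limits.
\<close>

inductive_set closed_span :: "'a star_algebra \<Rightarrow> 'a set \<Rightarrow> 'a set" for A X where
  closed_span_zero: "\<zero>\<^bsub>A\<^esub> \<in> closed_span A X"
| closed_span_base: "x \<in> X \<Longrightarrow> x \<in> closed_span A X"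
| closed_span_add: "x \<in> closed_span A X \<Longrightarrow> y \<in> closed_span A X \<Longrightarrow> x \<oplus>\<^bsub>A\<^esub> y \<in> closed_span A X"
| closed_span_smult: "x \<in> closed_span A X \<Longrightarrow> c \<odot>\<^bsub>A\<^esub> x \<in> closed_span A X"
| closed_span_lim: "(\<And>n. f n \<in> closed_span A X) \<Longrightarrow> x \<in> carrier A \<Longrightarrow> norm_lim A f x \<Longrightarrow> x \<in> closed_span A X"

lemma closed_span_carrier:
  assumes A: "cstar_algebra A" and X: "X \<subseteq> carrier A" and x: "x \<in> closed_span A X"
  shows "x \<in> carrier A"
proof -
  interpret cstar_algebra A by (rule A)
  from x show ?thesis by induction (use X in \<open>auto simp: smult_in\<close>)
qed

lemma closed_span_mult_closed:
  assumes A: "cstar_algebra A" and X: "X \<subseteq> carrier A" and y: "y \<in> carrier A"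
    and base: "\<And>x. x \<in> X \<Longrightarrow> x \<otimes>\<^bsub>A\<^esub> y \<in> closed_span A X"
    and x: "x \<in> closed_span A X"
  shows "x \<otimes>\<^bsub>A\<^esub> y \<in> closed_span A X"
proof -
  interpret cstar_algebra A by (rule A)
  note car = closed_span_carrier[OF A X]
  from x show ?thesis
  proof induction
    case closed_span_zero then show ?case using y by (simp add: zero_mult closed_span.closed_span_zero)
  next
    case (closed_span_base x) then show ?case by (rule base)
  next
    case (closed_span_add x x')
    then show ?case using y car by (simp add: l_distr closed_span.closed_span_add)
  next
    case (closed_span_smult x c)
    then show ?case using y car by (simp add: smult_mult_left closed_span.closed_span_smult)
  next
    case (closed_span_lim f x)
    show ?case
      by (rule closed_span.closed_span_lim[of "\<lambda>n. f n \<otimes>\<^bsub>A\<^esub> y"])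
        (use closed_span_lim y car in \<open>auto intro!: norm_lim_mult_right simp: m_closed\<close>)
  qed
qed

text \<open>
  The elements \<open>a\<close> for which both \<open>a\<close> and its adjoint multiply the span into itself form a closed
  *-subalgebra.
\<close>

lemma closed_span_right_ideal:
  assumes A: "cstar_algebra A" and X: "X \<subseteq> carrier A" and Y: "Y \<subseteq> carrier A" and gen: "generates A Y"
    and base: "\<And>x y. x \<in> X \<Longrightarrow> y \<in> Y \<Longrightarrow> x \<otimes>\<^bsub>A\<^esub> y \<in> closed_span A X"
    and base': "\<And>x y. x \<in> X \<Longrightarrow> y \<in> Y \<Longrightarrow> x \<otimes>\<^bsub>A\<^esub> adj A y \<in> closed_span A X"
    and x: "x \<in> closed_span A X" and a: "a \<in> carrier A"
  shows "x \<otimes>\<^bsub>A\<^esub> a \<in> closed_span A X"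
proof -
  interpret cstar_algebra A by (rule A)
  note car = closed_span_carrier[OF A X]
  define D where "D = {a \<in> carrier A. \<forall>x\<in>closed_span A X.
    x \<otimes>\<^bsub>A\<^esub> a \<in> closed_span A X \<and> x \<otimes>\<^bsub>A\<^esub> adj A a \<in> closed_span A X}"
  have "adj A \<zero>\<^bsub>A\<^esub> = \<zero>\<^bsub>A\<^esub>"
    using cnorm_adj[of "\<zero>\<^bsub>A\<^esub>"] cnorm_eq_0[of "adj A \<zero>\<^bsub>A\<^esub>"] by (simp add: cnorm_zero adj_closed)
  then have zero: "\<zero>\<^bsub>A\<^esub> \<in> D"
    using car by (auto simp: D_def mult_zero closed_span_zero)
  have mult: "a \<otimes>\<^bsub>A\<^esub> b \<in> D" if ab: "a \<in> D" "b \<in> D" for a b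
  proof -
    have "x \<otimes>\<^bsub>A\<^esub> (a \<otimes>\<^bsub>A\<^esub> b) \<in> closed_span A X \<and> x \<otimes>\<^bsub>A\<^esub> adj A (a \<otimes>\<^bsub>A\<^esub> b) \<in> closed_span A X"
      if x: "x \<in> closed_span A X" for x
    proof -
      have "x \<otimes>\<^bsub>A\<^esub> (a \<otimes>\<^bsub>A\<^esub> b) = (x \<otimes>\<^bsub>A\<^esub> a) \<otimes>\<^bsub>A\<^esub> b"
        "x \<otimes>\<^bsub>A\<^esub> adj A (a \<otimes>\<^bsub>A\<^esub> b) = (x \<otimes>\<^bsub>A\<^esub> adj A b) \<otimes>\<^bsub>A\<^esub> adj A a"
        using ab car[OF x] by (auto simp: D_def m_assoc adj_mult adj_closed)
      then show ?thesis using ab x by (auto simp: D_def)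
    qed
    then show ?thesis using ab by (auto simp: D_def m_closed)
  qed
  have lim: "y \<in> D" if f: "\<And>n. f n \<in> D" and y: "y \<in> carrier A" and ly: "norm_lim A f y" for f y
  proof -
    have "x \<otimes>\<^bsub>A\<^esub> y \<in> closed_span A X \<and> x \<otimes>\<^bsub>A\<^esub> adj A y \<in> closed_span A X"
      if x: "x \<in> closed_span A X" for x
    proof
      have fc: "f n \<in> carrier A" for n using f[of n] by (simp add: D_def)
      show "x \<otimes>\<^bsub>A\<^esub> y \<in> closed_span A X"
        by (rule closed_span_lim[of "\<lambda>n. x \<otimes>\<^bsub>A\<^esub> f n"])
          (use f fc y ly x car[OF x] in \<open>auto simp: D_def m_closed intro!: norm_lim_mult_left\<close>)
      show "x \<otimes>\<^bsub>A\<^esub> adj A y \<in> closed_span A X"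
        by (rule closed_span_lim[of "\<lambda>n. x \<otimes>\<^bsub>A\<^esub> adj A (f n)"])
          (use f fc y ly x car[OF x] in
            \<open>auto simp: D_def m_closed adj_closed intro!: norm_lim_mult_left norm_lim_adj\<close>)
    qed
    then show ?thesis using y by (simp add: D_def)
  qed
  have add: "a \<oplus>\<^bsub>A\<^esub> b \<in> D" if "a \<in> D" "b \<in> D" for a b
    using that car by (auto simp: D_def r_distr adj_add adj_closed closed_span_add)
  have smult: "c \<odot>\<^bsub>A\<^esub> a \<in> D" if "a \<in> D" for a c
    using that car by (auto simp: D_def smult_in adj_smult adj_closed smult_mult_right closed_span_smult)
  have "D \<subseteq> carrier A" "\<forall>a\<in>D. adj A a \<in> D" by (auto simp: D_def adj_closed adj_adj)
  then have "closed_star_subalgebra A D"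
    unfolding closed_star_subalgebra_def
    by (intro conjI ballI allI impI) (auto simp: zero mult add smult intro: lim)
  moreover have "Y \<subseteq> D"
  proof
    fix y assume y: "y \<in> Y"
    then have yc: "y \<in> carrier A" using Y by blast
    show "y \<in> D"
      unfolding D_def using yc closed_span_mult_closed[OF A X yc base]
        closed_span_mult_closed[OF A X adj_closed[OF yc] base'] y by simp
  qed
  ultimately have "D = carrier A" using gen by (simp add: generates_def)
  then show ?thesis using x a by (auto simp: D_def)
qed

lemma (in cstar_algebra) minus_zero_imp_eq:
  assumes "x \<in> carrier A" "y \<in> carrier A" "x \<ominus> y = \<zero>"
  shows "x = y"
proof -
  have "x = (x \<ominus> y) \<oplus> y" using assms(1,2) by (simp add: minus_eq a_assoc l_neg)
  then show ?thesis using assms by simp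
qed

text \<open>
  The two equations say that \<open>u\<close> is a unitary of the corner \<open>pAp\<close>, whose identity is \<open>p\<close>.
\<close>

locale corner_unitary = cstar_algebra A for A :: "'a star_algebra" (structure) +
  fixes p u :: 'a
  assumes p: "projection A p" and u_closed: "u \<in> carrier A"
    and u_left: "adj A u \<otimes> u = p" and u_right: "u \<otimes> adj A u = p"
begin

lemma p_closed: "p \<in> carrier A" and p_adj: "adj A p = p" and p_idem: "p \<otimes> p = p"
  using p by (auto simp: projection_def)

lemma u_p: "u \<otimes> p = u" and p_u: "p \<otimes> u = u"
proof -
  \<comment> \<open>the C*-identity turns \<open>u*u = p\<close> into \<open>u - up = 0\<close>\<close>
  have d: "u \<ominus> u \<otimes> p \<in> carrier A" by (simp add: u_closed p_closed m_closed)
  have "adj A (u \<ominus> u \<otimes> p) \<otimes> (u \<ominus> u \<otimes> p) = (adj A u \<ominus> p \<otimes> adj A u) \<otimes> (u \<ominus> u \<otimes> p)"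
    by (simp add: minus_smult adj_add adj_smult adj_mult adj_closed u_closed p_closed m_closed smult_in p_adj)
  also have "\<dots> = (p \<ominus> p \<otimes> p) \<ominus> (p \<otimes> p \<ominus> (p \<otimes> p) \<otimes> p)"
    by (simp add: minus_mult mult_minus adj_closed u_closed p_closed m_closed m_assoc u_left)
      (simp add: u_left adj_closed u_closed p_closed flip: m_assoc)
  also have "\<dots> = \<zero>" by (simp add: p_idem p_closed minus_eq r_neg)
  finally have "(cnorm A (u \<ominus> u \<otimes> p))\<^sup>2 = 0" using cstar_identity[OF d] by (simp add: cnorm_zero)
  then have "u \<ominus> u \<otimes> p = \<zero>" using d cnorm_eq_0 by simp
  then show up: "u \<otimes> p = u"
    using minus_zero_imp_eq[of u "u \<otimes> p"] u_closed p_closed by (simp add: m_closed)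
  show "p \<otimes> u = u"
    using up u_closed by (simp add: m_assoc adj_closed u_left flip: u_right)
qed

text \<open>
  Evaluation of a polynomial at \<open>u\<close> by Horner's scheme, the constant term being a multiple of \<open>p\<close>.
\<close>

definition eval :: "complex poly \<Rightarrow> 'a" where
  "eval P = fold_coeffs (\<lambda>c x. c \<odot> p \<oplus> u \<otimes> x) P \<zero>"

lemma eval_0: "eval 0 = \<zero>" by (simp add: eval_def)

lemma eval_pCons: "eval (pCons c P) = c \<odot> p \<oplus> u \<otimes> eval P"
proof (cases "c = 0 \<and> P = 0")
  case True then show ?thesis by (simp add: eval_def mult_zero zero_smult u_closed p_closed)
next
  case False
  then show ?thesis by (auto simp: eval_def)
qed

lemma eval_closed: "eval P \<in> carrier A"
  by (induction P) (simp_all add: eval_0 eval_pCons smult_in u_closed p_closed m_closed)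

lemma p_eval: "p \<otimes> eval P = eval P"
  by (induction P)
    (simp_all add: eval_0 eval_pCons mult_zero r_distr smult_in p_closed u_closed m_closed eval_closed
      smult_mult_right p_idem p_u flip: m_assoc)

lemma eval_p: "eval P \<otimes> p = eval P"
  by (induction P)
    (simp_all add: eval_0 eval_pCons zero_mult l_distr smult_in p_closed u_closed m_closed eval_closed
      smult_mult_left p_idem m_assoc)

lemma eval_add: "eval (P + Q) = eval P \<oplus> eval Q"
  by (induction P Q rule: poly_induct2)
    (simp_all add: eval_0 eval_pCons r_distr add_smult smult_in p_closed u_closed m_closed eval_closed a_ac)

lemma eval_smult: "eval (Polynomial.smult c P) = c \<odot> eval P"
  by (induction P)
    (simp_all add: eval_0 eval_pCons smult_zero smult_add smult_smult smult_mult_right smult_in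
      p_closed u_closed m_closed eval_closed)

lemma eval_u: "eval P \<otimes> u = u \<otimes> eval P"
  by (induction P)
    (simp_all add: eval_0 eval_pCons zero_mult mult_zero l_distr r_distr smult_in p_closed u_closed
      m_closed eval_closed smult_mult_left smult_mult_right p_u u_p m_assoc)

lemma eval_mult: "eval (P * Q) = eval P \<otimes> eval Q"
proof (induction P)
  case 0 show ?case by (simp add: eval_0 zero_mult eval_closed)
next
  case (pCons c P)
  have "eval (pCons c P * Q) = c \<odot> eval Q \<oplus> (0 \<odot> p \<oplus> u \<otimes> (eval P \<otimes> eval Q))"
    using pCons by (simp add: eval_add eval_smult eval_pCons)
  then show ?case
    by (simp add: eval_pCons l_distr smult_in p_closed u_closed m_closed eval_closed smult_mult_left
        p_eval m_assoc zero_smult)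
qed

lemma eval_commute: "eval P \<otimes> eval Q = eval Q \<otimes> eval P"
  by (simp add: mult.commute flip: eval_mult)

lemma eval_1: "eval 1 = p"
  using V.smult_one[OF p_closed] by (simp add: one_pCons eval_pCons eval_0 mult_zero u_closed p_closed complex_ring_def)

lemma eval_X: "eval (monom 1 (Suc 0)) = u"
  by (simp add: monom_Suc eval_pCons monom_0 zero_smult p_closed u_closed m_closed eval_closed flip: one_pCons)
    (simp add: eval_1 u_p u_closed)

abbreviation upow :: "nat \<Rightarrow> 'a" where "upow m \<equiv> eval (monom 1 m)"

lemma upow_Suc: "upow (Suc m) = u \<otimes> upow m"
  by (simp add: monom_Suc eval_pCons zero_smult p_closed u_closed m_closed eval_closed)

lemma upow_add: "upow (m + n) = upow m \<otimes> upow n"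
  by (simp add: mult_monom flip: eval_mult)

lemma upow_0: "upow 0 = p" by (simp add: eval_1 monom_0 flip: one_pCons)

lemma upow_adj: "upow m \<otimes> adj A (upow m) = p" and adj_upow: "adj A (upow m) \<otimes> upow m = p"
proof -
  show "upow m \<otimes> adj A (upow m) = p"
  proof (induction m)
    case 0 show ?case by (simp only: upow_0 p_adj p_idem)
  next
    case (Suc m)
    have "upow (Suc m) \<otimes> adj A (upow (Suc m)) = u \<otimes> (upow m \<otimes> adj A (upow m)) \<otimes> adj A u"
      by (simp add: upow_Suc adj_mult u_closed eval_closed adj_closed m_assoc m_closed)
    then show ?case by (simp add: Suc u_p u_right)
  qed
  show "adj A (upow m) \<otimes> upow m = p"
  proof (induction m)
    case 0 show ?case by (simp only: upow_0 p_adj p_idem)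
  next
    case (Suc m)
    have "adj A (upow (Suc m)) \<otimes> upow (Suc m) = adj A (upow m) \<otimes> ((adj A u \<otimes> u) \<otimes> upow m)"
      by (simp add: upow_Suc adj_mult u_closed eval_closed adj_closed m_assoc m_closed)
    then show ?case by (simp add: Suc u_left p_eval)
  qed
qed

lemma cnorm_p_le_1: "cnorm A p \<le> 1"
proof -
  have "cnorm A p = (cnorm A p)\<^sup>2" using cstar_identity[OF p_closed] by (simp add: p_adj p_idem)
  then have "cnorm A p = 0 \<or> cnorm A p = 1" by (auto simp: power2_eq_square)
  then show ?thesis by auto
qed

lemma cnorm_upow_le_1: "cnorm A (upow m) \<le> 1"
proof -
  have "(cnorm A (upow m))\<^sup>2 = cnorm A p"
    using cstar_identity[OF eval_closed, of "monom 1 m"] by (simp add: adj_upow)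
  then show ?thesis using cnorm_p_le_1 by (simp add: power2_le_imp_le[of _ 1])
qed

text \<open>
  Powers of \<open>u\<close> act isometrically on \<open>pA\<close>, so denominators of Laurent polynomials may be cleared
  without changing a distance.
\<close>

lemma cnorm_upow_mult:
  assumes x: "x \<in> carrier A" "p \<otimes> x = x"
  shows "cnorm A (upow m \<otimes> x) = cnorm A x"
proof (rule antisym)
  have "cnorm A (upow m \<otimes> x) \<le> cnorm A (upow m) * cnorm A x" by (simp add: cnorm_mult eval_closed x)
  also have "\<dots> \<le> 1 * cnorm A x" by (intro mult_right_mono cnorm_upow_le_1 cnorm_nonneg x)
  finally show "cnorm A (upow m \<otimes> x) \<le> cnorm A x" by simp
  have "x = adj A (upow m) \<otimes> (upow m \<otimes> x)"
    using x by (simp add: adj_upow eval_closed adj_closed flip: m_assoc)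
  then have "cnorm A x \<le> cnorm A (adj A (upow m)) * cnorm A (upow m \<otimes> x)"
    by (metis cnorm_mult adj_closed eval_closed m_closed x(1))
  also have "\<dots> \<le> 1 * cnorm A (upow m \<otimes> x)"
    by (intro mult_right_mono) (simp_all add: cnorm_adj eval_closed cnorm_upow_le_1 cnorm_nonneg m_closed x)
  finally show "cnorm A x \<le> cnorm A (upow m \<otimes> x)" by simp
qed

lemma cnorm_u_le_1: "cnorm A u \<le> 1"
  using cnorm_upow_le_1[of "Suc 0"] by (simp add: eval_X)

lemma cnorm_eval_le: "cnorm A (eval P) \<le> (\<Sum>c\<leftarrow>coeffs P. cmod c)"
proof (induction P)
  case 0 show ?case by (simp add: eval_0 cnorm_zero)
next
  case (pCons c P)
  have "cnorm A (eval (pCons c P)) \<le> cnorm A (c \<odot> p) + cnorm A (u \<otimes> eval P)"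
    by (simp add: eval_pCons cnorm_triangle smult_in p_closed m_closed u_closed eval_closed)
  also have "\<dots> \<le> cmod c * 1 + 1 * cnorm A (eval P)"
  proof (rule add_mono)
    show "cnorm A (c \<odot> p) \<le> cmod c * 1"
      unfolding cnorm_smult[OF p_closed] by (intro mult_left_mono cnorm_p_le_1) simp
    have "cnorm A (u \<otimes> eval P) \<le> cnorm A u * cnorm A (eval P)"
      by (simp add: cnorm_mult u_closed eval_closed)
    also have "\<dots> \<le> 1 * cnorm A (eval P)"
      by (intro mult_right_mono cnorm_u_le_1 cnorm_nonneg eval_closed)
    finally show "cnorm A (u \<otimes> eval P) \<le> 1 * cnorm A (eval P)" .
  qed
  also have "\<dots> \<le> (\<Sum>c\<leftarrow>coeffs (pCons c P). cmod c)"
    using pCons by (auto simp: cCons_def)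
  finally show ?case .
qed

text \<open>
  A crude bound, which is sharp enough for large powers of a polynomial: the degree grows only
  linearly with the exponent.
\<close>

lemma cnorm_eval_le_coeff_bound:
  assumes "\<And>k. cmod (coeff P k) \<le> M"
  shows "cnorm A (eval P) \<le> real (degree P + 1) * M"
proof -
  have M: "0 \<le> M" using assms[of 0] norm_ge_zero order_trans by blast
  have "sum_list (map cmod (coeffs P)) \<le> sum_list (map (\<lambda>_. M) (coeffs P))"
    by (intro sum_list_mono) (auto simp: coeffs_def assms split: if_splits)
  also have "\<dots> = real (length (coeffs P)) * M" by (simp add: sum_list_triv)
  also have "\<dots> \<le> real (degree P + 1) * M"
    using M by (intro mult_right_mono) (auto simp: length_coeffs coeffs_def)
  finally show ?thesis using cnorm_eval_le[of P] by linarith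
qed

text \<open>
  For \<open>x\<close> in \<open>pA\<close> this means that \<open>x\<close> is a limit of Laurent polynomials \<open>u\<^sup>-\<^sup>mP(u)\<close>: since \<open>u\<^sup>m\<close> is isometric
  there, the distance of \<open>u\<^sup>mx\<close> to \<open>P(u)\<close> is that of \<open>x\<close> to \<open>u\<^sup>-\<^sup>mP(u)\<close>.
\<close>

definition laurent_approximable :: "'a \<Rightarrow> bool" where
  "laurent_approximable x \<longleftrightarrow> x \<in> carrier A \<and> (\<forall>\<epsilon>>0. \<exists>m P. cnorm A (upow m \<otimes> x \<ominus> eval P) < \<epsilon>)"

lemma laurent_approximable_exact:
  "x \<in> carrier A \<Longrightarrow> upow m \<otimes> x = eval P \<Longrightarrow> laurent_approximable x"
  unfolding laurent_approximable_def
  by (auto intro!: exI[of _ m] exI[of _ P] simp: minus_eq r_neg eval_closed cnorm_zero)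

lemma laurent_approximable_smult:
  assumes "laurent_approximable x"
  shows "laurent_approximable (c \<odot> x)"
  unfolding laurent_approximable_def
proof (intro conjI allI impI)
  have x: "x \<in> carrier A" using assms by (simp add: laurent_approximable_def)
  then show "c \<odot> x \<in> carrier A" by (rule smult_in)
  fix \<epsilon> :: real assume e: "0 < \<epsilon>"
  have c: "0 < cmod c + 1" by (simp add: add_nonneg_pos)
  then have "0 < \<epsilon> / (cmod c + 1)" using e by simp
  then obtain m P where mP: "cnorm A (upow m \<otimes> x \<ominus> eval P) < \<epsilon> / (cmod c + 1)"
    using assms unfolding laurent_approximable_def by blast
  have "upow m \<otimes> (c \<odot> x) \<ominus> eval (Polynomial.smult c P) = c \<odot> (upow m \<otimes> x \<ominus> eval P)"
    using x by (simp add: eval_smult minus_smult smult_add smult_smult smult_mult_right smult_in m_closed eval_closed mult.commute)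
  then have "cnorm A (upow m \<otimes> (c \<odot> x) \<ominus> eval (Polynomial.smult c P)) = cmod c * cnorm A (upow m \<otimes> x \<ominus> eval P)"
    using x by (simp add: cnorm_smult m_closed eval_closed)
  also have "\<dots> \<le> (cmod c + 1) * cnorm A (upow m \<otimes> x \<ominus> eval P)"
    using x by (intro mult_right_mono) (simp_all add: cnorm_nonneg m_closed eval_closed)
  also have "\<dots> < \<epsilon>" using mP c by (simp add: pos_less_divide_eq mult.commute)
  finally show "\<exists>m P. cnorm A (upow m \<otimes> (c \<odot> x) \<ominus> eval P) < \<epsilon>" by blast
qed

text \<open>
  Two approximations can be brought to a common power of \<open>u\<close>.
\<close>

lemma laurent_approximable_raise:
  assumes x: "x \<in> carrier A"
  shows "cnorm A (upow (k + m) \<otimes> x \<ominus> eval (monom 1 k * P)) \<le> cnorm A (upow m \<otimes> x \<ominus> eval P)"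
proof -
  have d: "upow m \<otimes> x \<ominus> eval P \<in> carrier A" using x by (simp add: m_closed eval_closed)
  have "upow (k + m) \<otimes> x \<ominus> eval (monom 1 k * P) = upow k \<otimes> (upow m \<otimes> x \<ominus> eval P)"
    using x by (simp add: upow_add eval_mult mult_minus m_assoc m_closed eval_closed)
  then have "cnorm A (upow (k + m) \<otimes> x \<ominus> eval (monom 1 k * P)) \<le> cnorm A (upow k) * cnorm A (upow m \<otimes> x \<ominus> eval P)"
    using cnorm_mult[OF eval_closed d] by simp
  also have "\<dots> \<le> 1 * cnorm A (upow m \<otimes> x \<ominus> eval P)"
    by (intro mult_right_mono cnorm_upow_le_1 cnorm_nonneg d)
  finally show ?thesis by simp
qed

lemma laurent_approximable_add:
  assumes "laurent_approximable x" "laurent_approximable y"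
  shows "laurent_approximable (x \<oplus> y)"
  unfolding laurent_approximable_def
proof (intro conjI allI impI)
  have x: "x \<in> carrier A" and y: "y \<in> carrier A" using assms by (simp_all add: laurent_approximable_def)
  then show "x \<oplus> y \<in> carrier A" by simp
  fix \<epsilon> :: real assume "0 < \<epsilon>"
  then have e2: "0 < \<epsilon> / 2" by simp
  obtain m P where P: "cnorm A (upow m \<otimes> x \<ominus> eval P) < \<epsilon> / 2"
    using assms(1) e2 unfolding laurent_approximable_def by blast
  obtain n Q where Q: "cnorm A (upow n \<otimes> y \<ominus> eval Q) < \<epsilon> / 2"
    using assms(2) e2 unfolding laurent_approximable_def by blast
  define P' where "P' = monom 1 n * P"
  define Q' where "Q' = monom 1 m * Q"
  have P': "cnorm A (upow (n + m) \<otimes> x \<ominus> eval P') < \<epsilon> / 2"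
    using laurent_approximable_raise[OF x, of n m P] P by (simp add: P'_def)
  have Q': "cnorm A (upow (n + m) \<otimes> y \<ominus> eval Q') < \<epsilon> / 2"
    using laurent_approximable_raise[OF y, of m n Q] Q by (simp add: Q'_def add.commute)
  have "upow (n + m) \<otimes> (x \<oplus> y) \<ominus> eval (P' + Q')
      = (upow (n + m) \<otimes> x \<ominus> eval P') \<oplus> (upow (n + m) \<otimes> y \<ominus> eval Q')"
    using x y by (simp add: r_distr eval_add minus_smult smult_add smult_in m_closed eval_closed a_ac)
  then have "cnorm A (upow (n + m) \<otimes> (x \<oplus> y) \<ominus> eval (P' + Q')) < \<epsilon>"
    using P' Q' x y cnorm_triangle[of "upow (n + m) \<otimes> x \<ominus> eval P'" "upow (n + m) \<otimes> y \<ominus> eval Q'"]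
    by (simp add: m_closed eval_closed)
  then show "\<exists>m P. cnorm A (upow m \<otimes> (x \<oplus> y) \<ominus> eval P) < \<epsilon>" by blast
qed

lemma laurent_approximable_lim:
  assumes f: "\<And>n. laurent_approximable (f n)" and x: "x \<in> carrier A" and lim: "norm_lim A f x"
  shows "laurent_approximable x"
  unfolding laurent_approximable_def
proof (intro conjI allI impI x)
  fix \<epsilon> :: real assume "0 < \<epsilon>"
  then have e2: "0 < \<epsilon> / 2" by simp
  have "\<exists>n. cnorm A (f n \<ominus> x) < \<epsilon> / 2"
    using order_tendstoD(2)[OF lim[unfolded norm_lim_def] e2] by (auto simp: eventually_sequentially)
  then obtain n where n: "cnorm A (f n \<ominus> x) < \<epsilon> / 2" by blast
  have fc: "f n \<in> carrier A" using f by (simp add: laurent_approximable_def)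
  obtain m P where P: "cnorm A (upow m \<otimes> f n \<ominus> eval P) < \<epsilon> / 2"
    using f[of n] e2 unfolding laurent_approximable_def by blast
  have "cnorm A (upow m \<otimes> x \<ominus> upow m \<otimes> f n) \<le> cnorm A (upow m) * cnorm A (x \<ominus> f n)"
    using cnorm_mult[of "upow m" "x \<ominus> f n"] x fc by (simp add: eval_closed mult_minus)
  also have "\<dots> \<le> 1 * cnorm A (x \<ominus> f n)"
    using x fc by (intro mult_right_mono cnorm_upow_le_1 cnorm_nonneg) simp
  also have "\<dots> < \<epsilon> / 2" using n cnorm_minus_commute[OF x fc] by simp
  finally have "cnorm A (upow m \<otimes> x \<ominus> eval P) < \<epsilon>"
    using P cnorm_triangle_minus[of "upow m \<otimes> x" "upow m \<otimes> f n" "eval P"] x fc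
    by (simp add: m_closed eval_closed)
  then show "\<exists>m P. cnorm A (upow m \<otimes> x \<ominus> eval P) < \<epsilon>" by blast
qed

text \<open>
  With \<open>r = u\<^sup>mx - P(u)\<close> one has \<open>u\<^sup>m(ux - xu) = ur - ru\<close>, and \<open>r\<close> can be made arbitrarily small.
\<close>

lemma laurent_approximable_commute_u:
  assumes x: "laurent_approximable x" "p \<otimes> x = x" "x \<otimes> p = x"
  shows "x \<otimes> u = u \<otimes> x"
proof -
  have xc: "x \<in> carrier A" using x by (simp add: laurent_approximable_def)
  let ?d = "u \<otimes> x \<ominus> x \<otimes> u"
  have d: "?d \<in> carrier A" by (simp add: xc u_closed m_closed)
  have pd: "p \<otimes> ?d = ?d"
    using xc x by (simp add: mult_minus u_closed p_closed m_closed p_u flip: m_assoc)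
  have "cnorm A ?d \<le> 0 + \<epsilon>" if e: "0 < \<epsilon>" for \<epsilon>
  proof -
    have "0 < \<epsilon> / 2" using e by simp
    then obtain m P where P: "cnorm A (upow m \<otimes> x \<ominus> eval P) < \<epsilon> / 2"
      using x(1) unfolding laurent_approximable_def by blast
    let ?r = "upow m \<otimes> x \<ominus> eval P"
    have r: "?r \<in> carrier A" by (simp add: xc m_closed eval_closed)
    have "upow m \<otimes> ?d = u \<otimes> (upow m \<otimes> x) \<ominus> (upow m \<otimes> x) \<otimes> u"
      using xc by (simp add: mult_minus u_closed m_closed eval_closed eval_u flip: m_assoc)
    also have "\<dots> = u \<otimes> ?r \<ominus> ?r \<otimes> u"
    proof -
      have "a \<ominus> b = (a \<ominus> c) \<ominus> (b \<ominus> c)" if "a \<in> carrier A" "b \<in> carrier A" "c \<in> carrier A" for a b c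
      proof -
        have "\<ominus> (b \<ominus> c) = c \<ominus> b" using that by (simp add: minus_eq minus_add a_comm)
        then show ?thesis using that minus_add_minus[of a c b] by (simp add: minus_eq[of "a \<ominus> c" "b \<ominus> c"])
      qed
      from this[of "u \<otimes> (upow m \<otimes> x)" "(upow m \<otimes> x) \<otimes> u" "u \<otimes> eval P"]
      show ?thesis
        using xc by (simp add: mult_minus minus_mult u_closed m_closed eval_closed eval_u)
    qed
    finally have "cnorm A (upow m \<otimes> ?d) \<le> cnorm A (u \<otimes> ?r) + cnorm A (?r \<otimes> u)"
      using cnorm_triangle[of "u \<otimes> ?r" "(-1) \<odot> (?r \<otimes> u)"] r
      by (simp add: minus_smult[of "u \<otimes> ?r" "?r \<otimes> u"] m_closed u_closed smult_in cnorm_smult)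
    also have "\<dots> \<le> cnorm A ?r + cnorm A ?r"
    proof (rule add_mono)
      have "cnorm A (u \<otimes> ?r) \<le> cnorm A u * cnorm A ?r" by (rule cnorm_mult[OF u_closed r])
      also have "\<dots> \<le> 1 * cnorm A ?r" by (intro mult_right_mono cnorm_u_le_1 cnorm_nonneg r)
      finally show "cnorm A (u \<otimes> ?r) \<le> cnorm A ?r" by simp
      have "cnorm A (?r \<otimes> u) \<le> cnorm A ?r * cnorm A u" by (rule cnorm_mult[OF r u_closed])
      also have "\<dots> \<le> cnorm A ?r * 1" by (intro mult_left_mono cnorm_u_le_1 cnorm_nonneg r)
      finally show "cnorm A (?r \<otimes> u) \<le> cnorm A ?r" by simp
    qed
    finally show ?thesis using P cnorm_upow_mult[OF d pd] by simp
  qed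
  then have "cnorm A ?d \<le> 0" by (rule field_le_epsilon)
  then have "?d = \<zero>" using cnorm_eq_0[OF d] cnorm_nonneg[OF d] by simp
  then show ?thesis
    using minus_zero_imp_eq[of "u \<otimes> x" "x \<otimes> u"] xc u_closed by (simp add: m_closed)
qed

lemma commute_eval:
  assumes x: "x \<in> carrier A" "p \<otimes> x = x" "x \<otimes> p = x" and comm: "x \<otimes> u = u \<otimes> x"
  shows "x \<otimes> eval P = eval P \<otimes> x"
proof (induction P)
  case 0 show ?case using x by (simp add: eval_0 zero_mult mult_zero)
next
  case (pCons c P)
  have "x \<otimes> (u \<otimes> eval P) = (u \<otimes> x) \<otimes> eval P"
    using x by (simp add: u_closed eval_closed comm flip: m_assoc)
  also have "\<dots> = u \<otimes> (eval P \<otimes> x)"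
    using x by (simp add: u_closed eval_closed pCons m_assoc)
  finally have "x \<otimes> (u \<otimes> eval P) = u \<otimes> eval P \<otimes> x"
    using x by (simp add: u_closed eval_closed m_assoc)
  then show ?case
    using x by (simp add: eval_pCons r_distr l_distr smult_in p_closed u_closed m_closed eval_closed
        smult_mult_left smult_mult_right)
qed

end

section \<open>The corner at a cycle without exit\<close>

locale cuntz_krieger_family = cstar_algebra A + G: wf_digraph G
  for A :: "'a star_algebra" (structure) and G :: "('v, 'e) pre_digraph" +
  fixes p :: "'v \<Rightarrow> 'a" and s :: "'e \<Rightarrow> 'a"
  assumes fam: "graph_family G A p s"
begin

lemma p_proj:
  assumes "v \<in> verts G"
  shows vertex_closed: "p v \<in> carrier A" and vertex_adj: "adj A (p v) = p v" and vertex_idem: "p v \<otimes> p v = p v"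
  using fam assms by (auto simp: graph_family_def projection_def)

lemma p_orth: "v \<in> verts G \<Longrightarrow> w \<in> verts G \<Longrightarrow> v \<noteq> w \<Longrightarrow> p v \<otimes> p w = \<zero>"
  using fam by (auto simp: graph_family_def orthogonal_projections_def)

lemma s_closed: "e \<in> arcs G \<Longrightarrow> s e \<in> carrier A"
  using fam by (auto simp: graph_family_def partial_isometry_def)

lemma s_adj_closed: "e \<in> arcs G \<Longrightarrow> adj A (s e) \<in> carrier A"
  by (simp add: adj_closed s_closed)

lemma s_adj_s: "e \<in> arcs G \<Longrightarrow> adj A (s e) \<otimes> s e = p (head G e)"
  using fam by (auto simp: graph_family_def)

lemma s_range: "e \<in> arcs G \<Longrightarrow> s e \<otimes> adj A (s e) \<otimes> s e = s e"
  using fam by (auto simp: graph_family_def partial_isometry_def)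

lemma s_head: "e \<in> arcs G \<Longrightarrow> s e \<otimes> p (head G e) = s e"
  using s_range[of e] by (simp add: m_assoc s_closed s_adj_closed s_adj_s)

lemma tail_s:
  assumes e: "e \<in> arcs G"
  shows "p (tail G e) \<otimes> s e = s e"
proof -
  have "p (tail G e) \<otimes> (s e \<otimes> adj A (s e)) = s e \<otimes> adj A (s e)"
    using fam e by (auto simp: graph_family_def projection_le_def range_proj_def)
  then have "p (tail G e) \<otimes> (s e \<otimes> adj A (s e)) \<otimes> s e = s e"
    using s_range[OF e] by simp
  moreover have "p (tail G e) \<in> carrier A" using e by (simp add: vertex_closed)
  ultimately show ?thesis
    using e s_range[OF e] by (simp add: m_assoc s_closed s_adj_closed m_closed)
qed

lemma s_orth:
  assumes e: "e \<in> arcs G" and f: "f \<in> arcs G" and "e \<noteq> f"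
  shows "adj A (s e) \<otimes> s f = \<zero>"
proof -
  have 0: "(s e \<otimes> adj A (s e)) \<otimes> (s f \<otimes> adj A (s f)) = \<zero>"
    using fam assms by (auto simp: graph_family_def orthogonal_projections_def range_proj_def)
  have "adj A (s e) = adj A (s e) \<otimes> (s e \<otimes> adj A (s e))"
    using arg_cong[OF s_range[OF e], of "adj A"] e
    by (simp add: adj_mult adj_adj s_closed s_adj_closed m_closed)
  then have "adj A (s e) \<otimes> s f = (adj A (s e) \<otimes> (s e \<otimes> adj A (s e))) \<otimes> (s f \<otimes> adj A (s f) \<otimes> s f)"
    using s_range[OF f] by simp
  also have "\<dots> = adj A (s e) \<otimes> ((s e \<otimes> adj A (s e)) \<otimes> (s f \<otimes> adj A (s f))) \<otimes> s f"
    using e f by (simp add: m_assoc s_closed s_adj_closed m_closed)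
  finally show ?thesis
    using e f by (simp add: 0 mult_zero zero_mult s_closed s_adj_closed)
qed

lemma p_s_eq_0:
  assumes "v \<in> verts G" "e \<in> arcs G" "v \<noteq> tail G e"
  shows "p v \<otimes> s e = \<zero>"
proof -
  have "p v \<otimes> s e = (p v \<otimes> p (tail G e)) \<otimes> s e"
    using assms tail_s[of e] by (simp add: m_assoc vertex_closed s_closed)
  then show ?thesis using assms by (simp add: p_orth zero_mult s_closed)
qed

definition path_elem :: "'v \<Rightarrow> 'e list \<Rightarrow> 'a" where
  "path_elem v \<beta> = foldr (\<lambda>e x. s e \<otimes> x) \<beta> (p v)"

lemma path_elem_simps [simp]:
  "path_elem v [] = p v" "path_elem v (e # \<beta>) = s e \<otimes> path_elem v \<beta>"
  by (simp_all add: path_elem_def)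

lemma awalk_Cons: "G.awalk w (e # \<beta>) v \<longleftrightarrow> e \<in> arcs G \<and> tail G e = w \<and> G.awalk (head G e) \<beta> v"
  by (auto simp: G.awalk_def)

text \<open>
  The partial isometry of a path from \<open>w\<close> to \<open>v\<close> has initial projection \<open>p v\<close> and range below \<open>p w\<close>.
\<close>

lemma path_elem:
  assumes "G.awalk w \<beta> v"
  shows path_elem_closed: "path_elem v \<beta> \<in> carrier A"
    and p_path_elem: "p w \<otimes> path_elem v \<beta> = path_elem v \<beta>"
    and path_elem_p: "path_elem v \<beta> \<otimes> p v = path_elem v \<beta>"
    and adj_path_elem: "adj A (path_elem v \<beta>) \<otimes> path_elem v \<beta> = p v"
proof -
  from assms have "path_elem v \<beta> \<in> carrier A \<and> p w \<otimes> path_elem v \<beta> = path_elem v \<beta> \<and>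
    path_elem v \<beta> \<otimes> p v = path_elem v \<beta> \<and> adj A (path_elem v \<beta>) \<otimes> path_elem v \<beta> = p v"
  proof (induction \<beta> arbitrary: w)
    case Nil
    then have "w = v" "v \<in> verts G" by (auto simp: G.awalk_Nil_iff)
    then show ?case by (simp add: vertex_closed vertex_adj vertex_idem)
  next
    case (Cons e \<beta>)
    then have e: "e \<in> arcs G" "tail G e = w" and "G.awalk (head G e) \<beta> v"
      by (auto simp: awalk_Cons)
    with Cons have IH: "path_elem v \<beta> \<in> carrier A" "p (head G e) \<otimes> path_elem v \<beta> = path_elem v \<beta>"
      "path_elem v \<beta> \<otimes> p v = path_elem v \<beta>" "adj A (path_elem v \<beta>) \<otimes> path_elem v \<beta> = p v"
      by blast+
    have v: "v \<in> verts G" using Cons.prems by (rule G.awalk_last_in_verts)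
    have w: "w \<in> verts G" using e by auto
    have "adj A (s e \<otimes> path_elem v \<beta>) \<otimes> (s e \<otimes> path_elem v \<beta>)
        = adj A (path_elem v \<beta>) \<otimes> ((adj A (s e) \<otimes> s e) \<otimes> path_elem v \<beta>)"
      using e IH by (simp add: adj_mult m_assoc adj_closed s_closed m_closed)
    then have "adj A (s e \<otimes> path_elem v \<beta>) \<otimes> (s e \<otimes> path_elem v \<beta>) = p v"
      using e IH by (simp add: s_adj_s)
    moreover have "p w \<otimes> (s e \<otimes> path_elem v \<beta>) = s e \<otimes> path_elem v \<beta>"
      using e IH w tail_s[of e] by (simp add: s_closed vertex_closed flip: m_assoc)
    moreover have "s e \<otimes> path_elem v \<beta> \<otimes> p v = s e \<otimes> path_elem v \<beta>"
      using e IH v by (simp add: s_closed vertex_closed m_assoc)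
    ultimately show ?case using e IH by (simp add: s_closed m_closed)
  qed
  then show "path_elem v \<beta> \<in> carrier A" "p w \<otimes> path_elem v \<beta> = path_elem v \<beta>"
    "path_elem v \<beta> \<otimes> p v = path_elem v \<beta>" "adj A (path_elem v \<beta>) \<otimes> path_elem v \<beta> = p v" by blast+
qed

lemma path_elem_adj_p: "G.awalk w \<beta> v \<Longrightarrow> adj A (path_elem v \<beta>) \<otimes> p w = adj A (path_elem v \<beta>)"
  using arg_cong[OF p_path_elem, of w \<beta> v "adj A"]
  by (simp add: adj_mult path_elem_closed vertex_closed vertex_adj G.awalk_hd_in_verts)

end

locale cycle_without_exit = cuntz_krieger_family A G p s
  for A :: "'a star_algebra" (structure) and G :: "('v, 'e) pre_digraph" and p s +
  fixes \<mu> :: "'e list"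
  assumes cycle: "simple_closed_path G \<mu>" and no_exit: "\<And>e. \<not> is_exit G \<mu> e"
begin

abbreviation base :: 'v where "base \<equiv> tail G (hd \<mu>)"

lemma cycle_ne: "\<mu> \<noteq> []" and cycle_arcs: "set \<mu> \<subseteq> arcs G"
  using cycle by (auto simp: simple_closed_path_def closed_path_def edge_path_def)

lemma base_vert: "base \<in> verts G"
  using cycle_ne cycle_arcs by (auto simp: subset_iff)

lemma edge_from_cycle: "i < length \<mu> \<Longrightarrow> e \<in> arcs G \<Longrightarrow> tail G e = tail G (\<mu> ! i) \<Longrightarrow> e = \<mu> ! i"
  using no_exit[of e] by (auto simp: is_exit_def)

lemma head_cycle: "i < length \<mu> \<Longrightarrow> head G (\<mu> ! i) = (if Suc i < length \<mu> then tail G (\<mu> ! Suc i) else base)"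
proof -
  assume i: "i < length \<mu>"
  have "last \<mu> = \<mu> ! i" if "\<not> Suc i < length \<mu>"
  proof -
    have "i = length \<mu> - 1" using i that by linarith
    then show ?thesis using cycle_ne by (simp add: last_conv_nth)
  qed
  then show ?thesis
    using cycle i by (auto simp: simple_closed_path_def closed_path_def edge_path_def)
qed

lemma awalk_drop: "i \<le> length \<mu> \<Longrightarrow> G.awalk (if i < length \<mu> then tail G (\<mu> ! i) else base) (drop i \<mu>) base"
proof (induction i rule: inc_induct)
  case base show ?case by (simp add: G.awalk_Nil_iff base_vert)
next
  case (step i)
  have i: "i < length \<mu>" using step by simp
  have "\<mu> ! i \<in> arcs G" using i cycle_arcs nth_mem by blast
  moreover have "G.awalk (head G (\<mu> ! i)) (drop (Suc i) \<mu>) base"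
    using step.IH unfolding head_cycle[OF i] .
  moreover have "drop i \<mu> = \<mu> ! i # drop (Suc i) \<mu>" using i by (simp add: Cons_nth_drop_Suc)
  ultimately show ?case using i by (simp add: awalk_Cons)
qed

lemma awalk_cycle: "G.awalk base \<mu> base"
  using awalk_drop[of 0] cycle_ne by (simp add: hd_conv_nth)

text \<open>
  A vertex of the cycle emits one edge only, so the sum in the relation for regular vertices has one
  term.
\<close>

lemma cycle_edge_range: "e \<in> set \<mu> \<Longrightarrow> s e \<otimes> adj A (s e) = p (tail G e)"
proof -
  assume e: "e \<in> set \<mu>"
  then obtain i where i: "i < length \<mu>" "e = \<mu> ! i" by (auto simp: in_set_conv_nth)
  have ea: "e \<in> arcs G" using e cycle_arcs by blast
  have out: "out_arcs G (tail G e) = {e}"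
    using i ea edge_from_cycle by (auto simp: i(2))
  then have "regular_vertex G (tail G e)" using ea by (simp add: regular_vertex_def)
  then have "p (tail G e) = (\<Oplus>f\<in>out_arcs G (tail G e). range_proj A (s f))"
    using fam by (simp add: graph_family_def)
  also have "\<dots> = range_proj A (s e)"
    unfolding out using ea finsum_insert[of "{}" e "\<lambda>f. range_proj A (s f)"]
    by (simp add: range_proj_def m_closed s_closed s_adj_closed)
  finally show ?thesis by (simp add: range_proj_def)
qed

text \<open>
  Hence paths along the cycle give unitaries between the corners at their ends.
\<close>

lemma cycle_path_range:
  "G.awalk w \<beta> base \<Longrightarrow> set \<beta> \<subseteq> set \<mu> \<Longrightarrow> path_elem base \<beta> \<otimes> adj A (path_elem base \<beta>) = p w"
proof (induction \<beta> arbitrary: w)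
  case Nil
  then have "w = base" by (simp add: G.awalk_Nil_iff)
  then show ?case using base_vert by (simp add: vertex_adj vertex_idem)
next
  case (Cons e \<beta>)
  then have e: "e \<in> arcs G" "tail G e = w" "G.awalk (head G e) \<beta> base" and em: "e \<in> set \<mu>"
    by (auto simp: awalk_Cons)
  have IH: "path_elem base \<beta> \<otimes> adj A (path_elem base \<beta>) = p (head G e)"
    using Cons e by simp
  have c: "path_elem base \<beta> \<in> carrier A" using e by (simp add: path_elem_closed)
  have "path_elem base (e # \<beta>) \<otimes> adj A (path_elem base (e # \<beta>))
      = s e \<otimes> (path_elem base \<beta> \<otimes> adj A (path_elem base \<beta>)) \<otimes> adj A (s e)"
    using c e by (simp add: adj_mult m_assoc m_closed s_closed adj_closed)
  also have "\<dots> = p w" using e em by (simp add: IH s_head cycle_edge_range)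
  finally show ?case .
qed

definition u :: 'a where "u = path_elem base \<mu>"

sublocale corner_unitary A "p base" u
proof
  show "projection A (p base)" using fam base_vert by (simp add: graph_family_def)
  show "u \<in> carrier A" unfolding u_def by (rule path_elem_closed[OF awalk_cycle])
  show "adj A u \<otimes> u = p base" unfolding u_def by (rule adj_path_elem[OF awalk_cycle])
  show "u \<otimes> adj A u = p base" unfolding u_def by (rule cycle_path_range[OF awalk_cycle]) simp
qed

text \<open>
  A path that starts on the cycle never leaves it.  If it ends at the base it runs through the rest of the
  cycle and then goes round a number of times.  The additional factor \<open>u\<close> on the left-hand side is
  there for the empty path: it has \<open>i = 0\<close>, and the right-hand side then begins with a full turn.
\<close>

lemma path_from_cycle:
  "G.awalk w \<beta> base \<Longrightarrow> i < length \<mu> \<Longrightarrow> w = tail G (\<mu> ! i) \<Longrightarrow>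
    \<exists>m. path_elem base \<beta> \<otimes> u = path_elem base (drop i \<mu>) \<otimes> upow m"
proof (induction \<beta> arbitrary: w i)
  case Nil
  \<comment> \<open>a simple closed path visits its base only at the start\<close>
  have "i = 0"
  proof (rule ccontr)
    assume "i \<noteq> 0"
    then have "tail G (\<mu> ! i) \<noteq> base" using cycle Nil by (simp add: simple_closed_path_def)
    then show False using Nil by (simp add: G.awalk_Nil_iff)
  qed
  then show ?case
    by (intro exI[of _ 0]) (simp only: drop_0 path_elem_simps u_def[symmetric] upow_0 u_p p_u)
next
  case (Cons e \<beta>)
  then have e: "e \<in> arcs G" "tail G e = w" "G.awalk (head G e) \<beta> base" by (auto simp: awalk_Cons)
  have ei: "e = \<mu> ! i" using e Cons edge_from_cycle by blast
  have drop: "path_elem base (drop i \<mu>) = s e \<otimes> path_elem base (drop (Suc i) \<mu>)"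
    using Cons.prems ei by (simp flip: Cons_nth_drop_Suc)
  have c: "path_elem base \<beta> \<in> carrier A" using e by (simp add: path_elem_closed)
  have c': "path_elem base (drop (Suc i) \<mu>) \<in> carrier A"
    using awalk_drop[of "Suc i"] Cons.prems by (intro path_elem_closed) auto
  have "\<exists>m. path_elem base \<beta> \<otimes> u = path_elem base (drop (Suc i) \<mu>) \<otimes> upow m"
  proof (cases "Suc i < length \<mu>")
    case True
    then show ?thesis using Cons.IH[of "head G e" "Suc i"] e Cons.prems ei by (simp add: head_cycle)
  next
    case False
    then have h: "head G e = base" using ei Cons.prems by (simp add: head_cycle)
    then have "\<exists>m. path_elem base \<beta> \<otimes> u = path_elem base (drop 0 \<mu>) \<otimes> upow m"
      using Cons.IH[of "head G e" 0] e cycle_ne by (simp add: hd_conv_nth)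
    then obtain m where "path_elem base \<beta> \<otimes> u = u \<otimes> upow m" by (auto simp: u_def)
    then have "path_elem base \<beta> \<otimes> u = path_elem base (drop (Suc i) \<mu>) \<otimes> upow (Suc m)"
      using False by (simp add: upow_Suc[symmetric] p_eval)
    then show ?thesis by blast
  qed
  then obtain m where "path_elem base \<beta> \<otimes> u = path_elem base (drop (Suc i) \<mu>) \<otimes> upow m" by blast
  then have "path_elem base (e # \<beta>) \<otimes> u = path_elem base (drop i \<mu>) \<otimes> upow m"
    using e c c' by (simp add: drop m_assoc s_closed u_closed eval_closed)
  then show ?case by blast
qed

text \<open>
  The elements \<open>u\<^sup>k s\<^sub>\<beta>\<^sup>*\<close> for paths \<open>\<beta>\<close> into the base.  Negative powers of \<open>u\<close> are covered, as they arise from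
  paths \<open>\<beta>\<close> that end with turns round the cycle.
\<close>

definition corner_words :: "'a set" where
  "corner_words = {upow k \<otimes> adj A (path_elem base \<beta>) | k \<beta> w. G.awalk w \<beta> base}"

lemma corner_words_carrier: "corner_words \<subseteq> carrier A"
  by (auto simp: corner_words_def intro!: m_closed eval_closed adj_closed path_elem_closed)

lemma corner_words_mult_p:
  assumes "x \<in> corner_words" "v \<in> verts G"
  shows "x \<otimes> p v \<in> closed_span A corner_words"
proof -
  obtain k \<beta> w where x: "x = upow k \<otimes> adj A (path_elem base \<beta>)" and w: "G.awalk w \<beta> base"
    using assms by (auto simp: corner_words_def)
  have wv: "w \<in> verts G" using w by (rule G.awalk_hd_in_verts)
  have c: "adj A (path_elem base \<beta>) \<in> carrier A" using w by (simp add: adj_closed path_elem_closed)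
  have xp: "x \<otimes> p w = x"
    using c wv by (simp add: x m_assoc eval_closed vertex_closed path_elem_adj_p[OF w])
  have xc: "x \<in> carrier A" using assms(1) corner_words_carrier by blast
  show ?thesis
  proof (cases "v = w")
    case True then show ?thesis using xp assms(1) by (simp add: closed_span_base)
  next
    case False
    have "x \<otimes> p v = x \<otimes> (p w \<otimes> p v)"
      using xc wv assms(2) by (subst xp[symmetric]) (simp add: m_assoc vertex_closed)
    then show ?thesis using False wv assms(2) xc by (simp add: p_orth mult_zero closed_span_zero)
  qed
qed

lemma corner_words_mult_adj_s:
  assumes "x \<in> corner_words" "f \<in> arcs G"
  shows "x \<otimes> adj A (s f) \<in> closed_span A corner_words"
proof -
  obtain k \<beta> w where x: "x = upow k \<otimes> adj A (path_elem base \<beta>)" and w: "G.awalk w \<beta> base"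
    using assms by (auto simp: corner_words_def)
  have wv: "w \<in> verts G" using w by (rule G.awalk_hd_in_verts)
  have c: "path_elem base \<beta> \<in> carrier A" using w by (simp add: path_elem_closed)
  have eq: "x \<otimes> adj A (s f) = upow k \<otimes> adj A (s f \<otimes> path_elem base \<beta>)"
    using c assms(2) by (simp add: x m_assoc eval_closed s_closed adj_closed adj_mult)
  show ?thesis
  proof (cases "head G f = w")
    case True
    then have "G.awalk (tail G f) (f # \<beta>) base" using w assms(2) by (simp add: awalk_Cons)
    then have "x \<otimes> adj A (s f) \<in> corner_words"
      unfolding corner_words_def eq path_elem_simps(2)[symmetric] by blast
    then show ?thesis by (rule closed_span_base)
  next
    case False
    have "s f \<otimes> path_elem base \<beta> = s f \<otimes> p (head G f) \<otimes> (p w \<otimes> path_elem base \<beta>)"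
      using assms(2) by (simp add: s_head p_path_elem[OF w])
    also have "\<dots> = s f \<otimes> (p (head G f) \<otimes> p w) \<otimes> path_elem base \<beta>"
      using assms(2) c wv by (simp add: m_assoc s_closed vertex_closed m_closed)
    also have "\<dots> = \<zero>"
      using False assms(2) c wv by (simp add: p_orth mult_zero zero_mult s_closed)
    finally have "x \<otimes> adj A (s f) = upow k \<otimes> adj A \<zero>" by (simp add: eq)
    also have "adj A \<zero> = \<zero>"
      using adj_smult[of \<zero> 0] by (simp add: zero_smult adj_closed)
    finally show ?thesis by (simp add: mult_zero eval_closed closed_span_zero)
  qed
qed

text \<open>
  Multiplication by \<open>s\<^sub>f\<close> cancels the first edge of \<open>\<beta>\<close>.  If \<open>\<beta>\<close> is empty and \<open>f\<close> starts at the base, then \<open>f\<close>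
  is the first edge of the cycle and \<open>s\<^sub>f = u s\<^sub>\<gamma>\<^sup>*\<close> where \<open>\<gamma>\<close> is the rest of the cycle.
\<close>

lemma corner_words_mult_s:
  assumes "x \<in> corner_words" "f \<in> arcs G"
  shows "x \<otimes> s f \<in> closed_span A corner_words"
proof -
  obtain k \<beta> w where x: "x = upow k \<otimes> adj A (path_elem base \<beta>)" and w: "G.awalk w \<beta> base"
    using assms by (auto simp: corner_words_def)
  show ?thesis
  proof (cases \<beta>)
    case (Cons g \<beta>')
    then have g: "g \<in> arcs G" and w': "G.awalk (head G g) \<beta>' base" using w by (auto simp: awalk_Cons)
    have c: "path_elem base \<beta>' \<in> carrier A" using w' by (simp add: path_elem_closed)
    have eq: "x \<otimes> s f = upow k \<otimes> (adj A (path_elem base \<beta>') \<otimes> (adj A (s g) \<otimes> s f))"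
      using c g assms(2) by (simp add: x Cons m_assoc m_closed eval_closed s_closed adj_closed adj_mult)
    show ?thesis
    proof (cases "f = g")
      case True
      then have "x \<otimes> s f = upow k \<otimes> adj A (path_elem base \<beta>')"
        using eq g by (simp add: s_adj_s path_elem_adj_p[OF w'])
      then have "x \<otimes> s f \<in> corner_words" using w' unfolding corner_words_def by blast
      then show ?thesis by (rule closed_span_base)
    next
      case False
      then have "x \<otimes> s f = \<zero>"
        using eq g assms(2) c s_orth[of g f] by (simp add: mult_zero eval_closed adj_closed)
      then show ?thesis by (simp add: closed_span_zero)
    qed
  next
    case Nil
    then have x': "x = upow k" using base_vert by (simp add: x vertex_adj eval_p)
    have fc: "s f \<in> carrier A" using assms(2) by (rule s_closed)
    have xf: "x \<otimes> s f = upow k \<otimes> (p base \<otimes> s f)"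
      using fc base_vert by (simp add: x' eval_closed eval_p vertex_closed flip: m_assoc)
    show ?thesis
    proof (cases "tail G f = base")
      case False
      then show ?thesis
        using xf assms(2) base_vert p_s_eq_0[of base f]
        by (simp add: mult_zero eval_closed closed_span_zero)
    next
      case True
      then have f: "f = hd \<mu>"
        using edge_from_cycle[of 0 f] assms(2) cycle_ne by (simp add: hd_conv_nth)
      have \<mu>: "\<mu> = f # tl \<mu>" using f cycle_ne by simp
      have wt: "G.awalk (head G f) (tl \<mu>) base" using awalk_cycle \<mu> awalk_Cons by metis
      have c: "path_elem base (tl \<mu>) \<in> carrier A" using wt by (simp add: path_elem_closed)
      have "u = s f \<otimes> path_elem base (tl \<mu>)"
        unfolding u_def by (subst \<mu>) simp
      then have "u \<otimes> adj A (path_elem base (tl \<mu>)) = s f \<otimes> (path_elem base (tl \<mu>) \<otimes> adj A (path_elem base (tl \<mu>)))"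
        using c fc by (simp add: m_assoc adj_closed)
      also have "path_elem base (tl \<mu>) \<otimes> adj A (path_elem base (tl \<mu>)) = p (head G f)"
        by (rule cycle_path_range[OF wt]) (use cycle_ne in \<open>auto dest: list.set_sel(2)\<close>)
      finally have uf: "u \<otimes> adj A (path_elem base (tl \<mu>)) = s f" using assms(2) by (simp add: s_head)
      have "x \<otimes> s f = upow (Suc k) \<otimes> adj A (path_elem base (tl \<mu>))"
        using c by (simp add: x' uf[symmetric] upow_Suc eval_u[symmetric] m_assoc eval_closed u_closed adj_closed)
      then have "x \<otimes> s f \<in> corner_words" using wt unfolding corner_words_def by blast
      then show ?thesis by (rule closed_span_base)
    qed
  qed
qed

text \<open>
  After multiplication by \<open>p\<close> from the right only paths \<open>\<beta>\<close> from the base to itself survive.  For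
  these \<open>s\<^sub>\<beta>u = u\<^sup>m\<^sup>+\<^sup>1\<close> for some \<open>m\<close>, so that \<open>s\<^sub>\<beta>\<^sup>*\<close> is an inverse of \<open>u\<^sup>m\<close> in the corner.
\<close>

lemma corner_words_approximable:
  assumes "x \<in> corner_words"
  shows "laurent_approximable (x \<otimes> p base)"
proof -
  obtain k \<beta> w where x: "x = upow k \<otimes> adj A (path_elem base \<beta>)" and w: "G.awalk w \<beta> base"
    using assms by (auto simp: corner_words_def)
  let ?s = "path_elem base \<beta>"
  have wv: "w \<in> verts G" using w by (rule G.awalk_hd_in_verts)
  have c: "?s \<in> carrier A" using w by (simp add: path_elem_closed)
  have xc: "x \<in> carrier A" using assms corner_words_carrier by blast
  show ?thesis
  proof (cases "w = base")
    case True
    then obtain m where "?s \<otimes> u = u \<otimes> upow m"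
      using path_from_cycle[OF w, of 0] cycle_ne by (auto simp: hd_conv_nth u_def)
    then have su: "?s \<otimes> u = upow (Suc m)" by (simp add: upow_Suc)
    have "u \<otimes> adj A (upow (Suc m)) = u \<otimes> adj A u \<otimes> adj A ?s"
      using c by (simp add: adj_mult adj_closed u_closed m_assoc flip: su)
    also have "\<dots> = adj A ?s"
      using c arg_cong[OF path_elem_p[OF w], of "adj A"]
      by (simp add: u_right adj_mult vertex_closed base_vert vertex_adj)
    finally have "upow (Suc m) \<otimes> adj A ?s = upow (Suc m) \<otimes> (u \<otimes> adj A (upow (Suc m)))" by simp
    also have "\<dots> = u \<otimes> (upow (Suc m) \<otimes> adj A (upow (Suc m)))"
      by (simp add: eval_closed u_closed adj_closed eval_u flip: m_assoc)
    also have "\<dots> = u" by (simp add: upow_adj u_p)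
    finally have us: "upow (Suc m) \<otimes> adj A ?s = u" .
    have "upow (Suc m) \<otimes> (x \<otimes> p base) = upow (Suc m) \<otimes> (upow k \<otimes> adj A ?s)"
      using c path_elem_adj_p[OF w] by (simp add: x True m_assoc eval_closed adj_closed vertex_closed base_vert)
    also have "\<dots> = (upow (Suc m) \<otimes> upow k) \<otimes> adj A ?s"
      using c by (simp add: m_assoc eval_closed adj_closed)
    also have "upow (Suc m) \<otimes> upow k = upow k \<otimes> upow (Suc m)" by (rule eval_commute)
    also have "\<dots> \<otimes> adj A ?s = upow k \<otimes> u"
      using c by (simp add: m_assoc eval_closed adj_closed us)
    also have "\<dots> = upow (Suc k)" by (simp add: upow_Suc eval_u)
    finally show ?thesis
      using xc base_vert by (intro laurent_approximable_exact) (simp_all add: m_closed vertex_closed)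
  next
    case False
    have "x \<otimes> p base = upow k \<otimes> (adj A ?s \<otimes> p w) \<otimes> p base"
      by (simp add: path_elem_adj_p[OF w] x)
    also have "\<dots> = upow k \<otimes> adj A ?s \<otimes> (p w \<otimes> p base)"
      using c wv base_vert by (simp add: m_assoc m_closed eval_closed adj_closed vertex_closed)
    also have "\<dots> = \<zero>"
      using False wv base_vert xc by (simp add: p_orth mult_zero flip: x)
    finally show ?thesis
      using laurent_approximable_exact[of \<zero> 0 0] by (simp add: mult_zero eval_closed eval_0)
  qed
qed

text \<open>
  The closed span of the words \<open>u\<^sup>k s\<^sub>\<beta>\<^sup>*\<close> contains \<open>p\<close> and is stable under multiplication by \<open>A\<close> from the
  right, so it contains \<open>pA\<close>.
\<close>

theorem corner_laurent_approximable:
  assumes gen: "generates A (p ` verts G \<union> s ` arcs G)" and a: "a \<in> carrier A"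
  shows "laurent_approximable (p base \<otimes> a \<otimes> p base)"
proof -
  have A: "cstar_algebra A" by unfold_locales
  have "p base \<in> corner_words"
    unfolding corner_words_def
    by (rule CollectI, rule exI[of _ 0], rule exI[of _ "[]"], rule exI[of _ base])
      (simp only: path_elem_simps upow_0 vertex_adj[OF base_vert] vertex_idem[OF base_vert] G.awalk_Nil_iff base_vert)
  then have "p base \<in> closed_span A corner_words" by (rule closed_span_base)
  moreover have "p ` verts G \<union> s ` arcs G \<subseteq> carrier A" by (auto simp: vertex_closed s_closed)
  ultimately have "p base \<otimes> a \<in> closed_span A corner_words"
    by (intro closed_span_right_ideal[OF A corner_words_carrier _ gen _ _ _ a])
      (auto simp: corner_words_mult_p corner_words_mult_s corner_words_mult_adj_s vertex_adj)
  then show ?thesis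
  proof induction
    case closed_span_zero
    then show ?case
      using laurent_approximable_exact[of \<zero> 0 0] base_vert
      by (simp add: zero_mult vertex_closed mult_zero eval_closed eval_0)
  next
    case (closed_span_base x) then show ?case by (rule corner_words_approximable)
  next
    case (closed_span_add x y)
    then show ?case
      using closed_span_carrier[OF A corner_words_carrier] base_vert
      by (simp add: l_distr vertex_closed laurent_approximable_add)
  next
    case (closed_span_smult x c)
    then show ?case
      using closed_span_carrier[OF A corner_words_carrier] base_vert
      by (simp add: smult_mult_left vertex_closed laurent_approximable_smult)
  next
    case (closed_span_lim f x)
    then have fc: "f n \<in> carrier A" for n
      using closed_span_carrier[OF A corner_words_carrier] by blast
    show ?case
      by (rule laurent_approximable_lim[of "\<lambda>n. f n \<otimes> p base"])
        (use closed_span_lim fc base_vert in \<open>auto intro!: norm_lim_mult_right simp: vertex_closed m_closed\<close>)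
  qed
qed

end

section \<open>No multiple of p - u is a non-zero idempotent\<close>

lemma higher_deriv_poly: "(deriv ^^ n) (poly P) = poly ((pderiv ^^ n) P)" for P :: "complex poly"
proof (induction n)
  case (Suc n)
  then show ?case by (auto simp: DERIV_imp_deriv[OF poly_DERIV])
qed simp

text \<open>
  Cauchy's inequality for the derivatives at the origin.
\<close>

lemma coeff_le_unit_circle_bound:
  fixes P :: "complex poly"
  assumes "\<And>w. cmod w = 1 \<Longrightarrow> cmod (poly P w) \<le> M"
  shows "cmod (coeff P k) \<le> M"
proof -
  have "cmod ((deriv ^^ k) (poly P) 0) \<le> fact k * M / 1 ^ k"
    by (rule Cauchy_inequality) (use assms in \<open>auto intro!: holomorphic_intros continuous_intros\<close>)
  moreover have "(deriv ^^ k) (poly P) 0 = fact k * coeff P k"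
    by (simp add: higher_deriv_poly poly_0_coeff_0 coeff_higher_pderiv pochhammer_fact)
  ultimately show ?thesis by (simp add: norm_mult)
qed

context corner_unitary
begin

text \<open>
  Compare two estimates of \<open>e P(u)\<^sup>N\<close>.  From below: on \<open>eA\<close>, left multiplication by \<open>P(u)\<close> differs by at most \<open>1/4\<close>
  from left multiplication by the isometric \<open>u\<^sup>m\<close>, so it
  shrinks the norm at most by the factor \<open>3/4\<close>.
  From above: the coefficients of \<open>P\<^sup>N\<close> are at most \<open>1/4\<^sup>N\<close>, and there are at most \<open>N deg P + 1\<close> of them.
\<close>

lemma idempotent_near_small_laurent_eq_0:
  assumes e: "e \<in> carrier A" "p \<otimes> e = e" "e \<otimes> p = e" "e \<otimes> e = e" "e \<otimes> u = u \<otimes> e"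
    and near: "cnorm A (upow m \<otimes> e \<ominus> eval P) \<le> 1 / 4"
    and small: "\<And>w. cmod w = 1 \<Longrightarrow> cmod (poly P w) \<le> 1 / 4"
  shows "e = \<zero>"
proof -
  let ?r = "upow m \<otimes> e \<ominus> eval P"
  have r: "?r \<in> carrier A" by (simp add: e m_closed eval_closed)
  have lower: "(3 / 4) ^ N * cnorm A e \<le> cnorm A (e \<otimes> eval (P ^ N))" for N
  proof (induction N)
    case 0 show ?case by (simp add: eval_1 e)
  next
    case (Suc N)
    let ?y = "e \<otimes> eval (P ^ N)"
    have y: "?y \<in> carrier A" by (simp add: e m_closed eval_closed)
    have ey: "e \<otimes> ?y = ?y" "p \<otimes> ?y = ?y" using e by (simp_all add: eval_closed p_closed flip: m_assoc)
    have "e \<otimes> eval (P ^ Suc N) = (e \<otimes> eval P) \<otimes> eval (P ^ N)"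
      using e by (simp add: eval_mult eval_closed m_assoc)
    also have "e \<otimes> eval P = eval P \<otimes> e" by (rule commute_eval) (use e in auto)
    finally have eq: "e \<otimes> eval (P ^ Suc N) = eval P \<otimes> ?y"
      using e by (simp add: eval_closed m_assoc)
    have ry: "?r \<otimes> ?y = upow m \<otimes> ?y \<ominus> eval P \<otimes> ?y"
      using e y ey by (simp add: minus_mult m_closed eval_closed m_assoc[of "upow m" e ?y])
    have "upow m \<otimes> ?y = (upow m \<otimes> ?y \<ominus> eval P \<otimes> ?y) \<oplus> eval P \<otimes> ?y"
      using y by (simp add: minus_eq a_assoc l_neg m_closed eval_closed)
    then have "upow m \<otimes> ?y = ?r \<otimes> ?y \<oplus> eval P \<otimes> ?y" unfolding ry .
    then have "cnorm A ?y \<le> cnorm A (?r \<otimes> ?y) + cnorm A (eval P \<otimes> ?y)"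
      using cnorm_upow_mult[OF y ey(2), of m] cnorm_triangle[of "?r \<otimes> ?y" "eval P \<otimes> ?y"] y r
      by (simp add: m_closed eval_closed)
    moreover have "cnorm A (?r \<otimes> ?y) \<le> 1 / 4 * cnorm A ?y"
      using cnorm_mult[OF r y] mult_right_mono[OF near cnorm_nonneg[OF y]] by linarith
    ultimately have "3 / 4 * cnorm A ?y \<le> cnorm A (eval P \<otimes> ?y)" by simp
    then show ?case using Suc unfolding eq by simp
  qed
  define d where "d = degree P"
  have upper: "cnorm A (e \<otimes> eval (P ^ N)) \<le> cnorm A e * (real (N * d + 1) * (1 / 4) ^ N)" for N
  proof -
    have "cmod (coeff (P ^ N) k) \<le> (1 / 4) ^ N" for k
      by (rule coeff_le_unit_circle_bound) (use small in \<open>auto simp: norm_power intro!: power_mono\<close>)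
    then have "cnorm A (eval (P ^ N)) \<le> real (degree (P ^ N) + 1) * (1 / 4) ^ N"
      by (rule cnorm_eval_le_coeff_bound)
    also have "\<dots> \<le> real (N * d + 1) * (1 / 4) ^ N"
      using degree_power_le[of P N]
      by (intro mult_right_mono) (simp_all add: d_def mult.commute flip: of_nat_mult)
    finally have "cnorm A e * cnorm A (eval (P ^ N)) \<le> cnorm A e * (real (N * d + 1) * (1 / 4) ^ N)"
      by (intro mult_left_mono cnorm_nonneg e)
    then show ?thesis using cnorm_mult[OF e(1) eval_closed] order_trans by blast
  qed
  show ?thesis
  proof (rule ccontr)
    assume "e \<noteq> \<zero>"
    then have pos: "0 < cnorm A e" using cnorm_eq_0[OF e(1)] cnorm_nonneg[OF e(1)] by simp
    \<comment> \<open>even, so that Bernoulli's inequality for half the exponent bounds \<open>3\<^sup>N\<close> below by a quadratic in \<open>d\<close>\<close>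
    define N where "N = 2 * (d + 1)"
    have "(3 / 4) ^ N * cnorm A e \<le> cnorm A e * (real (N * d + 1) * (1 / 4) ^ N)"
      using lower upper order_trans by blast
    then have "(3 / 4) ^ N \<le> real (N * d + 1) * (1 / 4 :: real) ^ N"
      using pos by (simp add: mult.commute[of _ "cnorm A e"])
    then have "(3 :: real) ^ N \<le> real (N * d + 1)"
      by (simp add: power_divide field_simps)
    moreover have "(1 + 2 * real (d + 1))\<^sup>2 \<le> 3 ^ N"
    proof -
      have "1 + real (d + 1) * 2 \<le> (1 + 2) ^ (d + 1)" by (rule Bernoulli_inequality) simp
      then have "(1 + real (d + 1) * 2)\<^sup>2 \<le> ((1 + 2) ^ (d + 1))\<^sup>2" by (rule power_mono) simp
      then show ?thesis by (simp add: N_def power_mult[symmetric] mult.commute)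
    qed
    ultimately have "(1 + 2 * real (d + 1))\<^sup>2 \<le> real (N * d + 1)" by linarith
    then have "8 + (real d * 10 + real d * (real d * 2)) \<le> 0"
      by (simp add: N_def power2_eq_square algebra_simps)
    moreover have "0 \<le> real d * 10 + real d * (real d * 2)" by simp
    ultimately show False by linarith
  qed
qed

lemma star_hom_eval:
  fixes \<pi> :: "'a \<Rightarrow> 'i ell2_op"
  assumes hom: "star_hom A ell2_algebra \<pi>"
    and ev: "\<pi> p \<xi> = \<xi>" "\<pi> u \<xi> = scale_ell2 w \<xi>"
  shows "\<pi> (eval P) \<xi> = scale_ell2 (poly P w) \<xi>"
proof (induction P)
  case 0
  have "\<pi> \<zero> = \<pi> (0 \<odot> p)" using p_closed by (simp add: zero_smult)
  also have "\<dots> = scale_op 0 o\<^sub>L \<pi> p" using hom p_closed by (simp add: star_hom_def)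
  finally show ?case by (auto simp: eval_0 intro!: ell2_eqI)
next
  case (pCons c P)
  have lin: "\<pi> u (scale_ell2 a x) = scale_ell2 a (\<pi> u x)" for a x
    using hom u_closed by (auto simp: star_hom_def ell2_algebra_carrier complex_linear_def Pi_iff)
  have "\<pi> (eval (pCons c P)) = (scale_op c o\<^sub>L \<pi> p) + (\<pi> u o\<^sub>L \<pi> (eval P))"
    using hom by (simp add: eval_pCons star_hom_def smult_in m_closed p_closed u_closed eval_closed)
  then show ?case
    using pCons ev by (auto simp: blinfun.add_left lin algebra_simps intro!: ell2_eqI)
qed

text \<open>
  An eigenvector \<open>\<delta>\<close> of \<open>\<pi>(u)\<close> is mapped to a multiple of itself by every polynomial in \<open>u\<close>.  Contractivity of
  \<open>\<pi>\<close> extends this to limits of Laurent polynomials, with control of the eigenvalue.  The eigenvalue of an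
  idempotent is idempotent.
\<close>

lemma star_hom_idempotent_character:
  fixes \<pi> :: "'a \<Rightarrow> 'i ell2_op"
  assumes hom: "star_hom A ell2_algebra \<pi>"
    and ev: "\<pi> p (basis_vector i) = basis_vector i" "\<pi> u (basis_vector i) = scale_ell2 w (basis_vector i)"
    and w: "cmod w = 1"
    and e: "laurent_approximable e" "p \<otimes> e = e" "e \<otimes> p = e" "e \<otimes> e = e"
  obtains \<kappa> where "\<kappa> = 0 \<or> \<kappa> = 1" "\<pi> e (basis_vector i) = scale_ell2 \<kappa> (basis_vector i)"
    "\<And>m P. cmod (w ^ m * \<kappa> - poly P w) \<le> cnorm A (upow m \<otimes> e \<ominus> eval P)"
proof -
  let ?\<delta> = "basis_vector i"
  have A: "cstar_algebra A" by unfold_locales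
  have ec: "e \<in> carrier A" using e by (simp add: laurent_approximable_def)
  have lin: "\<pi> e (scale_ell2 a x) = scale_ell2 a (\<pi> e x)" for a x
    using hom ec by (auto simp: star_hom_def ell2_algebra_carrier complex_linear_def Pi_iff)
  have comm: "e \<otimes> u = u \<otimes> e" by (rule laurent_approximable_commute_u) (use e in auto)
  have bound: "norm (scale_ell2 (w ^ m) (\<pi> e ?\<delta>) - scale_ell2 (poly P w) ?\<delta>)
      \<le> cnorm A (upow m \<otimes> e \<ominus> eval P)" for m P
  proof -
    let ?d = "upow m \<otimes> e \<ominus> eval P"
    have d: "?d \<in> carrier A" by (simp add: ec m_closed eval_closed)
    have "?d = e \<otimes> upow m \<oplus> (-1) \<odot> eval P"
      using commute_eval[OF ec e(2,3) comm, of "monom 1 m"] ec by (simp add: minus_smult m_closed eval_closed)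
    then have "\<pi> ?d = (\<pi> e o\<^sub>L \<pi> (upow m)) + (scale_op (-1) o\<^sub>L \<pi> (eval P))"
      using hom ec by (simp add: star_hom_def m_closed eval_closed smult_in)
    then have "\<pi> ?d ?\<delta> = scale_ell2 (w ^ m) (\<pi> e ?\<delta>) + scale_ell2 (-1) (scale_ell2 (poly P w) ?\<delta>)"
      by (simp add: blinfun.add_left star_hom_eval[OF hom ev] lin poly_monom)
    also have "\<dots> = scale_ell2 (w ^ m) (\<pi> e ?\<delta>) - scale_ell2 (poly P w) ?\<delta>"
      by (auto intro!: ell2_eqI)
    finally have "norm (scale_ell2 (w ^ m) (\<pi> e ?\<delta>) - scale_ell2 (poly P w) ?\<delta>) \<le> norm (\<pi> ?d) * norm ?\<delta>"
      using norm_blinfun[of "\<pi> ?d" ?\<delta>] by simp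
    then show ?thesis
      using star_hom_contractive[OF A hom d] by (simp add: norm_basis_vector)
  qed
  define \<kappa> where "\<kappa> = coord (\<pi> e ?\<delta>) i"
  have "coord (\<pi> e ?\<delta>) j = 0" if "j \<noteq> i" for j
  proof -
    have "cmod (coord (\<pi> e ?\<delta>) j) \<le> 0 + \<epsilon>" if \<epsilon>: "0 < \<epsilon>" for \<epsilon>
    proof -
      obtain m P where mP: "cnorm A (upow m \<otimes> e \<ominus> eval P) < \<epsilon>"
        using e(1) \<epsilon> unfolding laurent_approximable_def by blast
      have "cmod (coord (scale_ell2 (w ^ m) (\<pi> e ?\<delta>) - scale_ell2 (poly P w) ?\<delta>) j) < \<epsilon>"
        using coord_le_norm bound[of m P] mP by (meson le_less_trans)
      then show ?thesis
        using \<open>j \<noteq> i\<close> w by (simp add: coord_basis_vector norm_mult norm_power)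
    qed
    then have "cmod (coord (\<pi> e ?\<delta>) j) \<le> 0" by (rule field_le_epsilon)
    then show ?thesis by simp
  qed
  then have e\<delta>: "\<pi> e ?\<delta> = scale_ell2 \<kappa> ?\<delta>"
    by (intro ell2_eqI) (auto simp: \<kappa>_def coord_basis_vector)
  have "\<pi> e = \<pi> e o\<^sub>L \<pi> e"
    using hom ec e(4) by (auto simp: star_hom_def) metis
  then have "scale_ell2 \<kappa> ?\<delta> = \<pi> e (\<pi> e ?\<delta>)" by (metis blinfun_apply_blinfun_compose e\<delta>)
  then have "scale_ell2 \<kappa> ?\<delta> = scale_ell2 \<kappa> (scale_ell2 \<kappa> ?\<delta>)" by (simp add: e\<delta> lin)
  then have "coord (scale_ell2 \<kappa> ?\<delta>) i = coord (scale_ell2 \<kappa> (scale_ell2 \<kappa> ?\<delta>)) i" by simp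
  then have "\<kappa> = \<kappa> * \<kappa>" by (simp add: coord_basis_vector)
  then have 01: "\<kappa> = 0 \<or> \<kappa> = 1" by auto
  have "cmod (w ^ m * \<kappa> - poly P w) \<le> cnorm A (upow m \<otimes> e \<ominus> eval P)" for m P
  proof -
    have "cmod (coord (scale_ell2 (w ^ m) (\<pi> e ?\<delta>) - scale_ell2 (poly P w) ?\<delta>) i)
        \<le> cnorm A (upow m \<otimes> e \<ominus> eval P)"
      using coord_le_norm bound[of m P] by (rule order_trans)
    then show ?thesis by (simp add: e\<delta> coord_basis_vector)
  qed
  then show thesis using that 01 e\<delta> by blast
qed

end

context cycle_without_exit
begin

lemma infinite_path_cycle: "infinite_path G (cycle \<mu>)"
proof -
  have nth: "cycle \<mu> !! k = \<mu> ! (k mod length \<mu>)" for k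
    using cycle_ne by (simp add: sdrop_cycle hd_rotate_conv_nth flip: sdrop_simps(1))
  have "cycle \<mu> !! k \<in> arcs G \<and> head G (cycle \<mu> !! k) = tail G (cycle \<mu> !! Suc k)" for k
  proof -
    have k: "k mod length \<mu> < length \<mu>" using cycle_ne by simp
    then have "\<mu> ! (k mod length \<mu>) \<in> arcs G" using cycle_arcs nth_mem by blast
    moreover have "Suc (k mod length \<mu>) < length \<mu> \<or> Suc (k mod length \<mu>) = length \<mu>"
      using k by linarith
    then have "head G (\<mu> ! (k mod length \<mu>)) = tail G (\<mu> ! (Suc k mod length \<mu>))"
      using head_cycle[OF k] cycle_ne by (auto simp: mod_Suc hd_conv_nth)
    ultimately show ?thesis by (simp only: nth)
  qed
  then show ?thesis by (simp add: infinite_path_def)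
qed

lemma infinite_path_shift:
  "G.awalk w \<beta> base \<Longrightarrow> infinite_path G (\<beta> @- cycle \<mu>) \<and> tail G (shd (\<beta> @- cycle \<mu>)) = w"
  by (induction \<beta> arbitrary: w)
    (auto simp: G.awalk_Nil_iff awalk_Cons infinite_path_SCons infinite_path_cycle)

lemma representation_path_elem:
  assumes hom: "star_hom A ell2_algebra \<pi>" and \<pi>p: "\<And>v. v \<in> verts G \<Longrightarrow> \<pi> (p v) = vertex_op G v"
    and \<pi>s: "\<And>e. e \<in> arcs G \<Longrightarrow> \<pi> (s e) = scale_op z o\<^sub>L edge_op G e"
  shows "G.awalk w \<beta> base \<Longrightarrow> \<pi> (path_elem base \<beta>) (basis_vector (cycle \<mu>))
    = scale_ell2 (z ^ length \<beta>) (basis_vector (\<beta> @- cycle \<mu>))"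
proof (induction \<beta> arbitrary: w)
  case Nil
  have "\<pi> (p base) (basis_vector (cycle \<mu>)) = basis_vector (cycle \<mu>)"
    using vertex_op_basis_vector[OF infinite_path_cycle] by (simp add: \<pi>p base_vert)
  then show ?case by (auto intro!: ell2_eqI)
next
  case (Cons e \<beta>)
  then have e: "e \<in> arcs G" "G.awalk (head G e) \<beta> base" by (auto simp: awalk_Cons)
  have lin: "edge_op G e (scale_ell2 a x) = scale_ell2 a (edge_op G e x)" for a x
    using edge_op_carrier[of G e] by (simp add: ell2_algebra_carrier complex_linear_def)
  have "infinite_path G (e ## (\<beta> @- cycle \<mu>))"
    using infinite_path_shift[OF Cons.prems] by simp
  then have eb: "edge_op G e (basis_vector (\<beta> @- cycle \<mu>)) = basis_vector (e ## (\<beta> @- cycle \<mu>))"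
    by (rule edge_op_basis_vector)
  have "\<pi> (path_elem base (e # \<beta>)) = (scale_op z o\<^sub>L edge_op G e) o\<^sub>L \<pi> (path_elem base \<beta>)"
    using hom e by (simp add: star_hom_def s_closed path_elem_closed[OF e(2)] \<pi>s[symmetric])
  then show ?case
    using Cons.IH[OF e(2)] by (auto simp: lin eb intro!: ell2_eqI)
qed

text \<open>
  Prefixing the cycle to the periodic path changes nothing.  A twist by \<open>z\<close> multiplies the eigenvalue by \<open>z\<^sup>n\<close>
  where \<open>n\<close> is the length of the cycle, and every \<open>w\<close> on the circle is such a power.
\<close>

lemma cycle_eigenvector_representation:
  assumes A: "graph_cstar_algebra G A p s" and w: "cmod w = 1"
  obtains \<pi> :: "'a \<Rightarrow> 'e stream ell2_op" where "star_hom A ell2_algebra \<pi>"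
    "\<pi> (p base) (basis_vector (cycle \<mu>)) = basis_vector (cycle \<mu>)"
    "\<pi> u (basis_vector (cycle \<mu>)) = scale_ell2 w (basis_vector (cycle \<mu>))"
proof -
  define n where "n = length \<mu>"
  have n: "0 < n" using cycle_ne by (simp add: n_def)
  define z where "z = cis (Arg w / real n)"
  have "w \<noteq> 0" using w by auto
  then have zn: "z ^ n = w"
    using n w by (simp add: z_def Complex.DeMoivre cis_Arg sgn_eq)
  have z1: "cmod z = 1" by (simp add: z_def)
  obtain \<pi> where \<pi>: "star_hom A ell2_algebra \<pi>" "\<And>v. v \<in> verts G \<Longrightarrow> \<pi> (p v) = vertex_op G v"
    "\<And>e. e \<in> arcs G \<Longrightarrow> \<pi> (s e) = scale_op z o\<^sub>L edge_op G e"
    using infinite_path_representation[OF G.wf_digraph_axioms A z1] by blast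
  show thesis
  proof (rule that[OF \<pi>(1)])
    show "\<pi> (p base) (basis_vector (cycle \<mu>)) = basis_vector (cycle \<mu>)"
      using vertex_op_basis_vector[OF infinite_path_cycle] by (simp add: \<pi>(2) base_vert)
    show "\<pi> u (basis_vector (cycle \<mu>)) = scale_ell2 w (basis_vector (cycle \<mu>))"
      using representation_path_elem[OF \<pi> awalk_cycle] cycle_decomp[OF cycle_ne] zn
      by (simp add: u_def n_def)
  qed
qed

text \<open>
  The element \<open>a = p - u\<close> violates the Zorn property.  At the eigenvalue \<open>w = -1\<close> it acts as \<open>2\<close>, so it is
  not nilpotent.  An idempotent \<open>f = ab\<close> is cut down to the corner as \<open>e = fp\<close>; there \<open>e = b'a\<close> with
  \<open>b' = pbp\<close>, so \<open>e\<close> kills the eigenvector for \<open>w = 1\<close>, and the eigenvalues of \<open>e\<close> at the other \<open>w\<close> cannot jump from \<open>0\<close> to \<open>1\<close>.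
\<close>

theorem not_zorn_ring:
  assumes A: "graph_cstar_algebra G A p s"
  shows "\<not> zorn_ring A"
proof
  assume zorn: "zorn_ring A"
  let ?\<delta> = "basis_vector (cycle \<mu>)"
  have gen: "generates A (p ` verts G \<union> s ` arcs G)" using A by (simp add: graph_cstar_algebra_def)
  define q where "q = p base"
  have q: "q \<in> carrier A" "q \<otimes> q = q" using base_vert by (simp_all add: q_def vertex_closed vertex_idem)
  have approx: "laurent_approximable (q \<otimes> x \<otimes> q)" if "x \<in> carrier A" for x
    using corner_laurent_approximable[OF gen that] by (simp add: q_def)
  define D :: "complex poly" where "D = [:1, -1:]"
  define a where "a = eval D"
  have a: "a \<in> carrier A" "q \<otimes> a = a" "a \<otimes> q = a"
    by (simp_all add: a_def eval_closed q_def p_eval eval_p)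
  have "\<not> nilpotent_elem A a"
  proof
    assume "nilpotent_elem A a"
    then obtain n where n: "((\<lambda>x. a \<otimes> x) ^^ n) a = \<zero>" by (auto simp: nilpotent_elem_def)
    have "((\<lambda>x. a \<otimes> x) ^^ k) a = eval (D ^ Suc k)" for k
      by (induction k) (simp_all add: a_def eval_mult eval_closed eval_p eval_1)
    with n have 0: "eval (D ^ Suc n) = eval 0" by (simp add: eval_0)
    obtain \<pi> :: "'a \<Rightarrow> 'e stream ell2_op" where hom: "star_hom A ell2_algebra \<pi>"
      and ev: "\<pi> (p base) ?\<delta> = ?\<delta>" "\<pi> u ?\<delta> = scale_ell2 (-1) ?\<delta>"
      using cycle_eigenvector_representation[OF A, of "-1"] by auto
    have "scale_ell2 (poly (D ^ Suc n) (-1)) ?\<delta> = scale_ell2 (poly 0 (-1)) ?\<delta>"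
      using star_hom_eval[OF hom ev] 0 by metis
    then have "coord (scale_ell2 (poly (D ^ Suc n) (-1)) ?\<delta>) (cycle \<mu>)
        = coord (scale_ell2 (poly 0 (-1)) ?\<delta>) (cycle \<mu>)" by (rule arg_cong)
    then show False by (simp add: coord_basis_vector D_def)
  qed
  then obtain b where b: "b \<in> carrier A" and idem: "idempotent_elem A (a \<otimes> b)" and nz: "a \<otimes> b \<noteq> \<zero>"
    using zorn a by (auto simp: zorn_ring_def)
  define f where "f = a \<otimes> b"
  have f: "f \<in> carrier A" "f \<otimes> f = f" "q \<otimes> f = f"
    using idem a b q by (auto simp: f_def idempotent_elem_def m_closed simp flip: m_assoc)
  define e where "e = f \<otimes> q"
  have ec: "e \<in> carrier A" using f q by (simp add: e_def m_closed)
  have qe: "q \<otimes> e = e" "e \<otimes> q = e"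
    using f q by (simp add: e_def flip: m_assoc, simp add: e_def m_assoc)
  have ee: "e \<otimes> e = e"
  proof -
    have "e \<otimes> e = (f \<otimes> (q \<otimes> f)) \<otimes> q" using f(1) q(1) by (simp add: e_def m_assoc m_closed)
    then show ?thesis using f by (simp add: e_def)
  qed
  have e0: "e \<noteq> \<zero>"
  proof
    assume "e = \<zero>"
    \<comment> \<open>\<open>fq = 0\<close> would give \<open>f = ff = f(qf) = 0\<close>\<close>
    then have "f \<otimes> (q \<otimes> f) = \<zero>" using f(1) q(1) by (simp add: e_def zero_mult flip: m_assoc)
    then show False using f nz by (simp add: f_def)
  qed
  have e_approx: "laurent_approximable e"
    using approx[OF f(1)] f by (simp add: e_def)
  define b' where "b' = q \<otimes> b \<otimes> q"
  have b': "b' \<in> carrier A" "q \<otimes> b' = b'" "b' \<otimes> q = b'"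
    using b q by (simp_all add: b'_def m_closed m_assoc) (simp_all add: m_closed flip: m_assoc)
  have "b' \<otimes> u = u \<otimes> b'"
    using laurent_approximable_commute_u[of b'] approx[OF b] b' by (simp add: b'_def q_def)
  then have "b' \<otimes> a = a \<otimes> b'"
    unfolding a_def using b' by (intro commute_eval) (simp_all add: q_def)
  also have "a \<otimes> b' = e"
    using a b q by (simp add: b'_def e_def f_def m_closed flip: m_assoc)
  finally have e_eq: "e = b' \<otimes> a" ..
  obtain m P where mP: "cnorm A (upow m \<otimes> e \<ominus> eval P) < 1 / 4"
    using e_approx unfolding laurent_approximable_def by (metis zero_less_divide_1_iff zero_less_numeral)
  have dichotomy: "cmod (poly P w) < 1 / 4 \<or> 3 / 4 < cmod (poly P w)" and at_1: "w = 1 \<Longrightarrow> cmod (poly P w) < 1 / 4"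
    if w: "cmod w = 1" for w
  proof -
    obtain \<pi> :: "'a \<Rightarrow> 'e stream ell2_op" where hom: "star_hom A ell2_algebra \<pi>"
      and ev: "\<pi> (p base) ?\<delta> = ?\<delta>" "\<pi> u ?\<delta> = scale_ell2 w ?\<delta>"
      using cycle_eigenvector_representation[OF A w] by blast
    obtain \<kappa> where \<kappa>: "\<kappa> = 0 \<or> \<kappa> = 1" "\<pi> e ?\<delta> = scale_ell2 \<kappa> ?\<delta>"
      "\<And>m P. cmod (w ^ m * \<kappa> - poly P w) \<le> cnorm A (upow m \<otimes> e \<ominus> eval P)"
      using star_hom_idempotent_character[OF hom ev w e_approx] qe ee unfolding q_def by blast
    have near: "cmod (w ^ m * \<kappa> - poly P w) < 1 / 4" using \<kappa>(3)[of m P] mP by linarith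
    have wm: "cmod (w ^ m) = 1" using w by (simp add: norm_power)
    show "cmod (poly P w) < 1 / 4 \<or> 3 / 4 < cmod (poly P w)"
      using \<kappa>(1)
    proof
      assume "\<kappa> = 1"
      then show ?thesis
        using near wm norm_triangle_sub[of "w ^ m" "poly P w"] by simp
    qed (use near in simp)
    show "cmod (poly P w) < 1 / 4" if "w = 1"
    proof -
      have "\<pi> e = \<pi> b' o\<^sub>L \<pi> a" using hom b' a by (simp add: e_eq star_hom_def)
      moreover have "\<pi> a ?\<delta> = scale_ell2 0 ?\<delta>"
        unfolding a_def using star_hom_eval[OF hom ev] \<open>w = 1\<close> by (simp add: D_def)
      moreover have "scale_ell2 0 ?\<delta> = 0" by (auto intro!: ell2_eqI)
      ultimately have "scale_ell2 \<kappa> ?\<delta> = 0" using \<kappa>(2) by simp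
      then have "coord (scale_ell2 \<kappa> ?\<delta>) (cycle \<mu>) = 0" by simp
      then have "\<kappa> = 0" by (simp add: coord_basis_vector)
      then show ?thesis using near by simp
    qed
  qed
  have "cmod (poly P w) \<le> 1 / 4" if w: "cmod w = 1" for w
  proof (rule ccontr)
    assume "\<not> cmod (poly P w) \<le> 1 / 4"
    then have big: "3 / 4 < cmod (poly P w)" using dichotomy[OF w] by auto
    have "connected ((\<lambda>w. cmod (poly P w)) ` sphere 0 1)"
      by (intro connected_continuous_image connected_sphere continuous_intros) simp
    then have "1 / 2 \<in> (\<lambda>w. cmod (poly P w)) ` sphere 0 1"
    proof (rule connectedD_interval)
      show "cmod (poly P 1) \<in> (\<lambda>w. cmod (poly P w)) ` sphere 0 1" by simp
      show "cmod (poly P w) \<in> (\<lambda>w. cmod (poly P w)) ` sphere 0 1" using w by simp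
      show "cmod (poly P 1) \<le> 1 / 2" using at_1[of 1] by simp
      show "1 / 2 \<le> cmod (poly P w)" using big by simp
    qed
    then obtain w' where "cmod w' = 1" "cmod (poly P w') = 1 / 2" by (auto simp: image_iff)
    then show False using dichotomy[of w'] by simp
  qed
  then have "e = \<zero>"
    using idempotent_near_small_laurent_eq_0[of e m P] ec qe ee mP
      laurent_approximable_commute_u[OF e_approx] by (simp add: q_def)
  then show False using e0 by contradiction
qed

end

theorem proposition4:
  fixes G :: "('v, 'e) pre_digraph"
    and A :: "'a star_algebra"
    and p :: "'v \<Rightarrow> 'a" and s :: "'e \<Rightarrow> 'a"
  assumes "wf_digraph G"
    and "graph_cstar_algebra G A p s"
    and "zorn_ring A"
  shows "condition_L G"
  unfolding condition_L_def
proof (intro allI impI)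
  fix \<mu> assume \<mu>: "simple_closed_path G \<mu>"
  show "\<exists>e. is_exit G \<mu> e"
  proof (rule ccontr)
    assume no_exit: "\<nexists>e. is_exit G \<mu> e"
    have "cycle_without_exit A G p s \<mu>"
      using assms \<mu> no_exit
      by (simp add: cycle_without_exit_def cycle_without_exit_axioms_def cuntz_krieger_family_def
          cuntz_krieger_family_axioms_def graph_cstar_algebra_def)
    then show False using cycle_without_exit.not_zorn_ring assms by blast
  qed
qed

end
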